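(* Let $T$ be a linear operator on $L^2(\mathbb{R}^3,\mathbb{H})$ that commutes with the natural representation of $\mathfrak{G}=r\mathrm{Spin}(3)+\mathbb{R}^3$, i.e. $T\pi(r,s,b)=\pi(r,s,b)T$ for all $(r,s,b)\in\mathfrak{G}$. Then $T$ is of the form $\lambda I+\mu H$, where $\lambda,\mu$ are complex numbers, $I$ is the identity and $H$ is the Hilbert transformation. Moreover, if $T$ is self-adjoint with norm $1$, then $T$ is one of $\pm I$, $\pm H$.
   Context: $\mathbb{H}$ denotes the quaternions with units $e_1,e_2,e_3$, $e_j^2=-1$, $e_3=e_1e_2$, $e_je_k=-e_ke_j$ for $j\ne k$; all function values are in $\mathbb{H}\otimes_{\mathbb{R}}\mathbb{C}$ with $i$ commuting with the $e_j$, so $L^2(\mathbb{R}^3,\mathbb{H})$ is a complex Hilbert space. $x\in\mathbb{R}^3$ is identified with $\underline{x}=x_1e_1+x_2e_2+x_3e_3$. $\mathrm{Spin}(3)$ is the group of unit quaternions, and $\mathfrak{G}$ is the group of triples $(r,s,b)$, $r>0$, $s\in\mathrm{Spin}(3)$, $b\in\mathbb{R}^3$, with product $(r,s,b)(r',s',b')=(rr',ss',rsb's^{-1}+b)$. Its natural representation on $L^2(\mathbb{R}^3,\mathbb{H})$ is $(\pi(r,s,b)f)(\underline{x})=r^{-3/2}sf(\frac1r s^{-1}(\underline{x}-b)s)$. The Hilbert transformation is $Hf(\underline{x})=c_3\,\mathrm{p.v.}\!\int_{\mathbb{R}^3}\frac{\underline{x}-\underline{y}}{|\underline{x}-\underline{y}|^{4}}f(\underline{y})\,d\underline{y}$,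 with $c_3=1/\pi^2$, so that $H^2=I$.
   Formalization: "Linear" is taken as right-linear over the complexified quaternions (else f ↦ f e₁ is a counterexample), and "norm 1" as norm-preserving, ‖Tf‖ = ‖f‖ (else the projection (I+H)/2, self-adjoint of operator norm 1, is a counterexample). *)

theory Defs
  imports "HOL-Analysis.Analysis"
begin

text \<open>
  An element of the complexified quaternions is a vector of four complex coordinates with respect
  to the basis \<open>e\<^sub>0 = 1, e\<^sub>1, e\<^sub>2, e\<^sub>3\<close>. The index type \<open>4\<close> consists of
  the residues \<open>0, 1, 2, 3\<close>, so that the numeral \<open>4 :: 4\<close> also denotes the scalar
  coordinate \<open>0\<close>. The norm of the type is \<open>sqrt (\<Sum>j. (cmod (q $ j))\<^sup>2)\<close>.
\<close>

type_synonym biquat = "complex ^ 4"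

definition qmult :: "biquat \<Rightarrow> biquat \<Rightarrow> biquat"  (infixl \<open>\<odot>\<close> 70) where
  "p \<odot> q = (\<chi> j.
     if j = 0 then p $ 0 * q $ 0 - p $ 1 * q $ 1 - p $ 2 * q $ 2 - p $ 3 * q $ 3
     else if j = 1 then p $ 0 * q $ 1 + p $ 1 * q $ 0 + p $ 2 * q $ 3 - p $ 3 * q $ 2
     else if j = 2 then p $ 0 * q $ 2 + p $ 2 * q $ 0 + p $ 3 * q $ 1 - p $ 1 * q $ 3
     else p $ 0 * q $ 3 + p $ 3 * q $ 0 + p $ 1 * q $ 2 - p $ 2 * q $ 1)"

text \<open>Quaternionic conjugation; it is complex linear and does not conjugate the coordinates.\<close>

definition qconj :: "biquat \<Rightarrow> biquat" where
  "qconj q = (\<chi> j. if j = 0 then q $ 0 else - q $ j)"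

text \<open>The identification of \<open>x\<close> with \<open>x\<^sub>1e\<^sub>1 + x\<^sub>2e\<^sub>2 + x\<^sub>3e\<^sub>3\<close>, and its left inverse.\<close>

definition qvec :: "real ^ 3 \<Rightarrow> biquat" where
  "qvec x = (\<chi> j. if j = 0 then 0 else if j = 1 then of_real (x $ 1)
                  else if j = 2 then of_real (x $ 2) else of_real (x $ 3))"

definition vec_of_q :: "biquat \<Rightarrow> real ^ 3" where
  "vec_of_q q = (\<chi> j. if j = 1 then Re (q $ 1) else if j = 2 then Re (q $ 2) else Re (q $ 3))"

text \<open>Unit quaternions: the coordinates are real.\<close>

definition Spin3 :: "biquat set" where
  "Spin3 = {s. (\<forall>j. s $ j \<in> \<real>) \<and> norm s = 1}"

text \<open>
  \<open>spin_rot s x\<close> is the vector \<open>s x s\<^sup>-\<^sup>1\<close>. For \<open>s\<close> in \<open>Spin3\<close> the inverse of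
  \<open>s\<close> is \<open>qconj s\<close>; see \<open>Spin3_inverse\<close> and \<open>qvec_spin_rot\<close> below.
\<close>

definition spin_rot :: "biquat \<Rightarrow> real ^ 3 \<Rightarrow> real ^ 3" where
  "spin_rot s x = vec_of_q (s \<odot> qvec x \<odot> qconj s)"

definition GG :: "(real \<times> biquat \<times> (real ^ 3)) set" where
  "GG = {(r, s, b). r > 0 \<and> s \<in> Spin3}"

fun GG_mult :: "real \<times> biquat \<times> (real ^ 3) \<Rightarrow> real \<times> biquat \<times> (real ^ 3) \<Rightarrow> real \<times> biquat \<times> (real ^ 3)" where
  "GG_mult (r, s, b) (r', s', b') = (r * r', s \<odot> s', r *\<^sub>R spin_rot s b' + b)"

text \<open>
  Elements of \<open>L\<^sup>2\<close> are represented by functions, equality in \<open>L\<^sup>2\<close> being equality almost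
  everywhere.
\<close>

definition L2 :: "(real ^ 3 \<Rightarrow> biquat) set" where
  "L2 = {f. f \<in> borel_measurable lborel \<and> integrable lborel (\<lambda>x. (norm (f x))\<^sup>2)}"

definition ae_eq :: "(real ^ 3 \<Rightarrow> biquat) \<Rightarrow> (real ^ 3 \<Rightarrow> biquat) \<Rightarrow> bool"  (infix \<open>=ae\<close> 50) where
  "f =ae g \<longleftrightarrow> (AE x in lborel. f x = g x)"

definition L2_inner :: "(real ^ 3 \<Rightarrow> biquat) \<Rightarrow> (real ^ 3 \<Rightarrow> biquat) \<Rightarrow> complex" where
  "L2_inner f g = (LINT x|lborel. (\<Sum>j\<in>UNIV. f x $ j * cnj (g x $ j)))"

definition L2_norm :: "(real ^ 3 \<Rightarrow> biquat) \<Rightarrow> real" where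
  "L2_norm f = sqrt (LINT x|lborel. (norm (f x))\<^sup>2)"

fun natural_rep :: "real \<times> biquat \<times> (real ^ 3) \<Rightarrow> (real ^ 3 \<Rightarrow> biquat) \<Rightarrow> real ^ 3 \<Rightarrow> biquat" where
  "natural_rep (r, s, b) f x =
     (r powr (-3/2)) *\<^sub>R (s \<odot> f ((1 / r) *\<^sub>R spin_rot (qconj s) (x - b)))"

text \<open>
  The principal value is the pointwise limit of the truncated integrals. Each truncated integral
  converges absolutely for \<open>f\<close> in \<open>L2\<close>, and the limit exists for almost every \<open>x\<close>.
\<close>

definition hilbert_trunc :: "real \<Rightarrow> (real ^ 3 \<Rightarrow> biquat) \<Rightarrow> real ^ 3 \<Rightarrow> biquat" where
  "hilbert_trunc \<epsilon> f x =
     (LINT y:{y. norm (x - y) > \<epsilon>}|lborel. (1 / norm (x - y) ^ 4) *\<^sub>R (qvec (x - y) \<odot> f y))"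

definition hilbert :: "(real ^ 3 \<Rightarrow> biquat) \<Rightarrow> real ^ 3 \<Rightarrow> biquat" where
  "hilbert f x = (1 / pi\<^sup>2) *\<^sub>R Lim (at_right 0) (\<lambda>\<epsilon>. hilbert_trunc \<epsilon> f x)"

text \<open>
  An everywhere defined linear operator on \<open>L\<^sup>2\<close>, given on representatives. Since
  \<open>L\<^sup>2\<close> is a right module over the complexified quaternions, linearity means right linearity.
  The scalars \<open>q\<close> include the complex numbers, so the operator is in particular complex linear.
  Complex linearity alone would admit the maps \<open>f \<mapsto> f q\<close>, which commute with the natural
  representation. Continuity is not assumed.
\<close>

definition L2_linear_operator :: "((real ^ 3 \<Rightarrow> biquat) \<Rightarrow> real ^ 3 \<Rightarrow> biquat) \<Rightarrow> bool" where
  "L2_linear_operator T \<longleftrightarrow>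
     (\<forall>f\<in>L2. T f \<in> L2) \<and>
     (\<forall>f\<in>L2. \<forall>g\<in>L2. f =ae g \<longrightarrow> T f =ae T g) \<and>
     (\<forall>f\<in>L2. \<forall>g\<in>L2. T (\<lambda>x. f x + g x) =ae (\<lambda>x. T f x + T g x)) \<and>
     (\<forall>f\<in>L2. \<forall>q. T (\<lambda>x. f x \<odot> q) =ae (\<lambda>x. T f x \<odot> q))"

definition L2_selfadjoint :: "((real ^ 3 \<Rightarrow> biquat) \<Rightarrow> real ^ 3 \<Rightarrow> biquat) \<Rightarrow> bool" where
  "L2_selfadjoint T \<longleftrightarrow> (\<forall>f\<in>L2. \<forall>g\<in>L2. L2_inner (T f) g = L2_inner f (T g))"

text \<open>
  An operator ``with norm 1'' is understood as a norm preserving one. For the operator norm the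
  classification of the self-adjoint intertwiners would fail: the Hardy projections
  \<open>(I \<plusminus> H) / 2\<close> are self-adjoint, of operator norm 1, and commute with the
  natural representation.
\<close>

definition L2_norm_preserving :: "((real ^ 3 \<Rightarrow> biquat) \<Rightarrow> real ^ 3 \<Rightarrow> biquat) \<Rightarrow> bool" where
  "L2_norm_preserving T \<longleftrightarrow> (\<forall>f\<in>L2. L2_norm (T f) = L2_norm f)"

definition commutes_with_rep :: "((real ^ 3 \<Rightarrow> biquat) \<Rightarrow> real ^ 3 \<Rightarrow> biquat) \<Rightarrow> bool" where
  "commutes_with_rep T \<longleftrightarrow>
     (\<forall>g\<in>GG. \<forall>f\<in>L2. T (natural_rep g f) =ae natural_rep g (T f))"


lemma forall_index4: "(\<forall>j::4. P j) \<longleftrightarrow> P 0 \<and> P 1 \<and> P 2 \<and> P 3"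
proof -
  have "(4::4) = 0" by simp
  then show ?thesis by (metis forall_4)
qed

lemma index4_neq [simp]:
  "(1::4) \<noteq> 0" "(2::4) \<noteq> 0" "(3::4) \<noteq> 0" "(2::4) \<noteq> 1" "(3::4) \<noteq> 1" "(3::4) \<noteq> 2"
  by simp_all

lemma sum_index4: "(\<Sum>j\<in>(UNIV::4 set). g j) = g 0 + g 1 + g 2 + g 3"
proof -
  have "(4::4) = 0" by simp
  then have "g 4 = g 0" by (rule arg_cong)
  then show ?thesis unfolding sum_4 by (simp add: ac_simps)
qed

lemma biquat_eq_iff:
  "(p::biquat) = q \<longleftrightarrow> p $ 0 = q $ 0 \<and> p $ 1 = q $ 1 \<and> p $ 2 = q $ 2 \<and> p $ 3 = q $ 3"
  by (simp add: vec_eq_iff forall_index4)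

lemmas q_defs = qmult_def qconj_def qvec_def vec_of_q_def biquat_eq_iff

lemma qmult_units:
  "axis 0 1 \<odot> q = q" "q \<odot> axis 0 1 = q"
  "axis 1 1 \<odot> axis 1 1 = - axis 0 1" "axis 2 1 \<odot> axis 2 1 = - axis 0 1"
  "axis 3 1 \<odot> axis 3 1 = - axis 0 1"
  "axis 1 1 \<odot> axis 2 1 = axis 3 1" "axis 2 1 \<odot> axis 1 1 = - axis 3 1"
  "axis 2 1 \<odot> axis 3 1 = axis 1 1" "axis 3 1 \<odot> axis 2 1 = - axis 1 1"
  "axis 3 1 \<odot> axis 1 1 = axis 2 1" "axis 1 1 \<odot> axis 3 1 = - axis 2 1"
  by (simp_all add: q_defs axis_def)

lemma qmult_assoc: "(p \<odot> q) \<odot> r = p \<odot> (q \<odot> r)"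
  by (simp add: q_defs algebra_simps)

lemma qconj_qmult: "qconj (p \<odot> q) = qconj q \<odot> qconj p"
  by (simp add: q_defs algebra_simps)

lemma qconj_qconj [simp]: "qconj (qconj q) = q"
  by (simp add: q_defs)

lemma Spin3_inverse:
  assumes "s \<in> Spin3"
  shows "s \<odot> qconj s = axis 0 1" "qconj s \<odot> s = axis 0 1"
proof -
  have re: "s $ j = of_real (Re (s $ j))" for j
    using assms by (simp add: Spin3_def complex_is_Real_iff complex_eq_iff)
  have "(cmod (s $ j))\<^sup>2 = (Re (s $ j))\<^sup>2" for j
    by (subst re) (simp del: of_real_Re)
  then have "(norm s)\<^sup>2 = (\<Sum>j\<in>UNIV. (Re (s $ j))\<^sup>2)"
    by (simp add: norm_vec_def L2_set_def sum_nonneg)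
  then have 1: "(Re (s $ 0))\<^sup>2 + (Re (s $ 1))\<^sup>2 + (Re (s $ 2))\<^sup>2 + (Re (s $ 3))\<^sup>2 = 1"
    using assms by (simp add: Spin3_def sum_index4)
  have im: "Im (s $ j) = 0" for j
    using assms by (simp add: Spin3_def complex_is_Real_iff)
  show "s \<odot> qconj s = axis 0 1" "qconj s \<odot> s = axis 0 1"
    using 1 by (simp_all add: q_defs axis_def complex_eq_iff im power2_eq_square)
qed

lemma qvec_spin_rot:
  assumes "s \<in> Spin3"
  shows "qvec (spin_rot s x) = s \<odot> qvec x \<odot> qconj s"
proof -
  have im: "Im (s $ j) = 0" for j
    using assms by (simp add: Spin3_def complex_is_Real_iff)
  show ?thesis
    by (simp add: spin_rot_def q_defs complex_eq_iff im algebra_simps)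
qed

lemma spin_rot_qmult:
  assumes "s \<in> Spin3" "t \<in> Spin3"
  shows "spin_rot (s \<odot> t) x = spin_rot s (spin_rot t x)"
  using qvec_spin_rot[OF assms(2), of x]
  by (simp add: spin_rot_def qconj_qmult qmult_assoc)

lemma spin_rot_one: "spin_rot (axis 0 1) x = x"
  by (simp add: spin_rot_def q_defs axis_def vec_eq_iff forall_3)

lemma spin_rot_diff: "spin_rot s (x - y) = spin_rot s x - spin_rot s y"
  by (simp add: spin_rot_def q_defs vec_eq_iff forall_3 algebra_simps)

lemma spin_rot_scaleR: "spin_rot s (c *\<^sub>R x) = c *\<^sub>R spin_rot s x"
  by (simp add: spin_rot_def q_defs vec_eq_iff forall_3 algebra_simps)

lemma qmult_scaleR_right: "p \<odot> (c *\<^sub>R q) = c *\<^sub>R (p \<odot> q)"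
  by (simp add: q_defs algebra_simps)

lemma qconj_Spin3:
  assumes "s \<in> Spin3"
  shows "qconj s \<in> Spin3"
proof -
  have "cmod (qconj s $ j) = cmod (s $ j)" for j
    by (simp add: qconj_def)
  then have "norm (qconj s) = norm s"
    by (simp add: norm_vec_def)
  then show ?thesis
    using assms by (auto simp: Spin3_def qconj_def)
qed

text \<open>The operators \<open>natural_rep\<close> do represent the group law of the triples.\<close>

lemma natural_rep_GG_mult:
  assumes "g \<in> GG" "h \<in> GG"
  shows "natural_rep g (natural_rep h f) = natural_rep (GG_mult g h) f"
proof -
  obtain r s b where g: "g = (r, s, b)" "r > 0" "s \<in> Spin3"
    using assms(1) by (auto simp: GG_def)
  obtain r' s' b' where h: "h = (r', s', b')" "r' > 0" "s' \<in> Spin3"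
    using assms(2) by (auto simp: GG_def)
  have inv: "spin_rot (qconj s) (spin_rot s y) = y" for y
    using spin_rot_qmult[OF qconj_Spin3[OF g(3)] g(3), of y]
    by (simp add: Spin3_inverse[OF g(3)] spin_rot_one)
  have arg: "(1 / r') *\<^sub>R spin_rot (qconj s') ((1 / r) *\<^sub>R spin_rot (qconj s) (x - b) - b')
      = (1 / (r * r')) *\<^sub>R spin_rot (qconj (s \<odot> s')) (x - (r *\<^sub>R spin_rot s b' + b))" for x
    using g(2) h(2)
    by (simp add: qconj_qmult spin_rot_qmult[OF qconj_Spin3[OF h(3)] qconj_Spin3[OF g(3)]]
        diff_diff_eq2[symmetric] spin_rot_diff spin_rot_scaleR inv scaleR_diff_right
        add.commute[of _ b] diff_diff_eq[symmetric] mult.commute)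
  show ?thesis
    using g(2) h(2)
    by (simp add: g(1) h(1) fun_eq_iff arg qmult_scaleR_right qmult_assoc powr_mult)
qed

end

theory Submission
  imports Defs "HOL-Probability.Probability"
begin

text \<open>
  An intertwiner is automatically bounded: the rotations about an axis provide infinitely many
  commuting projections with orthogonal ranges, a gliding hump bounds \<open>T\<close> on one of the ranges,
  and translations spread this to the whole space. So \<open>T\<close> has an adjoint \<open>A\<close>, again an intertwiner.

  Let \<open>P\<^sub>t\<close> be the Poisson kernel and \<open>Q\<^sub>t = H P\<^sub>t\<close> its conjugate. Invariance under the heat semigroup
  and the dilations determines the products of \<open>A P\<^sub>1\<close> with Gaussians up to two complex constants.
  Since \<open>A P\<^sub>1\<close> is also invariant under the spin group, \<open>A P\<^sub>1 = P\<^sub>1 l + Q\<^sub>1 m\<close>. Dilation, translation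
  and pairing with \<open>f\<close> express the Poisson average of \<open>T f\<close> by the Poisson and conjugate Poisson
  averages of \<open>f\<close>, and letting \<open>t\<close> tend to \<open>0\<close> at common Lebesgue points yields
  \<open>T = cnj l I + cnj m H\<close>; the truncated singular integrals differ from the conjugate Poisson averages
  by a null sequence. A self-adjoint isometry satisfies \<open>T\<^sup>2 = I\<close>, and testing on Poisson kernels makes
  \<open>l\<close>, \<open>m\<close> real with \<open>l\<^sup>2 + m\<^sup>2 = 1\<close> and \<open>l m = 0\<close>.
\<close>

section \<open>The Hilbert space of square integrable functions\<close>

text \<open>Everything happens on the side of \<open>x\<close>, without a Fourier transform: the
  image of one vector, the Poisson kernel, takes the place of the symbol of a multiplier. An
  intertwiner is determined by this image, because dilations, translations and right multiplication
  produce all kernels \<open>transl x (Pv t q)\<close>, and pairing with them recovers a function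
  almost everywhere. The adjoint carries this to arbitrary \<open>f\<close>: it moves the operator
  from \<open>f\<close>, about which nothing is known, to the kernel. Neither boundedness of
  \<open>hilbert\<close> on \<open>L2\<close> nor existence of the principal value is established
  beforehand. If \<open>m\<close> is nonzero, convergence of the Poisson averages of
  \<open>f\<close> and of \<open>T f\<close> forces the conjugate averages, and with them the
  truncated integrals, to converge; if \<open>m = 0\<close>, the value of \<open>hilbert f x\<close>
  is multiplied by zero. Likewise \<open>H\<^sup>2 = I\<close> enters only as the equality of the
  norms of \<open>Pv 1 (cq 1)\<close> and \<open>Qv 1 (cq 1)\<close>. The Poisson kernel is treated
  as a mixture of Gaussians because these form a convolution semigroup permuted by the dilations,
  which leaves only constants undetermined.\<close>

lemma L2_measurable [measurable_dest]: "f \<in> L2 \<Longrightarrow> f \<in> borel_measurable borel"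
  by (simp add: L2_def)

lemma L2_integrable: "f \<in> L2 \<Longrightarrow> integrable lborel (\<lambda>x. (norm (f x))\<^sup>2)"
  by (simp add: L2_def)

lemma L2I:
  assumes "f \<in> borel_measurable borel" "integrable lborel g" "\<And>x. (norm (f x))\<^sup>2 \<le> g x"
  shows "f \<in> L2"
  unfolding L2_def using assms
  by (auto intro: Bochner_Integration.integrable_bound[where f=g] simp: abs_of_nonneg order_trans[OF assms(3)])

lemma L2_dominated:
  assumes "f \<in> borel_measurable borel" "g \<in> L2" "\<And>x. norm (f x) \<le> c * norm (g x)"
  shows "f \<in> L2"
proof (rule L2I[OF assms(1)])
  show "integrable lborel (\<lambda>x. c\<^sup>2 * (norm (g x))\<^sup>2)"
    using L2_integrable[OF assms(2)] by simp
  show "(norm (f x))\<^sup>2 \<le> c\<^sup>2 * (norm (g x))\<^sup>2" for x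
    unfolding power_mult_distrib[symmetric] by (intro power_mono assms) simp
qed

lemma L2_zero [simp]: "(\<lambda>x. 0) \<in> L2"
  by (simp add: L2_def)

lemma norm_add_square_le: "(norm (a + b :: 'a::real_inner))\<^sup>2 \<le> 2 * (norm a)\<^sup>2 + 2 * (norm b)\<^sup>2"
  using zero_le_power2[of "norm (a - b)"]
  by (simp add: power2_norm_eq_inner inner_simps inner_commute)

lemma L2_add [intro]: "f \<in> L2 \<Longrightarrow> g \<in> L2 \<Longrightarrow> (\<lambda>x. f x + g x) \<in> L2"
  by (rule L2I[where g="\<lambda>x. 2 * (norm (f x))\<^sup>2 + 2 * (norm (g x))\<^sup>2"])
    (auto simp: L2_integrable norm_add_square_le)

lemma L2_scaleR [intro]: "f \<in> L2 \<Longrightarrow> (\<lambda>x. c *\<^sub>R f x) \<in> L2"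
  by (rule L2_dominated[of _ f "\<bar>c\<bar>"]) auto

lemma L2_uminus [intro]: "f \<in> L2 \<Longrightarrow> (\<lambda>x. - f x) \<in> L2"
  by (rule L2_dominated[of _ f 1]) auto

lemma L2_diff [intro]: "f \<in> L2 \<Longrightarrow> g \<in> L2 \<Longrightarrow> (\<lambda>x. f x - g x) \<in> L2"
  using L2_add[OF _ L2_uminus, of f g] by simp

lemma abs_inner_le: "\<bar>a \<bullet> b\<bar> \<le> (norm (a::'a::real_inner))\<^sup>2 + (norm b)\<^sup>2"
proof -
  have "\<bar>a \<bullet> b\<bar> \<le> norm a * norm b" by (rule Cauchy_Schwarz_ineq2)
  also have "\<dots> \<le> (norm a)\<^sup>2 + (norm b)\<^sup>2"
    proof -
    have "0 \<le> (norm a - norm b)\<^sup>2 + (norm a)\<^sup>2 + (norm b)\<^sup>2" by simp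
    then show ?thesis by (simp add: power2_diff)
  qed
  finally show ?thesis .
qed

lemma L2_inner_integrable [intro]:
  assumes "f \<in> L2" "g \<in> L2"
  shows "integrable lborel (\<lambda>x. f x \<bullet> g x)"
proof (rule Bochner_Integration.integrable_bound)
  show "integrable lborel (\<lambda>x. (norm (f x))\<^sup>2 + (norm (g x))\<^sup>2)"
    using assms by (simp add: L2_integrable)
  show "(\<lambda>x. f x \<bullet> g x) \<in> borel_measurable lborel"
    using assms[THEN L2_measurable] by simp
qed (use abs_inner_le in auto)

lemma ae_eq_refl [simp]: "f =ae f"
  by (simp add: ae_eq_def)

lemma ae_eq_sym: "f =ae g \<Longrightarrow> g =ae f"
  by (simp add: ae_eq_def eq_commute)

lemma ae_eq_trans [trans]: "f =ae g \<Longrightarrow> g =ae h \<Longrightarrow> f =ae h"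
  unfolding ae_eq_def by (auto elim: AE_mp)

\<comment> \<open>The quotient is partial, with a relation that is reflexive exactly on
  \<open>L2\<close>. The classes form a genuine Hilbert space, on which an operator given on
  representatives becomes a linear map and Riesz representation is available.\<close>
quotient_type Ltwo = "real ^ 3 \<Rightarrow> biquat" / partial: "\<lambda>f g. f \<in> L2 \<and> g \<in> L2 \<and> f =ae g"
  morphisms fun_of cls
proof (rule part_equivpI)
  show "\<exists>x. x \<in> L2 \<and> x \<in> L2 \<and> x =ae x" using L2_zero ae_eq_refl by blast
qed (auto intro!: sympI transpI intro: ae_eq_sym ae_eq_trans)

lemma fun_of_L2 [simp, intro]: "fun_of u \<in> L2"
  using Quotient3_rep_reflp[OF Quotient3_Ltwo] by auto

lemma cls_fun_of [simp]: "cls (fun_of u) = u"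
  using Quotient3_abs_rep[OF Quotient3_Ltwo] .

lemma cls_eq_iff: "f \<in> L2 \<Longrightarrow> g \<in> L2 \<Longrightarrow> cls f = cls g \<longleftrightarrow> f =ae g"
  using Quotient3_rel[OF Quotient3_Ltwo, of f g] by auto

lemma fun_of_cls: "f \<in> L2 \<Longrightarrow> fun_of (cls f) =ae f"
  by (metis cls_eq_iff cls_fun_of fun_of_L2)

lemma fun_of_measurable [measurable]: "fun_of u \<in> borel_measurable borel"
  by (rule L2_measurable) simp

text \<open>Only the real part of the hermitian inner product is used; right multiplication by
  \<open>\<i>\<close> recovers the imaginary part.\<close>

instantiation Ltwo :: real_inner
begin

lift_definition zero_Ltwo :: Ltwo is "\<lambda>x. 0" by simp

lift_definition plus_Ltwo :: "Ltwo \<Rightarrow> Ltwo \<Rightarrow> Ltwo" is "\<lambda>f g x. f x + g x"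
  by (auto simp: ae_eq_def)

lift_definition minus_Ltwo :: "Ltwo \<Rightarrow> Ltwo \<Rightarrow> Ltwo" is "\<lambda>f g x. f x - g x"
  by (auto simp: ae_eq_def)

lift_definition uminus_Ltwo :: "Ltwo \<Rightarrow> Ltwo" is "\<lambda>f x. - f x"
  by (auto simp: ae_eq_def)

lift_definition scaleR_Ltwo :: "real \<Rightarrow> Ltwo \<Rightarrow> Ltwo" is "\<lambda>c f x. c *\<^sub>R f x"
  by (auto simp: ae_eq_def)

lift_definition inner_Ltwo :: "Ltwo \<Rightarrow> Ltwo \<Rightarrow> real" is "\<lambda>f g. LINT x|lborel. f x \<bullet> g x"
proof -
  fix f f' g g' :: "real ^ 3 \<Rightarrow> biquat"
  assume *: "f \<in> L2 \<and> f' \<in> L2 \<and> f =ae f'" "g \<in> L2 \<and> g' \<in> L2 \<and> g =ae g'"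
  have "AE x in lborel. f x \<bullet> g x = f' x \<bullet> g' x"
    using conjunct2[OF conjunct2[OF *(1)]] conjunct2[OF conjunct2[OF *(2)]]
    unfolding ae_eq_def by eventually_elim simp
  then show "(LINT x|lborel. f x \<bullet> g x) = (LINT x|lborel. f' x \<bullet> g' x)"
    using * by (intro integral_cong_AE borel_measurable_inner) (auto dest: L2_measurable)
qed

definition norm_Ltwo :: "Ltwo \<Rightarrow> real" where "norm_Ltwo u = sqrt (u \<bullet> u)"
definition dist_Ltwo :: "Ltwo \<Rightarrow> Ltwo \<Rightarrow> real" where "dist_Ltwo u v = norm (u - v)"
definition sgn_Ltwo :: "Ltwo \<Rightarrow> Ltwo" where "sgn_Ltwo u = scaleR (inverse (norm u)) u"
definition uniformity_Ltwo :: "(Ltwo \<times> Ltwo) filter"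
  where "uniformity_Ltwo = (INF e\<in>{0<..}. principal {(x, y). dist x y < e})"
definition open_Ltwo :: "Ltwo set \<Rightarrow> bool"
  where "open_Ltwo U = (\<forall>x\<in>U. eventually (\<lambda>(x', y). x' = x \<longrightarrow> y \<in> U) uniformity)"

instance
proof
  fix u v w :: Ltwo and a b :: real
  show "dist u v = norm (u - v)" "sgn u = inverse (norm u) *\<^sub>R u" "norm u = sqrt (u \<bullet> u)"
    by (simp_all add: dist_Ltwo_def sgn_Ltwo_def norm_Ltwo_def)
  show "(uniformity::(Ltwo \<times> Ltwo) filter) = (INF e\<in>{0<..}. principal {(x, y). dist x y < e})"
    by (rule uniformity_Ltwo_def)
  show "open U = (\<forall>x\<in>U. eventually (\<lambda>(x', y). x' = x \<longrightarrow> y \<in> U) uniformity)" for U :: "Ltwo set"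
    by (rule open_Ltwo_def)
  show "u + v + w = u + (v + w)" by transfer (auto simp: add.assoc)
  show "u + v = v + u" by transfer (auto simp: add.commute)
  show "0 + u = u" by transfer auto
  show "- u + u = 0" by transfer auto
  show "u - v = u + - v" by transfer auto
  show "a *\<^sub>R (u + v) = a *\<^sub>R u + a *\<^sub>R v" by transfer (auto simp: scaleR_add_right)
  show "(a + b) *\<^sub>R u = a *\<^sub>R u + b *\<^sub>R u" by transfer (auto simp: scaleR_add_left)
  show "a *\<^sub>R b *\<^sub>R u = (a * b) *\<^sub>R u" by transfer auto
  show "1 *\<^sub>R u = u" by transfer auto
  show "u \<bullet> v = v \<bullet> u" by transfer (simp add: inner_commute)
  show "(u + v) \<bullet> w = u \<bullet> w + v \<bullet> w"
    by transfer (simp add: inner_add_left L2_inner_integrable)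
  show "(a *\<^sub>R u) \<bullet> v = a * (u \<bullet> v)" by transfer simp
  show "0 \<le> u \<bullet> u" by transfer simp
  show "u \<bullet> u = 0 \<longleftrightarrow> u = 0"
  proof transfer
    fix f assume "f \<in> L2 \<and> f \<in> L2 \<and> f =ae f"
    then have f: "f \<in> L2" by simp
    then have "(LINT x|lborel. f x \<bullet> f x) = 0 \<longleftrightarrow> (AE x in lborel. f x \<bullet> f x = 0)"
      by (intro integral_nonneg_eq_0_iff_AE) auto
    then show "(LINT x|lborel. f x \<bullet> f x) = 0 \<longleftrightarrow> f \<in> L2 \<and> (\<lambda>x. 0) \<in> L2 \<and> f =ae (\<lambda>x. 0)"
      using f by (simp add: ae_eq_def)
  qed
qed

end

lemma cls_add: "f \<in> L2 \<Longrightarrow> g \<in> L2 \<Longrightarrow> cls f + cls g = cls (\<lambda>x. f x + g x)"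
  by (rule plus_Ltwo.abs_eq) auto

lemma cls_diff: "f \<in> L2 \<Longrightarrow> g \<in> L2 \<Longrightarrow> cls f - cls g = cls (\<lambda>x. f x - g x)"
  by (rule minus_Ltwo.abs_eq) auto

lemma cls_scaleR: "f \<in> L2 \<Longrightarrow> c *\<^sub>R cls f = cls (\<lambda>x. c *\<^sub>R f x)"
  by (rule scaleR_Ltwo.abs_eq) auto

lemma inner_cls: "f \<in> L2 \<Longrightarrow> g \<in> L2 \<Longrightarrow> cls f \<bullet> cls g = (LINT x|lborel. f x \<bullet> g x)"
  by (rule inner_Ltwo.abs_eq) auto

lemma inner_cls_right: "g \<in> L2 \<Longrightarrow> u \<bullet> cls g = (LINT x|lborel. fun_of u x \<bullet> g x)"
  using inner_cls[OF fun_of_L2, of g u] by simp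

lemma norm_cls_square: "f \<in> L2 \<Longrightarrow> (norm (cls f))\<^sup>2 = (LINT x|lborel. (norm (f x))\<^sup>2)"
  by (simp add: power2_norm_eq_inner inner_cls)

lemma nn_integral_L2: "f \<in> L2 \<Longrightarrow> (\<integral>\<^sup>+x. ennreal ((norm (f x))\<^sup>2) \<partial>lborel) = ennreal ((norm (cls f))\<^sup>2)"
  by (subst nn_integral_eq_integral) (auto simp: L2_integrable norm_cls_square)

lemma L2_nnI:
  assumes "f \<in> borel_measurable borel" "(\<integral>\<^sup>+x. ennreal ((norm (f x))\<^sup>2) \<partial>lborel) < \<infinity>"
  shows "f \<in> L2"
  using assms by (auto simp: L2_def integrable_iff_bounded)

section \<open>Completeness of the space of classes\<close>

lemma Cauchy_geometric_subseq:
  fixes X :: "nat \<Rightarrow> 'a::metric_space"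
  assumes "Cauchy X"
  obtains r where "strict_mono (r :: nat \<Rightarrow> nat)"
    "\<And>k m n. m \<ge> r k \<Longrightarrow> n \<ge> r k \<Longrightarrow> dist (X m) (X n) < (1/4) ^ k"
proof -
  have ex: "\<exists>M. \<forall>m\<ge>M. \<forall>n\<ge>M. dist (X m) (X n) < (1/4) ^ k" for k :: nat
    using metric_CauchyD[OF assms, of "(1/4)^k"] by auto
  define M where "M k = (SOME M. \<forall>m\<ge>M. \<forall>n\<ge>M. dist (X m) (X n) < (1/4) ^ k)" for k
  have M: "dist (X m) (X n) < (1/4) ^ k" if "m \<ge> M k" "n \<ge> M k" for k m n
    using someI_ex[OF ex[of k]] that unfolding M_def[symmetric] by blast
  define r where "r k = k + (\<Sum>j\<le>k. M j)" for k
  have "strict_mono r" by (rule strict_monoI_Suc) (simp add: r_def)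
  moreover have "M k \<le> r k" for k
    by (simp add: r_def trans_le_add2 member_le_sum)
  ultimately show ?thesis using that M order_trans by blast
qed

text \<open>The theorem of Riesz and Fischer: a rapidly converging subsequence converges almost
  everywhere, Fatou's lemma turns this into convergence in norm, and a Cauchy sequence follows its
  subsequence.\<close>

instance Ltwo :: complete_space
proof
  fix X :: "nat \<Rightarrow> Ltwo" assume "Cauchy X"
  then obtain r where r: "strict_mono r"
    and rd: "\<And>k m n. m \<ge> r k \<Longrightarrow> n \<ge> r k \<Longrightarrow> dist (X m) (X n) < (1/4) ^ k"
    by (rule Cauchy_geometric_subseq) blast
  define F where "F k = fun_of (X (r k))" for k
  have F [simp]: "F k \<in> L2" for k by (simp add: F_def)
  have Fm [measurable]: "F k \<in> borel_measurable borel" for k by (rule L2_measurable) simp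
  have FX: "cls (F k) = X (r k)" for k by (simp add: F_def)
  have FF: "norm (cls (\<lambda>x. F m x - F n x)) \<le> (1/4) ^ k" if "k \<le> m" "k \<le> n" for k m n
    using rd[of k "r m" "r n"] that strict_mono_less_eq[OF r]
    by (simp add: cls_diff[symmetric] FX dist_norm)
  have FF2: "(\<integral>\<^sup>+x. ennreal ((norm (F m x - F n x))\<^sup>2) \<partial>lborel) \<le> ennreal ((1/16) ^ k)"
    if "k \<le> m" "k \<le> n" for k m n
  proof -
    have "(norm (cls (\<lambda>x. F m x - F n x)))\<^sup>2 \<le> ((1/4) ^ k)\<^sup>2"
      by (intro power_mono FF that) simp
    also have "\<dots> = (1/16) ^ k" by (simp add: power2_eq_square flip: power_mult_distrib)
    finally show ?thesis by (subst nn_integral_L2) (auto intro: ennreal_leI)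
  qed
  \<comment> \<open>The squared norms of the increments decay like \<open>(1/16) ^ k\<close>. With
    the weight \<open>4 ^ k\<close> the sum still has a finite integral, and where the sum is finite
    the increments are eventually at most \<open>(1/2) ^ k\<close>.\<close>
  have "(\<integral>\<^sup>+x. (\<Sum>k. ennreal (4 ^ k * (norm (F (Suc k) x - F k x))\<^sup>2)) \<partial>lborel)
      = (\<Sum>k. \<integral>\<^sup>+x. ennreal (4 ^ k) * ennreal ((norm (F (Suc k) x - F k x))\<^sup>2) \<partial>lborel)"
    by (subst nn_integral_suminf) (auto simp: ennreal_mult)
  also have "\<dots> = (\<Sum>k. ennreal (4 ^ k) * (\<integral>\<^sup>+x. ennreal ((norm (F (Suc k) x - F k x))\<^sup>2) \<partial>lborel))"
    by (subst nn_integral_cmult) auto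
  also have "\<dots> \<le> (\<Sum>k. ennreal ((1/4) ^ k))"
  proof (rule suminf_le)
    fix k
    have "ennreal (4 ^ k) * (\<integral>\<^sup>+x. ennreal ((norm (F (Suc k) x - F k x))\<^sup>2) \<partial>lborel)
        \<le> ennreal (4 ^ k) * ennreal ((1/16) ^ k)"
      by (intro mult_left_mono FF2) auto
    also have "\<dots> = ennreal ((1/4) ^ k)"
      by (subst ennreal_mult[symmetric]) (auto simp flip: power_mult_distrib)
    finally show "ennreal (4 ^ k) * (\<integral>\<^sup>+x. ennreal ((norm (F (Suc k) x - F k x))\<^sup>2) \<partial>lborel)
        \<le> ennreal ((1/4) ^ k)" .
  qed auto
  also have "\<dots> < \<infinity>"
    by (subst suminf_ennreal2) (auto intro: summable_geometric)
  finally have "AE x in lborel. (\<Sum>k. ennreal (4 ^ k * (norm (F (Suc k) x - F k x))\<^sup>2)) \<noteq> \<infinity>"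
    by (intro nn_integral_PInf_AE) auto
  then have conv: "AE x in lborel. convergent (\<lambda>k. F k x)"
  proof eventually_elim
    fix x assume fin: "(\<Sum>k. ennreal (4 ^ k * (norm (F (Suc k) x - F k x))\<^sup>2)) \<noteq> \<infinity>"
    have "summable (\<lambda>k. 4 ^ k * (norm (F (Suc k) x - F k x))\<^sup>2)"
      by (rule summable_suminf_not_top) (use fin in auto)
    then have "(\<lambda>k. 4 ^ k * (norm (F (Suc k) x - F k x))\<^sup>2) \<longlonglongrightarrow> 0"
      by (rule summable_LIMSEQ_zero)
    then have "eventually (\<lambda>k. 4 ^ k * (norm (F (Suc k) x - F k x))\<^sup>2 < 1) sequentially"
      by (rule order_tendstoD) simp
    then have "eventually (\<lambda>k. norm (F (Suc k) x - F k x) \<le> (1/2) ^ k) sequentially"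
    proof eventually_elim
      case (elim k)
      have "(2 ^ k * norm (F (Suc k) x - F k x))\<^sup>2 = 4 ^ k * (norm (F (Suc k) x - F k x))\<^sup>2"
        by (simp add: power2_eq_square flip: power_mult_distrib)
      then have "2 ^ k * norm (F (Suc k) x - F k x) < 1"
        using elim power2_less_imp_less[of "2 ^ k * norm (F (Suc k) x - F k x)" 1] by simp
      then show ?case by (simp add: field_simps)
    qed
    then have "summable (\<lambda>k. F (Suc k) x - F k x)"
      by (rule summable_comparison_test_ev) (simp add: summable_geometric)
    then have "convergent (\<lambda>n. \<Sum>k<n. F (Suc k) x - F k x)"
      by (simp add: summable_iff_convergent)
    then have "convergent (\<lambda>n. F n x - F 0 x)"
      by (simp only: sum_lessThan_telescope[of "\<lambda>k. F k x"])
    then obtain l where "(\<lambda>n. F n x - F 0 x) \<longlonglongrightarrow> l"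
      by (auto simp: convergent_def)
    then have "(\<lambda>n. (F n x - F 0 x) + F 0 x) \<longlonglongrightarrow> l + F 0 x"
      by (intro tendsto_intros)
    then show "convergent (\<lambda>n. F n x)" by (auto simp: convergent_def)
  qed
  define g where "g x = lim (\<lambda>k. F k x)" for x
  have gm [measurable]: "g \<in> borel_measurable borel" unfolding g_def by measurable
  have lim: "AE x in lborel. (\<lambda>k. F k x) \<longlonglongrightarrow> g x"
    using conv by eventually_elim (simp add: g_def convergent_LIMSEQ_iff)
  have gF: "(\<integral>\<^sup>+x. ennreal ((norm (g x - F k x))\<^sup>2) \<partial>lborel) \<le> ennreal ((1/16) ^ k)" for k
  proof -
    have "(\<integral>\<^sup>+x. ennreal ((norm (g x - F k x))\<^sup>2) \<partial>lborel)
        = (\<integral>\<^sup>+x. liminf (\<lambda>m. ennreal ((norm (F m x - F k x))\<^sup>2)) \<partial>lborel)"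
    proof (rule nn_integral_cong_AE)
      show "AE x in lborel. ennreal ((norm (g x - F k x))\<^sup>2) = liminf (\<lambda>m. ennreal ((norm (F m x - F k x))\<^sup>2))"
        using lim
      proof eventually_elim
        case (elim x)
        have "(\<lambda>m. ennreal ((norm (F m x - F k x))\<^sup>2)) \<longlonglongrightarrow> ennreal ((norm (g x - F k x))\<^sup>2)"
          by (intro tendsto_intros elim tendsto_ennrealI)
        then show ?case by (rule lim_imp_Liminf[OF trivial_limit_sequentially, symmetric])
      qed
    qed
    also have "\<dots> \<le> liminf (\<lambda>m. \<integral>\<^sup>+x. ennreal ((norm (F m x - F k x))\<^sup>2) \<partial>lborel)"
      by (rule nn_integral_liminf) simp
    also have "\<dots> \<le> ennreal ((1/16) ^ k)"
    proof (rule order_trans[OF Liminf_mono])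
      show "eventually (\<lambda>m. (\<integral>\<^sup>+x. ennreal ((norm (F m x - F k x))\<^sup>2) \<partial>lborel) \<le> ennreal ((1/16) ^ k)) sequentially"
        using eventually_ge_at_top[of k] by eventually_elim (simp add: FF2)
    qed (simp add: Liminf_const)
    finally show ?thesis .
  qed
  have gFL: "(\<lambda>x. g x - F k x) \<in> L2" for k
    by (rule L2_nnI) (auto intro: le_less_trans[OF gF])
  have gL: "g \<in> L2" using L2_add[OF gFL[of 0] F[of 0]] by simp
  have gX: "norm (cls g - X (r k)) \<le> (1/4) ^ k" for k
  proof -
    have "ennreal ((norm (cls (\<lambda>x. g x - F k x)))\<^sup>2) \<le> ennreal ((1/16) ^ k)"
      using gF[of k] by (simp add: nn_integral_L2[OF gFL])
    then have "(norm (cls (\<lambda>x. g x - F k x)))\<^sup>2 \<le> (1/16) ^ k" by simp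
    also have "\<dots> = ((1/4) ^ k)\<^sup>2" by (simp add: power2_eq_square flip: power_mult_distrib)
    finally have "norm (cls (\<lambda>x. g x - F k x)) \<le> (1/4) ^ k"
      by (rule power2_le_imp_le) simp
    then show ?thesis by (simp add: cls_diff[symmetric] gL FX)
  qed
  have "X \<longlonglongrightarrow> cls g"
  proof (rule metric_LIMSEQ_I)
    fix e :: real assume "e > 0"
    have "(\<lambda>k. 2 * (1/4::real) ^ k) \<longlonglongrightarrow> 2 * 0" by (intro tendsto_intros LIMSEQ_power_zero) simp
    then have "eventually (\<lambda>k. 2 * (1/4::real) ^ k < e) sequentially"
      using \<open>e > 0\<close> by (intro order_tendstoD) auto
    then obtain k where k: "2 * (1/4::real) ^ k < e" by (auto simp: eventually_sequentially)
    show "\<exists>no. \<forall>n\<ge>no. dist (X n) (cls g) < e"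
    proof (intro exI allI impI)
      fix n assume "r k \<le> n"
      then have "dist (X n) (X (r k)) < (1/4) ^ k" by (intro rd) auto
      moreover have "dist (X (r k)) (cls g) \<le> (1/4) ^ k"
        using gX[of k] by (simp add: dist_norm norm_minus_commute)
      ultimately show "dist (X n) (cls g) < e"
        using k dist_triangle[of "X n" "cls g" "X (r k)"] by linarith
    qed
  qed
  then show "convergent X" by (auto simp: convergent_def)
qed

instance Ltwo :: banach ..

section \<open>The unitary representation\<close>

lemma bounded_bilinear_qmult: "bounded_bilinear (\<odot>)"
proof -
  have "bilinear (\<odot>)"
    by (auto simp: bilinear_def linear_iff q_defs algebra_simps)
  then show ?thesis by (simp add: bilinear_conv_bounded_bilinear)
qed

interpretation qmult: bounded_bilinear "(\<odot>)"
  by (rule bounded_bilinear_qmult)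

lemma borel_measurable_qmult [measurable (raw)]:
  assumes "f \<in> borel_measurable M" "g \<in> borel_measurable M"
  shows "(\<lambda>x. f x \<odot> g x) \<in> borel_measurable M"
  by (rule borel_measurable_continuous_Pair[OF assms]) (intro qmult.continuous_on continuous_intros)

text \<open>The hermitian conjugation, adjoint to multiplication from either side. Unlike
  \<open>qconj\<close> it is conjugate linear; the two agree on quaternions with real coordinates,
  in particular on \<open>Spin3\<close>.\<close>

definition qdag :: "biquat \<Rightarrow> biquat" where
  "qdag q = (\<chi> j. if j = 0 then cnj (q $ 0) else - cnj (q $ j))"

lemma qinner: "(p::biquat) \<bullet> q = Re (p $ 0 * cnj (q $ 0)) + Re (p $ 1 * cnj (q $ 1))
    + Re (p $ 2 * cnj (q $ 2)) + Re (p $ 3 * cnj (q $ 3))"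
  by (simp add: inner_vec_def sum_index4 inner_complex_def)

lemma qmult_nth:
  "(p \<odot> q) $ 0 = p $ 0 * q $ 0 - p $ 1 * q $ 1 - p $ 2 * q $ 2 - p $ 3 * q $ 3"
  "(p \<odot> q) $ 1 = p $ 0 * q $ 1 + p $ 1 * q $ 0 + p $ 2 * q $ 3 - p $ 3 * q $ 2"
  "(p \<odot> q) $ 2 = p $ 0 * q $ 2 + p $ 2 * q $ 0 + p $ 3 * q $ 1 - p $ 1 * q $ 3"
  "(p \<odot> q) $ 3 = p $ 0 * q $ 3 + p $ 3 * q $ 0 + p $ 1 * q $ 2 - p $ 2 * q $ 1"
  by (simp_all add: qmult_def)

lemma qdag_nth: "qdag q $ 0 = cnj (q $ 0)" "qdag q $ 1 = - cnj (q $ 1)"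
  "qdag q $ 2 = - cnj (q $ 2)" "qdag q $ 3 = - cnj (q $ 3)"
  by (simp_all add: qdag_def)

lemma qvec_nth: "qvec x $ 0 = 0" "qvec x $ 1 = of_real (x $ 1)"
  "qvec x $ 2 = of_real (x $ 2)" "qvec x $ 3 = of_real (x $ 3)"
  by (simp_all add: qvec_def)

lemma qconj_nth: "qconj q $ 0 = q $ 0" "qconj q $ 1 = - q $ 1"
  "qconj q $ 2 = - q $ 2" "qconj q $ 3 = - q $ 3"
  by (simp_all add: qconj_def)

lemma qinner_left: "(s \<odot> p) \<bullet> r = p \<bullet> (qdag s \<odot> r)"
  by (simp add: qinner qmult_nth qdag_nth) (simp add: algebra_simps)

lemma qinner_right: "(p \<odot> q) \<bullet> r = p \<bullet> (r \<odot> qdag q)"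
  by (simp add: qinner qmult_nth qdag_nth) (simp add: algebra_simps)

lemma qdag_qvec: "qdag (qvec v) = - qvec v"
  by (simp add: biquat_eq_iff qdag_nth qvec_nth)

lemma qdag_qdag [simp]: "qdag (qdag q) = q"
  by (simp add: biquat_eq_iff qdag_nth)

lemma qdag_Spin3: "s \<in> Spin3 \<Longrightarrow> qdag s = qconj s"
  by (simp add: biquat_eq_iff qdag_nth qconj_nth Spin3_def complex_is_Real_iff complex_eq_iff)

lemma qvec_add: "qvec (x + y) = qvec x + qvec y" and qvec_diff: "qvec (x - y) = qvec x - qvec y"
  and qvec_scaleR: "qvec (c *\<^sub>R x) = c *\<^sub>R qvec x" and qvec_minus: "qvec (- x) = - qvec x"
  and qvec_0 [simp]: "qvec 0 = 0"
  by (simp_all add: biquat_eq_iff qvec_nth complex_eq_iff)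

lemma inner_vec3: "(x::real^3) \<bullet> y = x $ 1 * y $ 1 + x $ 2 * y $ 2 + x $ 3 * y $ 3"
  by (simp add: inner_vec_def sum_3)

lemma norm_qvec [simp]: "norm (qvec x) = norm x"
  by (simp add: norm_eq_sqrt_inner qinner qvec_nth inner_vec3)

lemma inner_Spin3_left: "s \<in> Spin3 \<Longrightarrow> (s \<odot> p) \<bullet> (s \<odot> q) = p \<bullet> q"
  by (simp add: qinner_left qdag_Spin3 qmult_assoc[symmetric] Spin3_inverse qmult_units)

lemma inner_Spin3_right: "s \<in> Spin3 \<Longrightarrow> (p \<odot> s) \<bullet> (q \<odot> s) = p \<bullet> q"
  by (simp add: qinner_right qdag_Spin3 qmult_assoc Spin3_inverse qmult_units)

lemma norm_Spin3_left: "s \<in> Spin3 \<Longrightarrow> norm (s \<odot> p) = norm p"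
  by (simp add: norm_eq_sqrt_inner inner_Spin3_left)

lemma norm_Spin3_right: "s \<in> Spin3 \<Longrightarrow> norm (p \<odot> s) = norm p"
  by (simp add: norm_eq_sqrt_inner inner_Spin3_right)

lemma norm_spin_rot: "s \<in> Spin3 \<Longrightarrow> norm (spin_rot s x) = norm x"
  by (metis norm_qvec qvec_spin_rot norm_Spin3_left norm_Spin3_right qconj_Spin3)

lemma spin_rot_add: "spin_rot s (x + y) = spin_rot s x + spin_rot s y"
  using spin_rot_diff[of s x "- y"] spin_rot_scaleR[of s "-1" y] by simp

lemma linear_spin_rot: "linear (spin_rot s)"
  by (intro linearI spin_rot_add spin_rot_scaleR)

lemma spin_rot_measurable [measurable]: "spin_rot s \<in> borel_measurable borel"
  by (intro borel_measurable_continuous_onI linear_continuous_on linear_conv_bounded_linear[THEN iffD1] linear_spin_rot)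

lemma spin_rot_inverse:
  assumes "s \<in> Spin3"
  shows "spin_rot s (spin_rot (qconj s) x) = x" "spin_rot (qconj s) (spin_rot s x) = x"
  using spin_rot_qmult[OF assms qconj_Spin3[OF assms], of x] spin_rot_qmult[OF qconj_Spin3[OF assms] assms, of x]
  by (simp_all add: Spin3_inverse[OF assms] spin_rot_one)

lemma orthogonal_spin_rot: "s \<in> Spin3 \<Longrightarrow> orthogonal_transformation (spin_rot s)"
  by (simp add: orthogonal_transformation linear_spin_rot norm_spin_rot)

text \<open>A Borel measure is Lebesgue measure once it gives boxes their volume. The preimage of a
  box under a rotation is its image under the inverse rotation, and orthogonal maps preserve
  volume.\<close>

lemma distr_lborel_spin_rot:
  assumes s: "s \<in> Spin3"
  shows "distr lborel borel (spin_rot s) = lborel"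
proof (rule lborel_eqI[symmetric])
  fix l u :: "real ^ 3" assume le: "\<And>b. b \<in> Basis \<Longrightarrow> l \<bullet> b \<le> u \<bullet> b"
  have eq: "spin_rot s -` box l u = spin_rot (qconj s) ` box l u"
  proof safe
    fix x assume "spin_rot s x \<in> box l u"
    then have "spin_rot (qconj s) (spin_rot s x) \<in> spin_rot (qconj s) ` box l u" by (rule imageI)
    then show "x \<in> spin_rot (qconj s) ` box l u" by (simp add: spin_rot_inverse s)
  qed (simp add: spin_rot_inverse s)
  have meas: "spin_rot s -` box l u \<in> sets borel"
    using measurable_sets[OF spin_rot_measurable, of "box l u" s] by simp
  have orth: "orthogonal_transformation (spin_rot (qconj s))"
    by (intro orthogonal_spin_rot qconj_Spin3 s)
  have lm: "spin_rot (qconj s) ` box l u \<in> lmeasurable"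
    by (rule measurable_orthogonal_image[OF orth]) simp
  have "emeasure (distr lborel borel (spin_rot s)) (box l u) = emeasure lborel (spin_rot s -` box l u)"
    by (simp add: emeasure_distr)
  also have "\<dots> = emeasure lebesgue (spin_rot (qconj s) ` box l u)"
    using meas by (simp add: eq)
  also have "\<dots> = ennreal (measure lebesgue (spin_rot (qconj s) ` box l u))"
    by (rule emeasure_eq_measure2[OF lm])
  also have "measure lebesgue (spin_rot (qconj s) ` box l u) = measure lebesgue (box l u)"
    by (rule measure_orthogonal_image[OF orth]) simp
  also have "ennreal \<dots> = emeasure lborel (box l u)"
    using emeasure_eq_measure2[of "box l u" lebesgue] by simp
  also have "\<dots> = ennreal (\<Prod>b\<in>Basis. (u - l) \<bullet> b)"
    using le by (simp add: emeasure_lborel_box_eq)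
  finally show "emeasure (distr lborel borel (spin_rot s)) (box l u) = ennreal (\<Prod>b\<in>Basis. (u - l) \<bullet> b)" .
qed simp

text \<open>The inverse of the similarity that the triple \<open>(r, s, b)\<close> defines on
  points; \<open>natural_rep\<close> composes functions with it.\<close>

definition act :: "real \<times> biquat \<times> (real ^ 3) \<Rightarrow> real ^ 3 \<Rightarrow> real ^ 3" where
  "act = (\<lambda>(r, s, b) x. (1 / r) *\<^sub>R spin_rot (qconj s) (x - b))"

lemma natural_rep_act: "natural_rep (r, s, b) f x = (r powr (-3/2)) *\<^sub>R (s \<odot> f (act (r, s, b) x))"
  by (simp add: act_def)

lemma act_measurable [measurable]: "act g \<in> borel_measurable borel"
  by (cases g) (simp add: act_def)

text \<open>Contracting by \<open>1 / r\<close> makes the image of Lebesgue measure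
  \<open>r ^ 3\<close> times as large. This is the factor that the square of
  \<open>r powr (-3/2)\<close> cancels in \<open>inner_U\<close>.\<close>

lemma lborel_act:
  assumes "(r, s, b) \<in> GG"
  shows "lborel = density (distr lborel borel (act (r, s, b))) (\<lambda>_. ennreal (1 / r ^ 3))"
proof -
  have r: "r > 0" and s: "s \<in> Spin3" using assms by (auto simp: GG_def)
  let ?A = "\<lambda>x::real^3. (- (1/r)) *\<^sub>R b + (1/r) *\<^sub>R x"
  have act: "act (r, s, b) = spin_rot (qconj s) \<circ> ?A"
    by (auto simp: act_def spin_rot_scaleR spin_rot_add spin_rot_diff scaleR_diff_right)
  have 1: "lborel = density (distr lborel borel ?A) (\<lambda>_. ennreal (1 / r ^ 3))"
    using lborel_affine[of "1/r" "(- (1/r)) *\<^sub>R b"] r by (simp add: power_divide)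
  have "density (distr lborel borel (act (r, s, b))) (\<lambda>_. ennreal (1 / r ^ 3))
     = density (distr (distr lborel borel ?A) borel (spin_rot (qconj s))) (\<lambda>_. ennreal (1 / r ^ 3))"
    unfolding act by (subst distr_distr) auto
  also have "\<dots> = distr (density (distr lborel borel ?A) (\<lambda>_. ennreal (1 / r ^ 3))) borel (spin_rot (qconj s))"
    by (subst density_distr) (auto simp: measurable_distr_eq1)
  also have "\<dots> = distr lborel borel (spin_rot (qconj s))"
    by (simp only: 1[symmetric])
  also have "\<dots> = lborel" by (intro distr_lborel_spin_rot qconj_Spin3 s)
  finally show ?thesis by simp
qed

lemma integral_act:
  fixes F :: "real ^ 3 \<Rightarrow> 'b::{banach, second_countable_topology}"
  assumes g: "(r, s, b) \<in> GG" and [measurable]: "F \<in> borel_measurable borel"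
  shows "(LINT x|lborel. F (act (r, s, b) x)) = r ^ 3 *\<^sub>R (LINT x|lborel. F x)"
    and "integrable lborel (\<lambda>x. F (act (r, s, b) x)) \<longleftrightarrow> integrable lborel F"
proof -
  have r: "r > 0" using g by (auto simp: GG_def)
  have "(LINT x|lborel. F x) = (1 / r ^ 3) *\<^sub>R (LINT x|lborel. F (act (r, s, b) x))"
    by (subst lborel_act[OF g]) (use r in \<open>simp add: integral_density integral_distr\<close>)
  then show "(LINT x|lborel. F (act (r, s, b) x)) = r ^ 3 *\<^sub>R (LINT x|lborel. F x)"
    using r by simp
  show "integrable lborel (\<lambda>x. F (act (r, s, b) x)) \<longleftrightarrow> integrable lborel F"
  proof -
    have "integrable lborel F \<longleftrightarrow> integrable lborel (\<lambda>x. (1 / r ^ 3) *\<^sub>R F (act (r, s, b) x))"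
      by (subst lborel_act[OF g]) (use r in \<open>simp add: integrable_density integrable_distr_eq\<close>)
    also have "\<dots> \<longleftrightarrow> integrable lborel (\<lambda>x. F (act (r, s, b) x))"
      using r integrable_scaleR_right[of "r ^ 3" lborel "\<lambda>x. (1 / r ^ 3) *\<^sub>R F (act (r, s, b) x)"] by auto
    finally show ?thesis by simp
  qed
qed

lemma AE_act:
  assumes g: "(r, s, b) \<in> GG" and [measurable]: "{x. P x} \<in> sets borel" and "AE x in lborel. P x"
  shows "AE x in lborel. P (act (r, s, b) x)"
proof -
  have "AE x in density (distr lborel borel (act (r, s, b))) (\<lambda>_. ennreal (1 / r ^ 3)). P x"
    using assms(3) unfolding lborel_act[OF g, symmetric] .
  then show ?thesis using g by (auto simp: AE_density AE_distr_iff GG_def)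
qed

lemma powr_m32_square: "(r::real) > 0 \<Longrightarrow> r powr (-3/2) * r powr (-3/2) = 1 / r ^ 3"
proof -
  assume r: "r > 0"
  have "r powr (-3/2) * r powr (-3/2) = r powr (-3)"
    by (subst powr_add[symmetric]) simp
  also have "\<dots> = 1 / r ^ 3"
    using r powr_minus_divide[of r 3] powr_realpow[of r 3] by simp
  finally show ?thesis .
qed

lemma natural_rep_inner:
  assumes g: "(r, s, b) \<in> GG"
  shows "natural_rep (r, s, b) f x \<bullet> natural_rep (r, s, b) h x
     = (1 / r ^ 3) * (f (act (r, s, b) x) \<bullet> h (act (r, s, b) x))"
proof -
  let ?y = "act (r, s, b) x"
  have r: "r > 0" and s: "s \<in> Spin3" using g by (auto simp: GG_def)
  have "natural_rep (r, s, b) f x \<bullet> natural_rep (r, s, b) h x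
      = (r powr (-3/2) * r powr (-3/2)) * ((s \<odot> f ?y) \<bullet> (s \<odot> h ?y))"
    unfolding natural_rep_act inner_scaleR_left inner_scaleR_right by (rule mult.assoc[symmetric])
  then show ?thesis unfolding inner_Spin3_left[OF s] powr_m32_square[OF r] .
qed

lemma natural_rep_measurable [measurable]:
  assumes [measurable]: "f \<in> borel_measurable borel"
  shows "natural_rep g f \<in> borel_measurable borel"
proof (cases g)
  case (fields r s b)
  have "natural_rep g f = (\<lambda>x. (r powr (-3/2)) *\<^sub>R (s \<odot> f (act (r, s, b) x)))"
    by (simp add: fun_eq_iff fields natural_rep_act del: natural_rep.simps)
  then show ?thesis by simp
qed

lemma natural_rep_L2 [intro]:
  assumes g: "g \<in> GG" and f: "f \<in> L2"
  shows "natural_rep g f \<in> L2"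
proof (cases g)
  case (fields r s b)
  have [measurable]: "f \<in> borel_measurable borel" using f by (rule L2_measurable)
  have "integrable lborel (\<lambda>x. (\<lambda>y. (1 / r ^ 3) * (norm (f y))\<^sup>2) (act (r, s, b) x))"
    using g f unfolding fields by (subst integral_act(2)) (auto simp: L2_integrable)
  moreover have "(norm (natural_rep g f x))\<^sup>2 = (1 / r ^ 3) * (norm (f (act (r, s, b) x)))\<^sup>2" for x
    using g unfolding fields power2_norm_eq_inner by (rule natural_rep_inner)
  ultimately show ?thesis by (simp add: L2_def)
qed

lemma natural_rep_ae:
  assumes g: "g \<in> GG" and "f \<in> borel_measurable borel" "h \<in> borel_measurable borel" "f =ae h"
  shows "natural_rep g f =ae natural_rep g h"
proof (cases g)
  case (fields r s b)
  note assms(2,3)[measurable]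
  have "AE x in lborel. f (act (r, s, b) x) = h (act (r, s, b) x)"
    using assms unfolding ae_eq_def fields by (intro AE_act) measurable
  then show ?thesis
    unfolding ae_eq_def fields natural_rep_act by eventually_elim simp
qed

definition U :: "real \<times> biquat \<times> (real ^ 3) \<Rightarrow> Ltwo \<Rightarrow> Ltwo" where
  "U g u = cls (natural_rep g (fun_of u))"

definition rmul :: "Ltwo \<Rightarrow> biquat \<Rightarrow> Ltwo" where
  "rmul u q = cls (\<lambda>x. fun_of u x \<odot> q)"

lemma L2_rmul [intro]: "f \<in> L2 \<Longrightarrow> (\<lambda>x. f x \<odot> q) \<in> L2"
proof -
  assume f: "f \<in> L2"
  then have [measurable]: "f \<in> borel_measurable borel" by (rule L2_measurable)
  obtain K where K: "\<And>a b. norm (a \<odot> b) \<le> norm a * norm b * K"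
    using qmult.nonneg_bounded by blast
  then have "norm (f x \<odot> q) \<le> (norm q * K) * norm (f x)" for x
    using K[of "f x" q] by (simp add: mult_ac)
  then show ?thesis
    by (intro L2_dominated[OF _ f]) auto
qed

lemma U_cls: "g \<in> GG \<Longrightarrow> f \<in> L2 \<Longrightarrow> U g (cls f) = cls (natural_rep g f)"
  unfolding U_def by (subst cls_eq_iff) (auto intro!: natural_rep_ae fun_of_cls L2_measurable)

lemma rmul_cls: "f \<in> L2 \<Longrightarrow> rmul (cls f) q = cls (\<lambda>x. f x \<odot> q)"
  unfolding rmul_def using fun_of_cls[of f]
  by (subst cls_eq_iff) (auto simp: ae_eq_def)

lemma Ltwo_cases: obtains f where "f \<in> L2" "u = cls f"
  by (metis cls_fun_of fun_of_L2)

lemma inner_U: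
  assumes g: "g \<in> GG"
  shows "U g u \<bullet> U g v = u \<bullet> v"
proof -
  obtain f where f: "f \<in> L2" "u = cls f" by (rule Ltwo_cases)
  obtain h where h: "h \<in> L2" "v = cls h" by (rule Ltwo_cases)
  obtain r s b where gg: "g = (r, s, b)" by (cases g)
  have [measurable]: "f \<in> borel_measurable borel" "h \<in> borel_measurable borel"
    using f h by (auto intro: L2_measurable)
  have "U g u \<bullet> U g v = (LINT x|lborel. (\<lambda>y. (1 / r ^ 3) * (f y \<bullet> h y)) (act (r, s, b) x))"
    using g f h by (simp add: U_cls inner_cls natural_rep_L2 gg natural_rep_inner del: natural_rep.simps)
  also have "\<dots> = r ^ 3 *\<^sub>R (LINT x|lborel. (1 / r ^ 3) * (f x \<bullet> h x))"
    using g unfolding gg by (intro integral_act) auto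
  also have "\<dots> = u \<bullet> v" using g f h by (simp add: gg GG_def inner_cls)
  finally show ?thesis .
qed

lemma GG_mult_closed: "g \<in> GG \<Longrightarrow> h \<in> GG \<Longrightarrow> GG_mult g h \<in> GG"
proof -
  have "s \<odot> t \<in> Spin3" if "s \<in> Spin3" "t \<in> Spin3" for s t
  proof -
    have "(s \<odot> t) $ j \<in> \<real>" for j
      using that by (auto simp: qmult_def Spin3_def intro!: Reals_add Reals_diff Reals_mult)
    then show ?thesis using that norm_Spin3_left[of s t] by (auto simp: Spin3_def)
  qed
  then show "g \<in> GG \<Longrightarrow> h \<in> GG \<Longrightarrow> GG_mult g h \<in> GG" by (cases g; cases h) (auto simp: GG_def)
qed

lemma U_U: "g \<in> GG \<Longrightarrow> h \<in> GG \<Longrightarrow> U g (U h u) = U (GG_mult g h) u"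
  by (rule Ltwo_cases[of u]) (simp add: U_cls natural_rep_L2 natural_rep_GG_mult GG_mult_closed)

lemma U_linear: "g \<in> GG \<Longrightarrow> linear (U g)"
proof (rule linearI)
  fix u v :: Ltwo and c :: real assume g: "g \<in> GG"
  obtain f where f: "f \<in> L2" "u = cls f" by (rule Ltwo_cases)
  obtain h where h: "h \<in> L2" "v = cls h" by (rule Ltwo_cases)
  obtain r s b where gg: "g = (r, s, b)" by (cases g)
  have "natural_rep g (\<lambda>x. f x + h x) = (\<lambda>x. natural_rep g f x + natural_rep g h x)"
    by (simp add: gg fun_eq_iff qmult.add_right scaleR_add_right)
  then show "U g (u + v) = U g u + U g v"
    using f h g by (simp add: cls_add U_cls natural_rep_L2 L2_add)
  have "natural_rep g (\<lambda>x. c *\<^sub>R f x) = (\<lambda>x. c *\<^sub>R natural_rep g f x)"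
    by (simp add: gg fun_eq_iff qmult.scaleR_right)
  then show "U g (c *\<^sub>R u) = c *\<^sub>R U g u"
    using f g by (simp add: cls_scaleR U_cls natural_rep_L2 L2_scaleR)
qed

lemma norm_U: "g \<in> GG \<Longrightarrow> norm (U g u) = norm u"
  by (simp add: norm_eq_sqrt_inner inner_U)

lemma U_rmul: "g \<in> GG \<Longrightarrow> U g (rmul u q) = rmul (U g u) q"
proof -
  assume g: "g \<in> GG"
  obtain f where f: "f \<in> L2" "u = cls f" by (rule Ltwo_cases)
  obtain r s b where gg: "g = (r, s, b)" by (cases g)
  have "natural_rep g (\<lambda>x. f x \<odot> q) = (\<lambda>x. natural_rep g f x \<odot> q)"
    by (simp add: gg fun_eq_iff qmult.scaleR_left qmult_assoc)
  then show ?thesis using f g by (simp add: U_cls rmul_cls natural_rep_L2 L2_rmul)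
qed

lemma rmul_add: "rmul (u + v) q = rmul u q + rmul v q"
  by (rule Ltwo_cases[of u]; rule Ltwo_cases[of v])
    (simp add: rmul_cls cls_add L2_rmul L2_add qmult.add_left)

lemma rmul_scaleR: "rmul (c *\<^sub>R u) q = c *\<^sub>R rmul u q"
  by (rule Ltwo_cases[of u]) (simp add: rmul_cls cls_scaleR L2_rmul L2_scaleR qmult.scaleR_left)

lemma rmul_scaleR_right: "rmul u (c *\<^sub>R q) = c *\<^sub>R rmul u q"
  by (rule Ltwo_cases[of u]) (simp add: rmul_cls cls_scaleR L2_rmul L2_scaleR qmult.scaleR_right)

lemma rmul_rmul: "rmul (rmul u p) q = rmul u (p \<odot> q)"
  by (rule Ltwo_cases[of u]) (simp add: rmul_cls L2_rmul qmult_assoc)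

lemma rmul_one [simp]: "rmul u (axis 0 1) = u"
  by (rule Ltwo_cases[of u]) (simp add: rmul_cls qmult_units)

lemma linear_rmul: "linear (\<lambda>u. rmul u q)"
  by (intro linearI rmul_add rmul_scaleR)

lemma inner_rmul: "rmul u q \<bullet> v = u \<bullet> rmul v (qdag q)"
  by (rule Ltwo_cases[of u]; rule Ltwo_cases[of v]) (simp add: rmul_cls inner_cls L2_rmul qinner_right)

lemma norm_rmul_Spin3: "s \<in> Spin3 \<Longrightarrow> norm (rmul u s) = norm u"
  by (simp add: norm_eq_sqrt_inner inner_rmul rmul_rmul qdag_Spin3 Spin3_inverse)

lemma one_Spin3 [simp]: "axis 0 1 \<in> Spin3"
  by (auto simp: Spin3_def axis_def norm_eq_sqrt_inner qinner)

lemma qconj_one [simp]: "qconj (axis 0 1) = axis 0 1"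
  by (simp add: biquat_eq_iff qconj_nth axis_def)

section \<open>Translations\<close>

definition transl :: "real ^ 3 \<Rightarrow> Ltwo \<Rightarrow> Ltwo" where "transl b = U (1, axis 0 1, b)"

lemma transl_GG [simp]: "(1, axis 0 1, b) \<in> GG"
  by (simp add: GG_def)

lemma natural_rep_transl: "natural_rep (1, axis 0 1, b) f = (\<lambda>x. f (x - b))"
  by (simp add: fun_eq_iff spin_rot_one qmult_units)

lemma L2_transl [intro]: "f \<in> L2 \<Longrightarrow> (\<lambda>x. f (x - b)) \<in> L2"
  using natural_rep_L2[OF transl_GG[of b], of f] by (simp only: natural_rep_transl)

lemma transl_cls: "f \<in> L2 \<Longrightarrow> transl b (cls f) = cls (\<lambda>x. f (x - b))"
  unfolding transl_def by (subst U_cls) (auto simp only: natural_rep_transl transl_GG)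

lemma transl_transl: "transl a (transl b u) = transl (a + b) u"
  unfolding transl_def by (simp add: U_U spin_rot_one qmult_units add.commute)

lemma transl_0 [simp]: "transl 0 u = u"
  by (rule Ltwo_cases[of u]) (simp add: transl_cls)

lemma inner_transl: "transl b u \<bullet> transl b v = u \<bullet> v"
  by (simp add: transl_def inner_U)

lemma inner_transl_left: "transl b u \<bullet> v = u \<bullet> transl (- b) v"
  using inner_transl[of b u "transl (-b) v"] by (simp add: transl_transl)

lemma norm_transl [simp]: "norm (transl b u) = norm u"
  by (simp add: transl_def norm_U)

lemma linear_transl: "linear (transl b)"
  by (simp add: transl_def U_linear)

section \<open>Automatic continuity and adjoints\<close>

lemma L2_indicator [intro]: "f \<in> L2 \<Longrightarrow> A \<in> sets borel \<Longrightarrow> (\<lambda>x. indicat_real A x *\<^sub>R f x) \<in> L2"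
  by (rule L2_dominated[of _ f 1]) (auto split: split_indicator)

lemma truncation_tendsto:
  assumes f: "f \<in> L2"
  shows "(\<lambda>n. cls (\<lambda>x. indicat_real (ball 0 (real n)) x *\<^sub>R f x)) \<longlonglongrightarrow> cls f"
proof -
  have [measurable]: "f \<in> borel_measurable borel" using f by (rule L2_measurable)
  have "(\<lambda>n. LINT x|lborel. (norm (f x - indicat_real (ball 0 (real n)) x *\<^sub>R f x))\<^sup>2) \<longlonglongrightarrow> integral\<^sup>L lborel (\<lambda>x::real^3. 0::real)"
  proof (rule integral_dominated_convergence[where w="\<lambda>x. (norm (f x))\<^sup>2"])
    show "AE x in lborel. (\<lambda>n. (norm (f x - indicat_real (ball 0 (real n)) x *\<^sub>R f x))\<^sup>2) \<longlonglongrightarrow> 0"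
    proof (rule AE_I2)
      fix x :: "real ^ 3"
      obtain N :: nat where N: "norm x < real N" using reals_Archimedean2 by blast
      have "eventually (\<lambda>n. (norm (f x - indicat_real (ball 0 (real n)) x *\<^sub>R f x))\<^sup>2 = 0) sequentially"
        using eventually_ge_at_top[of N] by eventually_elim (use N in \<open>simp add: dist_norm indicator_def\<close>)
      then show "(\<lambda>n. (norm (f x - indicat_real (ball 0 (real n)) x *\<^sub>R f x))\<^sup>2) \<longlonglongrightarrow> 0"
        by (rule tendsto_eventually)
    qed
    show "AE x in lborel. norm ((norm (f x - indicat_real (ball 0 (real n)) x *\<^sub>R f x))\<^sup>2) \<le> (norm (f x))\<^sup>2" for n
      by (auto split: split_indicator)
    have "ball 0 (real n) \<in> sets (borel :: (real ^ 3) measure)" for n by simp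
    then show "(\<lambda>x. (norm (f x - indicat_real (ball 0 (real n)) x *\<^sub>R f x))\<^sup>2) \<in> borel_measurable lborel" for n
      by measurable
  qed (use f in \<open>auto simp: L2_integrable\<close>)
  then have "(\<lambda>n. (norm (cls f - cls (\<lambda>x. indicat_real (ball 0 (real n)) x *\<^sub>R f x)))\<^sup>2) \<longlonglongrightarrow> 0"
    by (simp add: cls_diff f L2_indicator L2_diff norm_cls_square)
  then have "(\<lambda>n. sqrt ((norm (cls f - cls (\<lambda>x. indicat_real (ball 0 (real n)) x *\<^sub>R f x)))\<^sup>2)) \<longlonglongrightarrow> sqrt 0"
    by (rule tendsto_real_sqrt)
  then have "(\<lambda>n. dist (cls (\<lambda>x. indicat_real (ball 0 (real n)) x *\<^sub>R f x)) (cls f)) \<longlonglongrightarrow> 0"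
    by (simp add: dist_norm norm_minus_commute)
  then show ?thesis by (rule Lim_transform_eventually[THEN tendsto_dist_iff[THEN iffD2]]) simp
qed

text \<open>Truncated to balls of radius \<open>n\<close>, the two functions have disjoint supports
  after a translation longer than \<open>2 * n\<close>. The truncation error is small uniformly in
  \<open>c\<close>, because translations are isometric.\<close>

lemma transl_mixing_bound:
  assumes "e > 0"
  obtains R where "\<And>c. norm c > R \<Longrightarrow> \<bar>u \<bullet> transl c v\<bar> < e"
proof -
  obtain f where f: "f \<in> L2" "u = cls f" by (rule Ltwo_cases)
  obtain h where h: "h \<in> L2" "v = cls h" by (rule Ltwo_cases)
  define u' where "u' n = cls (\<lambda>x. indicat_real (ball 0 (real n)) x *\<^sub>R f x)" for n
  define v' where "v' n = cls (\<lambda>x. indicat_real (ball 0 (real n)) x *\<^sub>R h x)" for n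
  have "(\<lambda>n. norm (u - u' n) * norm v + norm (u' n) * norm (v - v' n)) \<longlonglongrightarrow> norm (u - u) * norm v + norm u * norm (v - v)"
    unfolding u'_def v'_def f h
    by (intro tendsto_intros truncation_tendsto f h)
  then have "eventually (\<lambda>n. norm (u - u' n) * norm v + norm (u' n) * norm (v - v' n) < e) sequentially"
    using assms by (intro order_tendstoD) auto
  then obtain n where n: "norm (u - u' n) * norm v + norm (u' n) * norm (v - v' n) < e"
    by (auto simp: eventually_sequentially)
  show ?thesis
  proof (rule that[of "2 * real n"])
    fix c :: "real ^ 3" assume c: "norm c > 2 * real n"
    have "transl c (v' n) = cls (\<lambda>x. indicat_real (ball 0 (real n)) (x - c) *\<^sub>R h (x - c))"
      unfolding v'_def by (subst transl_cls) (auto intro: h)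
    moreover have "(\<lambda>x. indicat_real (ball 0 (real n)) (x - c) *\<^sub>R h (x - c)) \<in> L2"
      using L2_transl[OF L2_indicator[OF h(1), of "ball 0 (real n)"], of c] by simp
    ultimately have "u' n \<bullet> transl c (v' n) = (LINT x|lborel. (indicat_real (ball 0 (real n)) x *\<^sub>R f x) \<bullet>
        (indicat_real (ball 0 (real n)) (x - c) *\<^sub>R h (x - c)))"
      unfolding u'_def by (simp only:) (intro inner_cls L2_indicator f; simp)
    also have "\<dots> = integral\<^sup>L lborel (\<lambda>x::real^3. 0)"
    proof (rule Bochner_Integration.integral_cong[OF refl])
      fix x :: "real ^ 3"
      have "norm c \<le> norm x + norm (x - c)" using norm_triangle_ineq4[of x "x - c"] by simp
      then have "\<not> (norm x < real n \<and> norm (x - c) < real n)" using c by linarith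
      then show "(indicat_real (ball 0 (real n)) x *\<^sub>R f x) \<bullet> (indicat_real (ball 0 (real n)) (x - c) *\<^sub>R h (x - c)) = 0"
        by (auto simp: indicator_def)
    qed
    finally have z: "u' n \<bullet> transl c (v' n) = 0" by simp
    have "u \<bullet> transl c v = (u - u' n) \<bullet> transl c v + u' n \<bullet> transl c (v - v' n)"
      using z by (simp add: inner_diff_left inner_diff_right linear_diff[OF linear_transl])
    also have "\<bar>\<dots>\<bar> \<le> norm (u - u' n) * norm v + norm (u' n) * norm (v - v' n)"
      using Cauchy_Schwarz_ineq2[of "u - u' n" "transl c v"] Cauchy_Schwarz_ineq2[of "u' n" "transl c (v - v' n)"]
      by simp
    finally show "\<bar>u \<bullet> transl c v\<bar> < e" using n by linarith
  qed
qed

lemma transl_mixing: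
  assumes a: "a \<noteq> 0"
  shows "((\<lambda>t::real. u \<bullet> transl (t *\<^sub>R a) v) \<longlongrightarrow> 0) at_top"
proof (rule tendstoI)
  fix e :: real assume "e > 0"
  then obtain R where R: "\<And>c. norm c > R \<Longrightarrow> \<bar>u \<bullet> transl c v\<bar> < e" by (rule transl_mixing_bound) blast
  show "eventually (\<lambda>t. dist (u \<bullet> transl (t *\<^sub>R a) v) 0 < e) at_top"
    using eventually_gt_at_top[of "\<bar>R\<bar> / norm a"]
  proof eventually_elim
    case (elim t)
    then have "\<bar>R\<bar> < t * norm a" using a by (simp add: field_simps)
    moreover have "t * norm a \<le> \<bar>t\<bar> * norm a" by (intro mult_right_mono) auto
    ultimately show ?case using R[of "t *\<^sub>R a"] by simp
  qed
qed

text \<open>If \<open>T\<close> were unbounded on every range of \<open>R j\<close>, there would be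
  a convergent sum \<open>f\<close> of small humps, one in each range, with \<open>T (R j f)\<close>
  of norm above \<open>j\<close>. But \<open>T (R j f) = S j (T f)\<close> has norm at most
  \<open>norm (T f)\<close>. The contractions \<open>S j\<close> on the target side stand in for
  continuity of \<open>T\<close>.\<close>

lemma gliding_hump:
  fixes T :: "'a::banach \<Rightarrow> 'b::real_normed_vector" and R :: "nat \<Rightarrow> 'a \<Rightarrow> 'a" and S :: "nat \<Rightarrow> 'b \<Rightarrow> 'b"
  assumes T: "linear T" and R: "\<And>j. linear (R j)"
    and Rn: "\<And>j u. norm (R j u) \<le> norm u" and Sn: "\<And>j v. norm (S j v) \<le> norm v"
    and com: "\<And>j u. T (R j u) = S j (T u)"
    and orth: "\<And>i j u. i \<noteq> j \<Longrightarrow> R i (R j u) = 0" and idem: "\<And>j u. R j (R j u) = R j u"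
  obtains j C where "\<And>u. norm (T (R j u)) \<le> C * norm u"
proof (rule ccontr)
  assume "\<not> thesis"
  \<comment> \<open>Of the factor \<open>real j * 2 ^ j\<close>, the power of two is spent on making
    the normalised humps \<open>w j\<close> summable; \<open>real j\<close> remains as the lower
    bound that tends to infinity.\<close>
  then have "\<forall>j. \<exists>u. norm (T (R j u)) > (real j * 2 ^ j) * norm u" using that by (metis not_le)
  then obtain h where h: "\<And>j. norm (T (R j (h j))) > (real j * 2 ^ j) * norm (h j)" by metis
  have h0: "h j \<noteq> 0" for j
    using h[of j] linear_0[OF R] linear_0[OF T] by auto
  define w where "w j = (1 / (2 ^ j * norm (h j))) *\<^sub>R h j" for j
  have w: "norm (w j) = (1/2) ^ j" for j
    using h0[of j] by (simp add: w_def power_divide)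
  have Tw: "norm (T (R j (w j))) > real j" for j
    using h[of j] h0[of j] by (simp add: w_def linear_scale[OF R] linear_scale[OF T] field_simps)
  have sR: "summable (\<lambda>j. R j (w j))"
  proof (rule summable_comparison_test')
    show "summable (\<lambda>j. (1/2::real) ^ j)" by (simp add: summable_geometric)
    show "norm (R j (w j)) \<le> (1/2) ^ j" if "j \<ge> 0" for j using Rn[of j "w j"] w[of j] by simp
  qed
  define f where "f = (\<Sum>j. R j (w j))"
  have bl: "bounded_linear (R j)" for j
    using R[of j] Rn[of j] by (intro bounded_linear_intro[where K=1]) (auto simp: linear_add linear_scale)
  have "R j f = R j (w j)" for j
  proof -
    have "R j f = (\<Sum>i. R j (R i (w i)))"
      unfolding f_def by (rule bounded_linear.suminf[OF bl sR])
    also have "\<dots> = (\<Sum>i. if i = j then R j (w j) else 0)"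
      by (rule suminf_cong) (auto simp: idem orth)
    also have "\<dots> = R j (w j)" using sums_unique[OF sums_single[of j "\<lambda>i. R j (w j)"]] by simp
    finally show ?thesis .
  qed
  then have "real j < norm (T f)" for j
    using Tw[of j] Sn[of j "T f"] com[of j f] by simp
  then show False using reals_Archimedean2[of "norm (T f)"] by (metis less_asym)
qed

section \<open>Rotations about the third axis and their frequency projections\<close>

definition axial :: "real \<Rightarrow> biquat" where
  "axial \<theta> = (\<chi> j. if j = 0 then of_real (cos (\<theta>/2)) else if j = 3 then of_real (sin (\<theta>/2)) else 0)"

lemma axial_nth: "axial \<theta> $ 0 = of_real (cos (\<theta>/2))" "axial \<theta> $ 1 = 0" "axial \<theta> $ 2 = 0"
  "axial \<theta> $ 3 = of_real (sin (\<theta>/2))"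
  by (simp_all add: axial_def)

lemma axial_Spin3 [simp]: "axial \<theta> \<in> Spin3"
  by (simp add: Spin3_def forall_index4 axial_nth norm_eq_sqrt_inner qinner flip: power2_eq_square)

lemma axial_add: "axial \<theta> \<odot> axial \<phi> = axial (\<theta> + \<phi>)"
  by (simp add: biquat_eq_iff qmult_nth axial_nth add_divide_distrib cos_add sin_add)

lemma qconj_axial: "qconj (axial \<theta>) = axial (- \<theta>)"
  by (simp add: biquat_eq_iff qconj_nth axial_nth)

text \<open>Right multiplication by the inverse unit quaternion cancels the sign that
  \<open>axial\<close> acquires at \<open>2 * pi\<close>, so this is a representation of the circle
  and not only of its double cover. It commutes with intertwiners because these are right
  linear.\<close>

definition rotop :: "real \<Rightarrow> Ltwo \<Rightarrow> Ltwo" where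
  "rotop \<theta> u = rmul (U (1, axial \<theta>, 0) u) (axial (- \<theta>))"

lemma axial_GG [simp]: "(1, axial \<theta>, 0) \<in> GG" by (simp add: GG_def)

lemma spin_rot_0 [simp]: "spin_rot s 0 = 0"
  using spin_rot_scaleR[of s 0 0] by simp

lemma rotop_rotop: "rotop \<theta> (rotop \<phi> u) = rotop (\<theta> + \<phi>) u"
  unfolding rotop_def by (simp add: U_rmul U_U rmul_rmul axial_add add.commute)

lemma spin_rot_minus: "spin_rot (- s) x = spin_rot s x"
proof -
  have "qconj (- s) = - qconj s" by (simp add: biquat_eq_iff qconj_nth)
  then show ?thesis by (simp add: spin_rot_def qmult.minus_left qmult.minus_right)
qed

lemma rotop_2pi: "rotop (2 * pi) u = u"
proof -
  obtain f where f: "f \<in> L2" "u = cls f" by (rule Ltwo_cases)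
  have ax: "axial (2 * pi) = - axis 0 1" "axial (- (2 * pi)) = - axis 0 1"
    by (simp_all add: biquat_eq_iff axial_nth axis_def)
  have "natural_rep (1, axial (2 * pi), 0) f x \<odot> axial (- (2 * pi)) = f x" for x
    unfolding natural_rep.simps qconj_axial ax(2)
    by (simp add: ax qmult.minus_left qmult.minus_right qmult_units spin_rot_minus spin_rot_one)
  then show ?thesis
    unfolding rotop_def f by (simp add: U_cls f rmul_cls natural_rep_L2 del: natural_rep.simps)
qed

lemma linear_rotop: "linear (rotop \<theta>)"
  unfolding rotop_def using linear_compose[OF U_linear[OF axial_GG] linear_rmul] by (simp add: o_def)

lemma norm_rotop: "norm (rotop \<theta> u) = norm u"
  by (simp add: rotop_def norm_rmul_Spin3 norm_U)

lemma rotop_transl: "rotop \<theta> (transl b u) = transl (spin_rot (axial \<theta>) b) (rotop \<theta> u)"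
  by (simp add: rotop_def transl_def U_rmul U_U qmult_units)

lemma spin_rot_axial_e1: "spin_rot (axial \<theta>) (axis 1 1) $ 1 = cos \<theta>"
proof -
  have "cos (\<theta>/2) * cos (\<theta>/2) - sin (\<theta>/2) * sin (\<theta>/2) = cos (\<theta>/2 + \<theta>/2)" by (simp only: cos_add)
  then show ?thesis by (simp add: spin_rot_def vec_of_q_def qmult_nth qconj_nth qvec_nth axial_nth axis_def)
qed

text \<open>The projection onto the angular frequencies that are odd multiples of \<open>2 ^ j\<close>.\<close>

definition altavg :: "nat \<Rightarrow> Ltwo \<Rightarrow> Ltwo" where
  "altavg j u = (1 / 2 ^ Suc j) *\<^sub>R (\<Sum>k<2 ^ Suc j. (-1) ^ k *\<^sub>R rotop (2 * pi * real k / 2 ^ Suc j) u)"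

lemma linear_altavg: "linear (altavg j)"
  unfolding altavg_def
  by (intro linear_compose_scale_right linear_compose_sum ballI linear_rotop)

lemma norm_altavg: "norm (altavg j u) \<le> norm u"
proof -
  have "norm (\<Sum>k<2 ^ Suc j. (-1::real) ^ k *\<^sub>R rotop (2 * pi * real k / 2 ^ Suc j) u)
      \<le> (\<Sum>k<(2::nat) ^ Suc j. norm u)"
    by (intro sum_norm_le) (simp add: norm_rotop power_abs)
  then have "(1 / 2 ^ Suc j) * norm (\<Sum>k<2 ^ Suc j. (-1::real) ^ k *\<^sub>R rotop (2 * pi * real k / 2 ^ Suc j) u)
      \<le> (1 / 2 ^ Suc j) * (2 ^ Suc j * norm u)"
    by (intro mult_left_mono) auto
  then show ?thesis by (simp add: altavg_def)
qed

text \<open>Rotation by one step shifts the summation index and so reverses every sign. The sum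
  closes up cyclically because the number of terms is even and \<open>rotop\<close> has period
  \<open>2 * pi\<close>.\<close>

lemma altavg_rotop: "altavg j (rotop (2 * pi / 2 ^ Suc j) u) = - altavg j u"
proof -
  let ?N = "2 ^ Suc j :: nat"
  define g where "g k = (-1::real) ^ k *\<^sub>R rotop (2 * pi * real k / 2 ^ Suc j) u" for k
  have rot0: "rotop 0 u = u" by (metis rotop_rotop rotop_2pi add.right_neutral add_0)
  have step: "(-1::real) ^ k *\<^sub>R rotop (2 * pi * real k / 2 ^ Suc j) (rotop (2 * pi / 2 ^ Suc j) u) = - g (Suc k)" for k
  proof -
    have "2 * pi * real k / 2 ^ Suc j + 2 * pi / 2 ^ Suc j = 2 * pi * real (Suc k) / 2 ^ Suc j"
      by (simp add: field_simps)
    then show ?thesis by (simp add: g_def rotop_rotop del: power_Suc)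
      (simp)
  qed
  have "g ?N = g 0"
    using rotop_2pi rot0 by (simp add: g_def)
  then have "(\<Sum>k<?N. g (Suc k)) = (\<Sum>k<?N. g k)"
    using sum_lessThan_telescope[of g ?N] by (simp add: sum_subtractf)
  then show ?thesis unfolding altavg_def step by (simp add: sum_negf g_def[symmetric] del: power_Suc)
qed

lemma altavg_rotop_pow: "altavg j (rotop (2 * pi * real k / 2 ^ Suc j) u) = (-1) ^ k *\<^sub>R altavg j u"
proof (induction k)
  case 0
  have "rotop 0 u = u" by (metis rotop_rotop rotop_2pi add.right_neutral add_0)
  then show ?case by simp
next
  case (Suc k)
  have "2 * pi * real (Suc k) / 2 ^ Suc j = 2 * pi / 2 ^ Suc j + 2 * pi * real k / 2 ^ Suc j"
    by (simp add: field_simps)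
  then have "rotop (2 * pi * real (Suc k) / 2 ^ Suc j) u = rotop (2 * pi / 2 ^ Suc j) (rotop (2 * pi * real k / 2 ^ Suc j) u)"
    by (simp only: rotop_rotop)
  then show ?case by (simp only: altavg_rotop Suc.IH) simp
qed

lemma altavg_idem: "altavg j (altavg j u) = altavg j u"
proof -
  have "altavg j (altavg j u) = (1 / 2 ^ Suc j) *\<^sub>R (\<Sum>k<2 ^ Suc j. (-1::real) ^ k *\<^sub>R (-1::real) ^ k *\<^sub>R altavg j u)"
    by (subst (2) altavg_def)
      (simp only: linear_scale[OF linear_altavg] linear_sum[OF linear_altavg] altavg_rotop_pow)
  also have "\<dots> = (1 / 2 ^ Suc j) *\<^sub>R (\<Sum>k<(2::nat) ^ Suc j. altavg j u)"
    by (simp add: power_mult_distrib[symmetric] del: power_Suc)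
  also have "\<dots> = altavg j u" by (simp add: sum_constant_scaleR del: power_Suc)
  finally show ?thesis .
qed

lemma sum_alternating_even: "(\<Sum>k<2 * n. (-1::real) ^ k) = 0"
  by (induction n) auto

text \<open>For \<open>i < j\<close> each rotation in \<open>altavg i\<close> is an even number of
  steps of \<open>altavg j\<close>, which therefore absorbs it without a sign. What is left is an
  alternating sum with an even number of terms.\<close>

lemma altavg_orth_less: "i < j \<Longrightarrow> altavg j (altavg i u) = 0"
proof -
  assume ij: "i < j"
  have rot: "altavg j (rotop (2 * pi * real k / 2 ^ Suc i) u) = altavg j u" for k
  proof -
    have "2 ^ Suc j = (2::real) ^ Suc i * 2 ^ (j - i)"
      using ij by (simp add: power_add[symmetric])
    then have "2 * pi * real k / 2 ^ Suc i = 2 * pi * real (k * 2 ^ (j - i)) / 2 ^ Suc j"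
      by simp
    then have "altavg j (rotop (2 * pi * real k / 2 ^ Suc i) u) = (-1) ^ (k * 2 ^ (j - i)) *\<^sub>R altavg j u"
      by (simp only: altavg_rotop_pow)
    moreover have "even (k * 2 ^ (j - i))" using ij by simp
    ultimately show ?thesis by simp
  qed
  have "altavg j (altavg i u) = (1 / 2 ^ Suc i) *\<^sub>R (\<Sum>k<2 ^ Suc i. (-1::real) ^ k *\<^sub>R altavg j u)"
    by (subst (2) altavg_def) (simp only: linear_scale[OF linear_altavg] linear_sum[OF linear_altavg] rot)
  also have "(\<Sum>k<2 ^ Suc i. (-1::real) ^ k *\<^sub>R altavg j u) = (\<Sum>k<2 * 2 ^ i. (-1::real) ^ k) *\<^sub>R altavg j u"
    by (simp add: scaleR_sum_left)
  finally show ?thesis by (simp only: sum_alternating_even) simp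
qed

lemma altavg_intertwine:
  assumes T: "linear T" and com: "\<And>\<theta> u. T (rotop \<theta> u) = rotop \<theta> (T u)"
  shows "T (altavg j u) = altavg j (T u)"
  unfolding altavg_def by (simp only: linear_scale[OF T] linear_sum[OF T] com)

lemma altavg_commute: "altavg i (altavg j u) = altavg j (altavg i u)"
proof (rule altavg_intertwine[OF linear_altavg])
  show "altavg i (rotop \<theta> u) = rotop \<theta> (altavg i u)" for \<theta> u
    by (rule altavg_intertwine[OF linear_rotop, symmetric]) (simp add: rotop_rotop add.commute)
qed

lemma altavg_orth: "i \<noteq> j \<Longrightarrow> altavg i (altavg j u) = 0"
  by (metis altavg_orth_less altavg_commute nat_neq_iff)

text \<open>Real linearity is the right notion for the real inner product; complex scalars are
  contained in \<open>rmul\<close>. No continuity is built in, so that \<open>lift T\<close>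
  qualifies directly.\<close>

definition intertwiner :: "(Ltwo \<Rightarrow> Ltwo) \<Rightarrow> bool" where
  "intertwiner T \<longleftrightarrow> linear T \<and> (\<forall>g\<in>GG. \<forall>u. T (U g u) = U g (T u)) \<and> (\<forall>u q. T (rmul u q) = rmul (T u) q)"

lemma intertwinerD:
  assumes "intertwiner T"
  shows "linear T" "g \<in> GG \<Longrightarrow> T (U g u) = U g (T u)" "T (rmul u q) = rmul (T u) q"
    "T (transl b u) = transl b (T u)" "T (rotop \<theta> u) = rotop \<theta> (T u)"
  using assms by (auto simp: intertwiner_def transl_def rotop_def)

text \<open>By the gliding hump, \<open>T\<close> is bounded on the range of some \<open>altavg j\<close>. Applied to far
  translates of \<open>u\<close>, the rotated summands of \<open>altavg j\<close> become asymptotically orthogonal, so that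
  \<open>altavg j\<close> controls the norm of \<open>u\<close>.\<close>

theorem intertwiner_bounded:
  assumes T: "intertwiner T"
  obtains C where "C \<ge> 0" "\<And>u. norm (T u) \<le> C * norm u"
proof -
  note lin = intertwinerD(1)[OF T]
  have com: "T (altavg j u) = altavg j (T u)" for j u
    by (rule altavg_intertwine[OF lin]) (rule intertwinerD(5)[OF T])
  obtain j C where C: "\<And>u. norm (T (altavg j u)) \<le> C * norm u"
    using gliding_hump[of T altavg altavg, OF lin linear_altavg norm_altavg norm_altavg com altavg_orth altavg_idem]
    by blast
  let ?N = "2 ^ Suc j :: nat"
  define ang where "ang k = 2 * pi * real k / 2 ^ Suc j" for k
  \<comment> \<open>Rotating a translate by \<open>b\<close> gives a translate by the rotated
    \<open>b\<close> (\<open>rotop_transl\<close>). \<open>a k\<close> is the resulting relative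
    displacement for the unit vector \<open>axis 1 1\<close>; it is nonzero unless the rotation is
    trivial, since it changes the first coordinate.\<close>
  define a where "a k = spin_rot (axial (ang k)) (axis 1 1) - axis 1 1" for k
  have a0: "a k \<noteq> 0" if "0 < k" "k < ?N" for k
  proof
    assume "a k = 0"
    then have "a k $ 1 = 0" by simp
    then have "cos (ang k) = 1" by (simp add: a_def spin_rot_axial_e1)
    then obtain m :: int where m: "ang k = real_of_int m * 2 * pi" by (auto simp: cos_one_2pi_int)
    have "real k / real ?N < 1" "0 < real k / real ?N"
      using that by (simp_all del: power_Suc)
    moreover have "real k / real ?N = real_of_int m"
    proof -
      have "real k / real ?N = ang k / (2 * pi)" by (simp add: ang_def)
      then show ?thesis using m by simp
    qed
    ultimately have "real_of_int m < 1" "0 < real_of_int m" by (simp_all only:)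
    then show False by simp
  qed
  have main: "norm (T f) \<le> real ?N * \<bar>C\<bar> * norm f" for f
  proof -
    define u where "u = T f"
    \<comment> \<open>The terms \<open>k > 0\<close> of the pairing of a translate of
      \<open>u\<close> with its own alternating average; the term \<open>k = 0\<close> is
      \<open>u \<bullet> u\<close>.\<close>
    define S where "S t = (\<Sum>k\<in>{0<..<?N}. (-1) ^ k * (u \<bullet> transl (t *\<^sub>R a k) (rotop (ang k) u)))" for t :: real
    have bound: "u \<bullet> u + S t \<le> real ?N * \<bar>C\<bar> * norm f * norm u" for t
    proof -
      let ?b = "t *\<^sub>R axis 1 1 :: real ^ 3"
      have rot0: "rotop 0 u = u" by (metis rotop_rotop rotop_2pi add.right_neutral add_0)
      have term_eq: "transl ?b u \<bullet> rotop (ang k) (transl ?b u) = u \<bullet> transl (t *\<^sub>R a k) (rotop (ang k) u)" for k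
        by (simp add: rotop_transl inner_transl_left transl_transl spin_rot_scaleR a_def scaleR_diff_right)
      have "u \<bullet> u + S t = (\<Sum>k<?N. (-1) ^ k * (u \<bullet> transl (t *\<^sub>R a k) (rotop (ang k) u)))"
      proof -
        have "{..<?N} = insert 0 {0<..<?N}" by auto
        moreover have "u \<bullet> transl (t *\<^sub>R a 0) (rotop (ang 0) u) = u \<bullet> u"
        proof -
          have "axial 0 = axis 0 1" by (simp add: biquat_eq_iff axial_nth axis_def)
          then show ?thesis by (simp add: a_def ang_def rot0 spin_rot_one)
        qed
        ultimately show ?thesis by (simp add: S_def del: power_Suc)
      qed
      also have "\<dots> = transl ?b u \<bullet> (real ?N *\<^sub>R altavg j (transl ?b u))"
        unfolding term_eq[symmetric] by (simp add: altavg_def inner_sum_right ang_def del: power_Suc)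
      also have "\<dots> \<le> norm (transl ?b u) * norm (real ?N *\<^sub>R altavg j (transl ?b u))"
        by (rule norm_cauchy_schwarz)
      also have "\<dots> = real ?N * norm u * norm (T (altavg j (transl ?b f)))"
        by (simp add: com intertwinerD(4)[OF T] u_def del: power_Suc)
      also have "\<dots> \<le> real ?N * norm u * (\<bar>C\<bar> * norm f)"
      proof (intro mult_left_mono)
        have "norm (T (altavg j (transl ?b f))) \<le> C * norm f" using C[of "transl ?b f"] by simp
        also have "\<dots> \<le> \<bar>C\<bar> * norm f" by (intro mult_right_mono) auto
        finally show "norm (T (altavg j (transl ?b f))) \<le> \<bar>C\<bar> * norm f" .
      qed simp
      finally show ?thesis by (simp add: mult_ac del: power_Suc)
    qed
    \<comment> \<open>The bound does not depend on \<open>t\<close>, because \<open>f\<close> and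
      its translates have the same norm. In the limit mixing removes \<open>S\<close>, and the bound
      for the average becomes one for \<open>u = T f\<close> itself.\<close>
    have "((\<lambda>t. u \<bullet> u + S t) \<longlongrightarrow> u \<bullet> u + (\<Sum>k\<in>{0<..<?N}. (-1) ^ k * 0)) at_top"
      unfolding S_def by (intro tendsto_intros transl_mixing a0) auto
    then have "u \<bullet> u + (\<Sum>k\<in>{0<..<?N}. (-1) ^ k * 0) \<le> real ?N * \<bar>C\<bar> * norm f * norm u"
      by (rule tendsto_upperbound) (intro always_eventually allI bound, simp)
    then have "norm u * norm u \<le> real ?N * \<bar>C\<bar> * norm f * norm u"
      by (simp add: dot_square_norm power2_eq_square del: power_Suc)
    then show ?thesis unfolding u_def by (cases "T f = 0") (auto simp del: power_Suc)
  qed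
  show ?thesis by (rule that[OF _ main]) simp
qed

text \<open>If \<open>w\<close> represents \<open>l\<close>, then \<open>J u\<close> is the squared
  distance of \<open>u\<close> from \<open>w\<close> up to a constant, so \<open>w\<close> is found
  as the minimiser of \<open>J\<close>. The parallelogram identity makes minimising sequences
  Cauchy.\<close>

lemma riesz_representation:
  fixes l :: "'a::{real_inner, complete_space} \<Rightarrow> real"
  assumes l: "bounded_linear l"
  obtains w where "\<And>u. l u = u \<bullet> w"
proof -
  interpret l: bounded_linear l by (rule l)
  obtain K where K: "\<And>u. norm (l u) \<le> norm u * K" using l.bounded by blast
  define J where "J u = (norm u)\<^sup>2 - 2 * l u" for u
  have low: "J u \<ge> - K\<^sup>2" for u
  proof -
    have "2 * l u \<le> 2 * (norm u * K)" using K[of u] by auto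
    moreover have "0 \<le> (norm u - K)\<^sup>2" by simp
    ultimately show ?thesis by (simp add: J_def power2_diff algebra_simps)
  qed
  define m where "m = (INF u. J u)"
  have bdd: "bdd_below (range J)" using low by (auto simp: bdd_below_def)
  have mJ: "m \<le> J u" for u unfolding m_def by (rule cINF_lower[OF bdd]) simp
  have "\<exists>u. J u < m + e" if "e > 0" for e
  proof -
    have "(INF u. J u) < m + e" using that by (simp add: m_def)
    then show ?thesis by (subst (asm) cINF_less_iff) (auto simp: bdd)
  qed
  then have "\<exists>u. J u < m + 1 / real (Suc n)" for n by simp
  then obtain x where x: "\<And>n. J (x n) < m + 1 / real (Suc n)" by metis
  have par: "(norm (u - v))\<^sup>2 = 2 * J u + 2 * J v - 4 * J ((1/2) *\<^sub>R (u + v))" for u v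
    unfolding J_def power2_norm_eq_inner
    by (simp add: inner_simps l.scaleR l.add l.diff inner_commute algebra_simps)
  have dx: "(norm (x n - x k))\<^sup>2 \<le> 2 / real (Suc n) + 2 / real (Suc k)" for n k
    using x[of n] x[of k] mJ[of "(1/2) *\<^sub>R (x n + x k)"] unfolding par by auto
  have "Cauchy x"
  proof (rule metric_CauchyI)
    fix e :: real assume e: "e > 0"
    obtain M :: nat where M: "4 / e\<^sup>2 < real M" using reals_Archimedean2 by blast
    show "\<exists>M. \<forall>m\<ge>M. \<forall>n\<ge>M. dist (x m) (x n) < e"
    proof (intro exI allI impI)
      fix n k assume nk: "M \<le> n" "M \<le> k"
      have M0: "real M > 0" using M e by (meson divide_pos_pos less_trans zero_less_numeral zero_less_power)
      have "2 / real (Suc n) \<le> 2 / real M" "2 / real (Suc k) \<le> 2 / real M"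
        using nk M0 by (auto intro!: divide_left_mono)
      then have "(norm (x n - x k))\<^sup>2 \<le> 4 / real M" using dx[of n k] by linarith
      also have "\<dots> < e\<^sup>2" using M M0 e by (simp add: field_simps)
      finally show "dist (x n) (x k) < e" using e by (simp add: dist_norm power2_less_imp_less)
    qed
  qed
  then obtain w where w: "x \<longlonglongrightarrow> w" by (auto simp: Cauchy_convergent_iff convergent_def)
  have "(\<lambda>n. J (x n)) \<longlonglongrightarrow> J w" unfolding J_def by (intro tendsto_intros w l.tendsto)
  moreover have "(\<lambda>n. m + 1 / real (Suc n)) \<longlonglongrightarrow> m + 0"
    by (intro tendsto_intros LIMSEQ_Suc lim_const_over_n)
  ultimately have Jw: "J w \<le> m"
    using x by (intro LIMSEQ_le[of "\<lambda>n. J (x n)" _ "\<lambda>n. m + 1 / real (Suc n)"]) (auto intro: less_imp_le)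
  have "l v = v \<bullet> w" for v
  proof (rule ccontr)
    assume ne: "l v \<noteq> v \<bullet> w"
    define d where "d = v \<bullet> w - l v"
    have d: "d \<noteq> 0" using ne by (simp add: d_def)
    have v: "v \<noteq> 0" using ne by (auto simp: l.zero)
    have "J w \<le> J (w + t *\<^sub>R v)" for t using Jw mJ[of "w + t *\<^sub>R v"] by linarith
    moreover have "J (w + t *\<^sub>R v) = J w + (t\<^sup>2 * (norm v)\<^sup>2 + 2 * t * d)" for t
      unfolding J_def d_def power2_norm_eq_inner
      by (simp add: inner_simps l.scaleR l.add inner_commute algebra_simps power2_eq_square)
    ultimately have ge: "0 \<le> t\<^sup>2 * (norm v)\<^sup>2 + 2 * t * d" for t by (metis add_le_cancel_left add.right_neutral)
    \<comment> \<open>The value of \<open>t\<close> at which the quadratic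
      \<open>t\<^sup>2 * (norm v)\<^sup>2 + 2 * t * d\<close> is smallest; it is negative there
      unless \<open>d = 0\<close>.\<close>
    have "(- d / (norm v)\<^sup>2)\<^sup>2 * (norm v)\<^sup>2 + 2 * (- d / (norm v)\<^sup>2) * d = - (d\<^sup>2 / (norm v)\<^sup>2)"
      using v by (simp add: power2_eq_square field_simps)
    moreover have "d\<^sup>2 / (norm v)\<^sup>2 > 0" using d v by simp
    ultimately show False using ge[of "- d / (norm v)\<^sup>2"] by linarith
  qed
  then show ?thesis using that by blast
qed

text \<open>The adjoint exists by boundedness and Riesz representation. It is again an intertwiner
  because the adjoint of \<open>U g\<close> is \<open>U\<close> of the inverse group element and the
  adjoint of right multiplication is right multiplication by \<open>qdag q\<close>.\<close>

lemma intertwiner_adjoint: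
  assumes T: "intertwiner T"
  obtains A where "intertwiner A" "\<And>u v. T u \<bullet> v = u \<bullet> A v"
proof -
  note lin = intertwinerD(1)[OF T]
  obtain C where C: "\<And>u. norm (T u) \<le> C * norm u" using intertwiner_bounded[OF T] by blast
  have bl: "bounded_linear T"
    using C lin by (intro bounded_linear_intro[where K=C]) (auto simp: linear_add linear_scale mult.commute)
  have "\<exists>w. \<forall>u. T u \<bullet> v = u \<bullet> w" for v
    by (rule riesz_representation[OF bounded_linear_compose[OF bounded_linear_inner_left bl]]) blast
  then obtain A where A: "\<And>u v. T u \<bullet> v = u \<bullet> A v" by metis
  have eqI: "x = y" if "\<And>u. u \<bullet> x = u \<bullet> y" for x y :: Ltwo
    using that[of "x - y"] by (metis inner_diff_right inner_eq_zero_iff right_minus_eq)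
  have ginv: "\<exists>h\<in>GG. \<forall>u. U h (U g u) = u \<and> U g (U h u) = u" if g: "g \<in> GG" for g
  proof -
    obtain r s b where gg: "g = (r, s, b)" by (cases g)
    have r: "r > 0" and s: "s \<in> Spin3" using g by (auto simp: gg GG_def)
    \<comment> \<open>The inverse of \<open>(r, s, b)\<close> in the group.\<close>
    let ?h = "(1 / r, qconj s, - (1 / r) *\<^sub>R spin_rot (qconj s) b)"
    have h: "?h \<in> GG" using r s by (simp add: GG_def qconj_Spin3)
    have 1: "U (1, axis 0 1, 0) u = u" for u using transl_0[of u] by (simp add: transl_def)
    have "spin_rot s (- c) = - spin_rot s c" for s c using linear_neg[OF linear_spin_rot] .
    then have "GG_mult ?h g = (1, axis 0 1, 0)" "GG_mult g ?h = (1, axis 0 1, 0)"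
      using r s by (simp_all add: gg Spin3_inverse spin_rot_scaleR spin_rot_inverse)
    then have "U ?h (U g u) = u \<and> U g (U ?h u) = u" for u
      using 1 by (simp only: U_U[OF h g] U_U[OF g h])
    then show ?thesis using h by blast
  qed
  have "intertwiner A"
    unfolding intertwiner_def
  proof (intro conjI ballI allI)
    show "linear A" by (intro linearI eqI) (simp_all add: A[symmetric] inner_add_right)
    show "A (U g u) = U g (A u)" if g: "g \<in> GG" for g u
    proof (rule eqI)
      fix v
      obtain h where h: "h \<in> GG" "\<And>u. U h (U g u) = u" "\<And>u. U g (U h u) = u" using ginv[OF g] by blast
      have "v \<bullet> A (U g u) = U g (U h (T v)) \<bullet> U g u" by (simp add: A[symmetric] h)
      also have "\<dots> = U h (T v) \<bullet> u" by (rule inner_U[OF g])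
      also have "\<dots> = U h v \<bullet> A u" by (simp add: intertwinerD(2)[OF T h(1), symmetric] A)
      also have "\<dots> = U g (U h v) \<bullet> U g (A u)" by (rule inner_U[OF g, symmetric])
      finally show "v \<bullet> A (U g u) = v \<bullet> U g (A u)" by (simp add: h)
    qed
    show "A (rmul u q) = rmul (A u) q" for u q
    proof (rule eqI)
      fix v
      have adj: "x \<bullet> rmul y q = rmul x (qdag q) \<bullet> y" for x y by (simp add: inner_rmul)
      have "v \<bullet> A (rmul u q) = T v \<bullet> rmul u q" by (simp add: A)
      also have "\<dots> = v \<bullet> rmul (A u) q" unfolding adj A[symmetric] intertwinerD(3)[OF T] ..
      finally show "v \<bullet> A (rmul u q) = v \<bullet> rmul (A u) q" .
    qed
  qed
  then show ?thesis using A that by blast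
qed

section \<open>Heat kernels and matrix coefficients\<close>

lemma integral_transl:
  fixes F :: "real ^ 3 \<Rightarrow> 'b::{banach, second_countable_topology}"
  assumes "F \<in> borel_measurable borel"
  shows "(LINT x|lborel. F (x - b)) = (LINT x|lborel. F x)"
    and "integrable lborel (\<lambda>x. F (x - b)) \<longleftrightarrow> integrable lborel F"
  using integral_act[OF transl_GG[of b] assms] by (simp_all add: act_def spin_rot_one)

lemma integral_neg:
  fixes F :: "real ^ 3 \<Rightarrow> 'b::{banach, second_countable_topology}"
  assumes [measurable]: "F \<in> borel_measurable borel"
  shows "(LINT x|lborel. F (- x)) = (LINT x|lborel. F x)"
    and "integrable lborel (\<lambda>x. F (- x)) \<longleftrightarrow> integrable lborel F"
proof -
  have *: "lborel = distr lborel borel (uminus :: real ^ 3 \<Rightarrow> real ^ 3)"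
    using lborel_affine[of "-1" "0 :: real ^ 3"] by (simp add: density_1)
  show "(LINT x|lborel. F (- x)) = (LINT x|lborel. F x)"
    by (subst (2) *) (simp add: integral_distr)
  show "integrable lborel (\<lambda>x. F (- x)) \<longleftrightarrow> integrable lborel F"
    by (subst (2) *) (simp add: integrable_distr_eq)
qed

section \<open>Gaussian integrals and convolutions\<close>

lemma nn_integral_gaussian:
  assumes u: "u > (0::real)"
  shows "(\<integral>\<^sup>+x. ennreal (exp (- u * x\<^sup>2)) \<partial>lborel) = ennreal (sqrt (pi / u))"
    and "(\<integral>\<^sup>+x. ennreal (x\<^sup>2 * exp (- u * x\<^sup>2)) \<partial>lborel) = ennreal (sqrt (pi / u) / (2 * u))"
proof -
  \<comment> \<open>The standard deviation for which \<open>exp (- u * x\<^sup>2)\<close> is a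
    multiple of a normal density.\<close>
  define \<sigma> where "\<sigma> = sqrt (1 / (2 * u))"
  have s: "\<sigma> > 0" "\<sigma>\<^sup>2 = 1 / (2 * u)" using u by (simp_all add: \<sigma>_def)
  have nd: "exp (- u * x\<^sup>2) = sqrt (pi / u) * normal_density 0 \<sigma> x" for x
    using u by (simp add: normal_density_def s(2))
  have i0: "integrable lborel (\<lambda>x. sqrt (pi / u) * normal_density 0 \<sigma> x)"
    using s by simp
  have i2: "has_bochner_integral lborel (\<lambda>x. normal_density 0 \<sigma> x * x\<^sup>2) (1 / (2 * u))"
    using normal_moment_even[OF s(1), of 0 1] s(2) by simp
  show "(\<integral>\<^sup>+x. ennreal (exp (- u * x\<^sup>2)) \<partial>lborel) = ennreal (sqrt (pi / u))"
    unfolding nd using i0 s u by (subst nn_integral_eq_integral) (auto simp: normal_density_nonneg)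
  have "has_bochner_integral lborel (\<lambda>x. sqrt (pi / u) * (normal_density 0 \<sigma> x * x\<^sup>2)) (sqrt (pi / u) * (1 / (2 * u)))"
    by (intro has_bochner_integral_mult_right i2)
  then have "has_bochner_integral lborel (\<lambda>x. x\<^sup>2 * exp (- u * x\<^sup>2)) (sqrt (pi / u) / (2 * u))"
    unfolding nd by (simp add: mult_ac)
  then show "(\<integral>\<^sup>+x. ennreal (x\<^sup>2 * exp (- u * x\<^sup>2)) \<partial>lborel) = ennreal (sqrt (pi / u) / (2 * u))"
    by (subst nn_integral_eq_integral) (auto simp: has_bochner_integral_iff)
qed

lemma norm_square_Basis: "(norm (x::'a::euclidean_space))\<^sup>2 = (\<Sum>b\<in>Basis. (x \<bullet> b)\<^sup>2)"
  by (subst power2_norm_eq_inner, subst euclidean_inner, simp add: power2_eq_square)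

lemma card_Basis_vec3 [simp]: "card (Basis :: (real^3) set) = 3"
  using DIM_cart[where 'a=real and 'b=3] by simp

lemma nn_integral_gaussian3:
  assumes u: "u > (0::real)"
  shows "(\<integral>\<^sup>+x. ennreal (exp (- u * (norm (x::real^3))\<^sup>2)) \<partial>lborel) = ennreal (sqrt (pi / u) ^ 3)"
proof -
  have "(\<integral>\<^sup>+x. ennreal (exp (- u * (norm (x::real^3))\<^sup>2)) \<partial>lborel)
      = (\<integral>\<^sup>+x. (\<Prod>b\<in>Basis. ennreal (exp (- u * (x \<bullet> b)\<^sup>2))) \<partial>(lborel :: (real^3) measure))"
    by (simp add: norm_square_Basis sum_distrib_left exp_sum prod_ennreal flip: sum_negf)
  also have "\<dots> = (\<Prod>b\<in>(Basis :: (real^3) set). (\<integral>\<^sup>+x. ennreal (exp (- u * x\<^sup>2)) \<partial>lborel))"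
    by (rule nn_integral_lborel_prod) auto
  also have "\<dots> = ennreal (sqrt (pi / u) ^ 3)"
    unfolding nn_integral_gaussian(1)[OF u] using u by (simp add: ennreal_power)
  finally show ?thesis .
qed

lemma nn_integral_gaussian3_moment:
  assumes u: "u > (0::real)"
  shows "(\<integral>\<^sup>+x. ennreal ((norm (x::real^3))\<^sup>2 * exp (- u * (norm x)\<^sup>2)) \<partial>lborel)
    = ennreal (3 / (2 * u) * sqrt (pi / u) ^ 3)"
proof -
  let ?f = "\<lambda>i b y. ennreal (if b = i then y\<^sup>2 * exp (- u * y\<^sup>2) else exp (- u * y\<^sup>2))"
  have one: "(\<integral>\<^sup>+x. ennreal ((x \<bullet> i)\<^sup>2 * exp (- u * (norm (x::real^3))\<^sup>2)) \<partial>lborel)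
      = ennreal (1 / (2 * u) * sqrt (pi / u) ^ 3)" if i: "i \<in> Basis" for i
  proof -
    have "ennreal ((x \<bullet> i)\<^sup>2 * exp (- u * (norm x)\<^sup>2)) = (\<Prod>b\<in>Basis. ?f i b (x \<bullet> b))" for x
    proof -
      have "exp (- u * (norm x)\<^sup>2) = (\<Prod>b\<in>Basis. exp (- u * (x \<bullet> b)\<^sup>2))"
        by (simp add: norm_square_Basis sum_distrib_left exp_sum flip: sum_negf)
      also have "\<dots> = exp (- u * (x \<bullet> i)\<^sup>2) * (\<Prod>b\<in>Basis - {i}. exp (- u * (x \<bullet> b)\<^sup>2))"
        using i by (rule prod.remove[OF finite_Basis])
      finally have e: "exp (- u * (norm x)\<^sup>2) = exp (- u * (x \<bullet> i)\<^sup>2) * (\<Prod>b\<in>Basis - {i}. exp (- u * (x \<bullet> b)\<^sup>2))" .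
      have "(\<Prod>b\<in>Basis. (if b = i then (x \<bullet> b)\<^sup>2 * exp (- u * (x \<bullet> b)\<^sup>2) else exp (- u * (x \<bullet> b)\<^sup>2)))
          = (x \<bullet> i)\<^sup>2 * exp (- u * (x \<bullet> i)\<^sup>2) * (\<Prod>b\<in>Basis - {i}. exp (- u * (x \<bullet> b)\<^sup>2))"
      proof -
        have "(\<Prod>b\<in>Basis - {i}. (if b = i then (x \<bullet> b)\<^sup>2 * exp (- u * (x \<bullet> b)\<^sup>2) else exp (- u * (x \<bullet> b)\<^sup>2)))
            = (\<Prod>b\<in>Basis - {i}. exp (- u * (x \<bullet> b)\<^sup>2))"
          by (rule prod.cong) auto
        then show ?thesis by (subst prod.remove[OF finite_Basis i]) simp
      qed
      then show ?thesis unfolding e by (subst prod_ennreal) (auto simp: mult_ac)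
    qed
    then have "(\<integral>\<^sup>+x. ennreal ((x \<bullet> i)\<^sup>2 * exp (- u * (norm (x::real^3))\<^sup>2)) \<partial>lborel)
        = (\<integral>\<^sup>+x. (\<Prod>b\<in>Basis. ?f i b (x \<bullet> b)) \<partial>lborel)" by simp
    also have "\<dots> = (\<Prod>b\<in>Basis. (\<integral>\<^sup>+y. ?f i b y \<partial>lborel))"
      by (rule nn_integral_lborel_prod) auto
    also have "\<dots> = (\<integral>\<^sup>+y. ?f i i y \<partial>lborel) * (\<Prod>b\<in>Basis - {i}. (\<integral>\<^sup>+y. ?f i b y \<partial>lborel))"
      by (rule prod.remove[OF finite_Basis i])
    also have "(\<Prod>b\<in>Basis - {i}. (\<integral>\<^sup>+y. ?f i b y \<partial>lborel)) = (\<Prod>b\<in>Basis - {i}. ennreal (sqrt (pi / u)))"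
      by (rule prod.cong) (auto simp: nn_integral_gaussian(1)[OF u, simplified])
    also have "\<dots> = ennreal (sqrt (pi / u) ^ 2)" using i u by (simp add: ennreal_power)
    also have "(\<integral>\<^sup>+y. ?f i i y \<partial>lborel) = ennreal (sqrt (pi / u) / (2 * u))"
      using nn_integral_gaussian(2)[OF u] by simp
    finally show ?thesis
      using u by (simp add: ennreal_mult[symmetric] power3_eq_cube power2_eq_square)
  qed
  have "(\<integral>\<^sup>+x. ennreal ((norm (x::real^3))\<^sup>2 * exp (- u * (norm x)\<^sup>2)) \<partial>lborel)
      = (\<integral>\<^sup>+x. (\<Sum>i\<in>Basis. ennreal ((x \<bullet> i)\<^sup>2 * exp (- u * (norm (x::real^3))\<^sup>2))) \<partial>lborel)"
    by (intro nn_integral_cong) (subst (1) norm_square_Basis, simp add: sum_distrib_right sum_ennreal)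
  also have "\<dots> = (\<Sum>i\<in>(Basis::(real^3) set). ennreal (1 / (2 * u) * sqrt (pi / u) ^ 3))"
    by (subst nn_integral_sum, measurable) (rule sum.cong[OF refl one])
  also have "\<dots> = ennreal (3 * (1 / (2 * u) * sqrt (pi / u) ^ 3))"
    by (subst sum_ennreal) (use u in auto)
  finally show ?thesis by simp
qed

text \<open>The usual heat kernel at time \<open>t / 4\<close>. The parameter adds under convolution
  and is multiplied by \<open>r\<^sup>2\<close> under dilation.\<close>

definition heat :: "real \<Rightarrow> real ^ 3 \<Rightarrow> real" where
  "heat t x = (1 / sqrt (pi * t)) ^ 3 * exp (- ((norm x)\<^sup>2 / t))"

lemma heat_measurable [measurable]: "heat t \<in> borel_measurable borel"
  unfolding heat_def by measurable

lemma heat_nonneg [simp]: "t > 0 \<Longrightarrow> 0 \<le> heat t x"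
  and heat_pos: "t > 0 \<Longrightarrow> 0 < heat t x"
  by (simp_all add: heat_def)

lemma heat_minus [simp]: "heat t (- x) = heat t x"
  by (simp add: heat_def)

lemma heat_le: "t > 0 \<Longrightarrow> heat t x \<le> heat t 0"
  by (simp add: heat_def)

lemma gauss_heat: "u > 0 \<Longrightarrow> exp (- u * (norm x)\<^sup>2) = sqrt (pi / u) ^ 3 * heat (1 / u) x"
  by (simp add: heat_def power_mult_distrib[symmetric] mult.assoc[symmetric] mult.commute)

lemma has_integral_heat:
  assumes t: "t > 0"
  shows "integrable lborel (heat t)" "(LINT x|lborel. heat t x) = 1"
    "integrable lborel (\<lambda>x. (norm x)\<^sup>2 * heat t x)"
proof -
  define c where "c = (1 / sqrt (pi * t)) ^ 3"
  have c: "c > 0" using t by (simp add: c_def)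
  have h: "heat t x = c * exp (- (1 / t) * (norm x)\<^sup>2)" for x by (simp add: heat_def c_def)
  have "(\<integral>\<^sup>+x. ennreal (heat t x) \<partial>lborel) = ennreal c * (\<integral>\<^sup>+x. ennreal (exp (- (1 / t) * (norm (x::real^3))\<^sup>2)) \<partial>lborel)"
    using c by (simp add: h ennreal_mult nn_integral_cmult)
  also have "\<dots> = ennreal (c * sqrt (pi * t) ^ 3)"
    using t c by (subst nn_integral_gaussian3) (auto simp: ennreal_mult)
  also have "c * sqrt (pi * t) ^ 3 = 1" using t by (simp add: c_def power_divide)
  finally have 1: "(\<integral>\<^sup>+x. ennreal (heat t x) \<partial>lborel) = 1" by simp
  show i: "integrable lborel (heat t)"
    by (rule integrableI_nonneg) (use t 1 in auto)
  show "(LINT x|lborel. heat t x) = 1"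
    using 1 t by (subst integral_eq_nn_integral) auto
  have "(\<integral>\<^sup>+x. ennreal ((norm x)\<^sup>2 * heat t x) \<partial>lborel)
      = ennreal c * (\<integral>\<^sup>+x. ennreal ((norm (x::real^3))\<^sup>2 * exp (- (1 / t) * (norm x)\<^sup>2)) \<partial>lborel)"
    using c by (simp add: h nn_integral_cmult[symmetric] ennreal_mult[symmetric] mult_ac)
  also have "\<dots> < \<infinity>"
    using t by (subst nn_integral_gaussian3_moment) (auto simp: ennreal_mult_less_top)
  finally show "integrable lborel (\<lambda>x. (norm x)\<^sup>2 * heat t x)"
    using t by (intro integrableI_nonneg) auto
qed

lemma qvec_measurable [measurable]: "qvec \<in> borel_measurable borel"
proof -
  have "linear qvec" by (intro linearI qvec_add qvec_scaleR)
  then show ?thesis by (intro borel_measurable_continuous_onI linear_continuous_on) (simp add: linear_conv_bounded_linear)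
qed

lemma integrable_heat_qvec:
  assumes t: "t > 0"
  shows "integrable lborel (\<lambda>x. heat t x *\<^sub>R qvec x)"
proof (rule Bochner_Integration.integrable_bound)
  show "integrable lborel (\<lambda>x. heat t x + (norm x)\<^sup>2 * heat t x)"
    using has_integral_heat[OF t] by simp
  show "AE x in lborel. norm (heat t x *\<^sub>R qvec x) \<le> norm (heat t x + (norm x)\<^sup>2 * heat t x)"
  proof (rule AE_I2)
    fix x :: "real ^ 3"
    have "norm x \<le> 1 + (norm x)\<^sup>2"
      using zero_le_power2[of "norm x - 1"] norm_ge_zero[of x] unfolding power2_diff by (simp; linarith)
    then have "heat t x * norm x \<le> heat t x * (1 + (norm x)\<^sup>2)"
      using t by (intro mult_left_mono) auto
    then show "norm (heat t x *\<^sub>R qvec x) \<le> norm (heat t x + (norm x)\<^sup>2 * heat t x)"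
      using t by (simp add: algebra_simps)
  qed
qed simp

lemma integral_heat_qvec:
  assumes t: "t > 0"
  shows "(LINT x|lborel. heat t x *\<^sub>R qvec x) = 0"
proof -
  have "(LINT x|lborel. heat t x *\<^sub>R qvec x) = (LINT x|lborel. heat t (- x) *\<^sub>R qvec (- x))"
    by (rule integral_neg(1)[symmetric]) simp
  also have "\<dots> = - (LINT x|lborel. heat t x *\<^sub>R qvec x)"
    by (simp add: qvec_minus)
  finally show ?thesis by (simp add: eq_neg_iff_add_eq_0 flip: scaleR_2)
qed

text \<open>Completing the square: as a function of \<open>y\<close> the product is again Gaussian,
  centred on the segment from 0 to \<open>x\<close>. Both convolution formulas then need only its
  mass and its centre of mass.\<close>

lemma heat_mult:
  assumes r: "r > 0" and s: "s > 0"
  shows "heat r y * heat s (x - y) = heat (r + s) x * heat (r * s / (r + s)) (y - (r / (r + s)) *\<^sub>R x)"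
proof -
  have A: "(norm y)\<^sup>2 / r + (norm (x - y))\<^sup>2 / s
      = (norm x)\<^sup>2 / (r + s) + (norm (y - (r / (r + s)) *\<^sub>R x))\<^sup>2 / (r * s / (r + s))"
  proof -
    have "norm (y - (r / (r + s)) *\<^sub>R x) ^ 2 = (norm y)\<^sup>2 - 2 * (r / (r + s)) * (x \<bullet> y) + (r / (r + s))\<^sup>2 * (norm x)\<^sup>2"
      unfolding power2_norm_eq_inner by (simp add: inner_simps inner_commute power2_eq_square algebra_simps)
    moreover have "norm (x - y) ^ 2 = (norm x)\<^sup>2 - 2 * (x \<bullet> y) + (norm y)\<^sup>2"
      unfolding power2_norm_eq_inner by (simp add: inner_simps inner_commute)
    moreover have "Y / r + (X - 2 * Z + Y) / s
        = X / (r + s) + (Y - 2 * (r / (r + s)) * Z + (r / (r + s))\<^sup>2 * X) / (r * s / (r + s))" for X Y Z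
    proof -
      have "r + s \<noteq> 0" using r s by simp
      then show ?thesis using r s by (simp add: power2_eq_square divide_simps) (simp add: algebra_simps)
    qed
    ultimately show ?thesis by simp
  qed
  have B: "(1 / sqrt (pi * r)) ^ 3 * (1 / sqrt (pi * s)) ^ 3
      = (1 / sqrt (pi * (r + s))) ^ 3 * (1 / sqrt (pi * (r * s / (r + s)))) ^ 3"
  proof -
    have "sqrt (pi * r) * sqrt (pi * s) = sqrt (pi * (r + s)) * sqrt (pi * (r * s / (r + s)))"
      using r s unfolding real_sqrt_mult[symmetric] by simp
    then show ?thesis unfolding power_mult_distrib[symmetric] by simp
  qed
  have e: "(a * exp (- p)) * (b * exp (- q)) = (a * b) * exp (- (p + q))" for a b p q :: real
    by (simp only: minus_add_distrib exp_add mult_ac)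
  show ?thesis unfolding heat_def e A B ..
qed

lemma heat_convolution:
  assumes r: "r > 0" and s: "s > 0"
  shows "(LINT y|lborel. heat r y * heat s (x - y)) = heat (r + s) x"
    and "(LINT y|lborel. heat r y *\<^sub>R (heat s (x - y) / s) *\<^sub>R qvec (x - y)) = (heat (r + s) x / (r + s)) *\<^sub>R qvec x"
    and "integrable lborel (\<lambda>y. heat r y * heat s (x - y))"
    and "integrable lborel (\<lambda>y. heat r y *\<^sub>R (heat s (x - y) / s) *\<^sub>R qvec (x - y))"
proof -
  define \<tau> where "\<tau> = r * s / (r + s)"
  have \<tau>: "\<tau> > 0" using r s by (simp add: \<tau>_def)
  define m where "m = (r / (r + s)) *\<^sub>R x"
  have hm: "heat r y * heat s (x - y) = heat (r + s) x * heat \<tau> (y - m)" for y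
    unfolding \<tau>_def m_def by (rule heat_mult[OF r s])
  note ht = has_integral_heat[OF \<tau>]
  have "integrable lborel (\<lambda>y. heat \<tau> (y - m))" "(LINT y|lborel. heat \<tau> (y - m)) = 1"
    using ht by (simp_all add: integral_transl)
  then show "(LINT y|lborel. heat r y * heat s (x - y)) = heat (r + s) x"
    "integrable lborel (\<lambda>y. heat r y * heat s (x - y))"
    by (simp_all add: hm)
  \<comment> \<open>The vector \<open>x - y\<close> seen from the centre \<open>m\<close> is a
    constant minus an odd function, and only the constant survives integration.\<close>
  define F where "F z = heat \<tau> z *\<^sub>R qvec (x - m) - heat \<tau> z *\<^sub>R qvec z" for z
  have xm: "x - m = (s / (r + s)) *\<^sub>R x"
  proof -
    have "x - m = (1 - r / (r + s)) *\<^sub>R x" by (simp add: m_def scaleR_left_diff_distrib)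
    also have "1 - r / (r + s) = s / (r + s)" using r s by (simp add: field_simps)
    finally show ?thesis .
  qed
  have [measurable]: "F \<in> borel_measurable borel" unfolding F_def by simp
  have iF: "integrable lborel F" "(LINT z|lborel. F z) = qvec (x - m)"
    unfolding F_def using ht integrable_heat_qvec[OF \<tau>] integral_heat_qvec[OF \<tau>] by simp_all
  have eq: "heat r y *\<^sub>R (heat s (x - y) / s) *\<^sub>R qvec (x - y) = (heat (r + s) x / s) *\<^sub>R F (y - m)" for y
  proof -
    have "heat r y *\<^sub>R (heat s (x - y) / s) *\<^sub>R qvec (x - y) = (1 / s) *\<^sub>R (heat r y * heat s (x - y)) *\<^sub>R qvec (x - y)"
      by simp
    also have "\<dots> = (heat (r + s) x / s) *\<^sub>R heat \<tau> (y - m) *\<^sub>R qvec (x - y)" by (simp add: hm)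
    also have "heat \<tau> (y - m) *\<^sub>R qvec (x - y) = F (y - m)"
      by (simp add: F_def qvec_diff scaleR_diff_right algebra_simps)
    finally show ?thesis .
  qed
  have iF': "integrable lborel (\<lambda>y. F (y - m))" "(LINT y|lborel. F (y - m)) = qvec (x - m)"
    using iF by (simp_all add: integral_transl)
  show "integrable lborel (\<lambda>y. heat r y *\<^sub>R (heat s (x - y) / s) *\<^sub>R qvec (x - y))"
    unfolding eq using iF' by simp
  show "(LINT y|lborel. heat r y *\<^sub>R (heat s (x - y) / s) *\<^sub>R qvec (x - y)) = (heat (r + s) x / (r + s)) *\<^sub>R qvec x"
    unfolding eq using iF' s by (simp add: xm qvec_scaleR)
qed

text \<open>A class given by a pointwise integral over a parameter may be paired under the integral.
  Absolute convergence of the double integral follows from integrability of the norms, by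
  Cauchy-Schwarz for each parameter.\<close>

lemma inner_cls_integral:
  fixes k :: "'a \<Rightarrow> real ^ 3 \<Rightarrow> biquat"
  assumes M: "sigma_finite_measure M"
    and meas [measurable]: "case_prod k \<in> borel_measurable (M \<Otimes>\<^sub>M lborel)"
    and kL: "\<And>a. k a \<in> L2"
    and fin: "(\<integral>\<^sup>+a. ennreal (norm (cls (k a))) \<partial>M) < \<infinity>"
    and int: "\<And>x. integrable M (\<lambda>a. k a x)"
    and \<Psi>: "\<Psi> \<in> L2" "\<And>x. \<Psi> x = (\<integral>a. k a x \<partial>M)"
  shows "cls \<Psi> \<bullet> v = (\<integral>a. cls (k a) \<bullet> v \<partial>M)"
proof -
  interpret M: sigma_finite_measure M by (rule M)
  interpret pair_sigma_finite M "lborel :: (real^3) measure"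
    by (intro pair_sigma_finite.intro M sigma_finite_lborel)
  let ?v = "fun_of v"
  have "(\<integral>\<^sup>+p. ennreal (norm (case p of (a, x) \<Rightarrow> k a x \<bullet> ?v x)) \<partial>(M \<Otimes>\<^sub>M lborel))
      = (\<integral>\<^sup>+a. \<integral>\<^sup>+x. ennreal (norm (k a x \<bullet> ?v x)) \<partial>lborel \<partial>M)"
    by (subst lborel.nn_integral_fst[symmetric]) (auto simp: split_beta')
  also have "\<dots> \<le> (\<integral>\<^sup>+a. ennreal (norm (cls (k a))) * ennreal (norm v) \<partial>M)"
  proof (rule nn_integral_mono)
    fix a
    \<comment> \<open>Flipping signs pointwise makes the integrand equal to its absolute value
      without changing the norm, so Cauchy-Schwarz on classes bounds the integral of the absolute
      value.\<close>
    define w where "w x = (if k a x \<bullet> ?v x < 0 then - 1 else 1) *\<^sub>R k a x" for x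
    have [measurable]: "k a \<in> borel_measurable borel" using kL by (rule L2_measurable)
    have [measurable]: "w \<in> borel_measurable borel" unfolding w_def by measurable
    have wL: "w \<in> L2" by (rule L2_dominated[OF _ kL[of a], of _ 1]) (auto simp: w_def)
    have nw: "norm (cls w) = norm (cls (k a))"
    proof (rule power2_eq_imp_eq)
      have "norm (w x) = norm (k a x)" for x by (simp add: w_def)
      then show "(norm (cls w))\<^sup>2 = (norm (cls (k a)))\<^sup>2" by (simp add: norm_cls_square wL kL)
    qed simp_all
    have "(\<integral>\<^sup>+x. ennreal (norm (k a x \<bullet> ?v x)) \<partial>lborel) = (\<integral>\<^sup>+x. ennreal (w x \<bullet> ?v x) \<partial>lborel)"
      by (intro nn_integral_cong) (simp add: w_def)
    also have "\<dots> = ennreal (LINT x|lborel. w x \<bullet> ?v x)"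
      by (rule nn_integral_eq_integral[OF L2_inner_integrable[OF wL fun_of_L2]]) (auto simp: w_def)
    also have "(LINT x|lborel. w x \<bullet> ?v x) = cls w \<bullet> v"
      using inner_cls[OF wL fun_of_L2[of v]] by simp
    also have "ennreal (cls w \<bullet> v) \<le> ennreal (norm (cls (k a)) * norm v)"
      using norm_cauchy_schwarz[of "cls w" v] by (intro ennreal_leI) (simp add: nw)
    finally show "(\<integral>\<^sup>+x. ennreal (norm (k a x \<bullet> ?v x)) \<partial>lborel) \<le> ennreal (norm (cls (k a))) * ennreal (norm v)"
      by (simp add: ennreal_mult)
  qed
  also have "\<dots> < \<infinity>"
  \<comment> \<open>The norm is measurable in \<open>a\<close> because it is given by an integral
    over \<open>x\<close>; the second case is contradictory.\<close>
  proof (cases "(\<lambda>a. ennreal (norm (cls (k a)))) \<in> borel_measurable M")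
    case True
    then show ?thesis using fin by (simp add: nn_integral_multc ennreal_mult_less_top)
  next
    case False
    have "(\<lambda>a. ennreal (norm (cls (k a)))) = (\<lambda>a. ennreal (sqrt (LINT x|lborel. (norm (k a x))\<^sup>2)))"
      by (simp add: norm_cls_square[symmetric] kL)
    moreover have "(\<lambda>a. ennreal (sqrt (LINT x|lborel. (norm (k a x))\<^sup>2))) \<in> borel_measurable M"
      by measurable
    ultimately show ?thesis using False by simp
  qed
  finally have int2: "integrable (M \<Otimes>\<^sub>M lborel) (\<lambda>(a, x). k a x \<bullet> ?v x)"
    by (intro integrableI_bounded) auto
  have "cls \<Psi> \<bullet> v = (LINT x|lborel. \<Psi> x \<bullet> ?v x)"
    using inner_cls[OF \<Psi>(1) fun_of_L2[of v]] by simp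
  also have "\<dots> = (LINT x|lborel. (\<integral>a. k a x \<bullet> ?v x \<partial>M))"
    by (intro Bochner_Integration.integral_cong refl) (simp add: \<Psi>(2) integral_inner_left[OF int])
  also have "\<dots> = (\<integral>a. (LINT x|lborel. k a x \<bullet> ?v x) \<partial>M)"
    by (rule Fubini_integral[OF int2])
  also have "\<dots> = (\<integral>a. cls (k a) \<bullet> v \<partial>M)"
    using inner_cls[OF kL fun_of_L2[of v]] by simp
  finally show ?thesis .
qed

lemma inner_convolution:
  assumes r: "r > 0" and \<psi>: "\<psi> \<in> L2" and \<Psi>: "\<Psi> \<in> L2"
    and int: "\<And>x. integrable lborel (\<lambda>y. heat r y *\<^sub>R \<psi> (x - y))"
    and eq: "\<And>x. (LINT y|lborel. heat r y *\<^sub>R \<psi> (x - y)) = \<Psi> x"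
  shows "cls \<Psi> \<bullet> v = (LINT y|lborel. heat r y * (transl y (cls \<psi>) \<bullet> v))"
proof -
  have [measurable]: "\<psi> \<in> borel_measurable borel" using \<psi> by (rule L2_measurable)
  have k: "cls (\<lambda>x. heat r y *\<^sub>R \<psi> (x - y)) = heat r y *\<^sub>R transl y (cls \<psi>)" for y
    by (simp add: transl_cls \<psi> cls_scaleR L2_transl)
  have "cls \<Psi> \<bullet> v = (LINT y|lborel. cls (\<lambda>x. heat r y *\<^sub>R \<psi> (x - y)) \<bullet> v)"
  proof (rule inner_cls_integral[OF sigma_finite_lborel _ _ _ int \<Psi> eq[symmetric]])
    show "(\<lambda>(y, x). heat r y *\<^sub>R \<psi> (x - y)) \<in> borel_measurable (lborel \<Otimes>\<^sub>M lborel)" by measurable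
    show "(\<lambda>x. heat r y *\<^sub>R \<psi> (x - y)) \<in> L2" for y using \<psi> by (intro L2_scaleR L2_transl)
    have "(\<integral>\<^sup>+y. ennreal (norm (cls (\<lambda>x. heat r y *\<^sub>R \<psi> (x - y)))) \<partial>lborel)
        = (\<integral>\<^sup>+y. ennreal (norm (cls \<psi>) * heat r y) \<partial>lborel)"
      unfolding k using r by (simp add: mult.commute)
    also have "\<dots> < \<infinity>"
      using integrableD(2)[of lborel "\<lambda>y. norm (cls \<psi>) * heat r y"] has_integral_heat[OF r] r
      by (simp add: less_top)
    finally show "(\<integral>\<^sup>+y. ennreal (norm (cls (\<lambda>x. heat r y *\<^sub>R \<psi> (x - y)))) \<partial>lborel) < \<infinity>" .
  qed
  then show ?thesis by (simp add: k)
qed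

section \<open>Scalar and vector Gaussians and their matrix coefficients\<close>

abbreviation cq :: "complex \<Rightarrow> biquat" where "cq z \<equiv> axis 0 z"

lemma cq_nth: "cq z $ 0 = z" "cq z $ 1 = 0" "cq z $ 2 = 0" "cq z $ 3 = 0"
  by (simp_all add: axis_def)

lemma L2_profile:
  assumes [measurable]: "\<phi> \<in> borel_measurable borel" and int: "integrable lborel (\<lambda>x. (\<phi> x)\<^sup>2)"
  shows "(\<lambda>x. \<phi> x *\<^sub>R q) \<in> L2"
proof (rule L2I)
  show "integrable lborel (\<lambda>x. (norm q)\<^sup>2 * (\<phi> x)\<^sup>2)" using int by simp
qed (auto simp: power_mult_distrib mult.commute)

lemma L2_vector_profile:
  assumes [measurable]: "\<phi> \<in> borel_measurable borel" and int: "integrable lborel (\<lambda>x. (norm x)\<^sup>2 * (\<phi> x)\<^sup>2)"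
  shows "(\<lambda>x. \<phi> x *\<^sub>R (qvec x \<odot> q)) \<in> L2"
proof -
  have "(\<lambda>x. \<phi> x *\<^sub>R qvec x) \<in> L2"
    by (rule L2I[OF _ int]) (auto simp: power_mult_distrib mult.commute)
  from L2_rmul[OF this, of q] show ?thesis by (simp add: qmult.scaleR_left)
qed

lemma heat_square_integrable:
  assumes t: "t > 0"
  shows "integrable lborel (\<lambda>x. (heat t x)\<^sup>2)" "integrable lborel (\<lambda>x. (norm x)\<^sup>2 * (heat t x)\<^sup>2)"
proof -
  have le: "(heat t x)\<^sup>2 \<le> heat t 0 * heat t x" for x
    unfolding power2_eq_square using t by (intro mult_right_mono heat_le) auto
  show "integrable lborel (\<lambda>x. (heat t x)\<^sup>2)"
    by (rule Bochner_Integration.integrable_bound[where f="\<lambda>x. heat t 0 * heat t x"])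
      (use has_integral_heat[OF t] t le in auto)
  show "integrable lborel (\<lambda>x. (norm x)\<^sup>2 * (heat t x)\<^sup>2)"
  proof (rule Bochner_Integration.integrable_bound[where f="\<lambda>x. heat t 0 * ((norm x)\<^sup>2 * heat t x)"])
    show "integrable lborel (\<lambda>x. heat t 0 * ((norm x)\<^sup>2 * heat t x))"
      using has_integral_heat[OF t] by simp
    show "AE x in lborel. norm ((norm x)\<^sup>2 * (heat t x)\<^sup>2) \<le> norm (heat t 0 * ((norm x)\<^sup>2 * heat t x))"
      using t mult_left_mono[OF le, of "(norm x)\<^sup>2" for x] by (auto simp: mult_ac)
  qed simp
qed

definition hq :: "real \<Rightarrow> biquat \<Rightarrow> Ltwo" where "hq t q = cls (\<lambda>x. heat t x *\<^sub>R q)"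
text \<open>Up to the factor \<open>-1/2\<close> this is the Dirac gradient of the Gaussian,
  multiplied by \<open>q\<close>. The division by \<open>t\<close> is what lets convolution with
  \<open>heat r\<close> turn \<open>vq s\<close> into \<open>vq (s + r)\<close>.\<close>

definition vq :: "real \<Rightarrow> biquat \<Rightarrow> Ltwo" where "vq t q = cls (\<lambda>x. (heat t x / t) *\<^sub>R (qvec x \<odot> q))"

lemma hq_L2 [simp]: "t > 0 \<Longrightarrow> (\<lambda>x. heat t x *\<^sub>R q) \<in> L2"
  by (intro L2_profile heat_square_integrable) auto

lemma vq_L2 [simp]: "t > 0 \<Longrightarrow> (\<lambda>x. (heat t x / t) *\<^sub>R (qvec x \<odot> q)) \<in> L2"
  by (intro L2_vector_profile) (auto simp: power_divide heat_square_integrable)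

lemma hq_convolution:
  assumes r: "r > 0" and s: "s > 0"
  shows "hq (s + r) q \<bullet> v = (LINT y|lborel. heat r y * (transl y (hq s q) \<bullet> v))"
  unfolding hq_def
proof (rule inner_convolution[OF r])
  fix x
  have "(LINT y|lborel. heat r y *\<^sub>R heat s (x - y) *\<^sub>R q) = (LINT y|lborel. (heat r y * heat s (x - y)) *\<^sub>R q)"
    by simp
  then show "(LINT y|lborel. heat r y *\<^sub>R heat s (x - y) *\<^sub>R q) = heat (s + r) x *\<^sub>R q"
    using heat_convolution(1,3)[OF r s, of x] by (simp add: add.commute del: scaleR_scaleR)
  show "integrable lborel (\<lambda>y. heat r y *\<^sub>R heat s (x - y) *\<^sub>R q)"
    using heat_convolution(3)[OF r s, of x] by simp
qed (use assms in auto)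

lemma vq_convolution:
  assumes r: "r > 0" and s: "s > 0"
  shows "vq (s + r) q \<bullet> v = (LINT y|lborel. heat r y * (transl y (vq s q) \<bullet> v))"
  unfolding vq_def
proof (rule inner_convolution[OF r])
  fix x
  let ?f = "\<lambda>y. heat r y *\<^sub>R (heat s (x - y) / s) *\<^sub>R qvec (x - y)"
  have eq: "heat r y *\<^sub>R (heat s (x - y) / s) *\<^sub>R (qvec (x - y) \<odot> q) = ?f y \<odot> q" for y
    by (simp add: qmult.scaleR_left)
  note int = heat_convolution(4)[OF r s, of x]
  have bl: "bounded_linear (\<lambda>a. a \<odot> q)" by (rule qmult.bounded_linear_left)
  show "integrable lborel (\<lambda>y. heat r y *\<^sub>R (heat s (x - y) / s) *\<^sub>R (qvec (x - y) \<odot> q))"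
    unfolding eq by (rule integrable_bounded_linear[OF bl int])
  show "(LINT y|lborel. heat r y *\<^sub>R (heat s (x - y) / s) *\<^sub>R (qvec (x - y) \<odot> q))
      = (heat (s + r) x / (s + r)) *\<^sub>R (qvec x \<odot> q)"
    unfolding eq integral_bounded_linear[OF bl int] heat_convolution(2)[OF r s]
    by (simp add: qmult.scaleR_left add.commute)
qed (use assms in auto)

lemma dil_GG [simp]: "r > 0 \<Longrightarrow> (r, axis 0 1, 0) \<in> GG" by (simp add: GG_def)

lemma natural_rep_dil: "natural_rep (r, axis 0 1, 0) f = (\<lambda>x. (r powr (-3/2)) *\<^sub>R f ((1 / r) *\<^sub>R x))"
  by (simp add: fun_eq_iff spin_rot_one qmult_units)

lemma heat_dil: "r > 0 \<Longrightarrow> t > 0 \<Longrightarrow> heat t ((1 / r) *\<^sub>R x) = r ^ 3 * heat (r\<^sup>2 * t) x"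
  by (simp add: heat_def real_sqrt_mult power_mult_distrib power_divide)

lemma powr_m32_power: "(r::real) > 0 \<Longrightarrow> r powr (-3/2) * r ^ n = r powr (real n - 3/2)"
  by (simp add: powr_realpow[symmetric] powr_add[symmetric])

lemma hq_dil:
  assumes r: "r > 0" and t: "t > 0"
  shows "U (r, axis 0 1, 0) (hq t q) = r powr (3/2) *\<^sub>R hq (r\<^sup>2 * t) q"
proof -
  have "r powr (-3/2) * (r ^ 3 * heat (r\<^sup>2 * t) x) = r powr (3/2) * heat (r\<^sup>2 * t) x" for x
    using powr_m32_power[OF r, of 3] by (simp add: mult.assoc[symmetric])
  then have eq: "r powr (-3/2) *\<^sub>R heat t ((1 / r) *\<^sub>R x) *\<^sub>R q = r powr (3/2) *\<^sub>R heat (r\<^sup>2 * t) x *\<^sub>R q" for x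
    by (simp only: scaleR_scaleR heat_dil[OF r t])
  have "U (r, axis 0 1, 0) (hq t q) = cls (\<lambda>x. r powr (3/2) *\<^sub>R heat (r\<^sup>2 * t) x *\<^sub>R q)"
    unfolding hq_def using r t by (subst U_cls) (simp_all only: natural_rep_dil eq dil_GG hq_L2)
  also have "\<dots> = r powr (3/2) *\<^sub>R hq (r\<^sup>2 * t) q"
    unfolding hq_def using r t by (intro cls_scaleR[symmetric] hq_L2) simp
  finally show ?thesis .
qed

lemma vq_dil:
  assumes r: "r > 0" and t: "t > 0"
  shows "U (r, axis 0 1, 0) (vq t q) = r powr (5/2) *\<^sub>R vq (r\<^sup>2 * t) q"
proof -
  have "r powr (-3/2) * (heat t ((1 / r) *\<^sub>R x) / t * (1 / r)) = r powr (5/2) * (heat (r\<^sup>2 * t) x / (r\<^sup>2 * t))" for x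
  proof -
    have "r powr (-3/2) * (heat t ((1 / r) *\<^sub>R x) / t * (1 / r)) = (r powr (-3/2) * r ^ 4) * (heat (r\<^sup>2 * t) x / (r\<^sup>2 * t))"
      using r t by (simp add: heat_dil power2_eq_square power3_eq_cube power4_eq_xxxx)
    also have "r powr (-3/2) * r ^ 4 = r powr (5/2)" using powr_m32_power[OF r, of 4] by simp
    finally show ?thesis .
  qed
  then have eq: "r powr (-3/2) *\<^sub>R (heat t ((1 / r) *\<^sub>R x) / t) *\<^sub>R (qvec ((1 / r) *\<^sub>R x) \<odot> q)
      = r powr (5/2) *\<^sub>R (heat (r\<^sup>2 * t) x / (r\<^sup>2 * t)) *\<^sub>R (qvec x \<odot> q)" for x
    by (simp only: qvec_scaleR qmult.scaleR_left scaleR_scaleR)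
  have "U (r, axis 0 1, 0) (vq t q) = cls (\<lambda>x. r powr (5/2) *\<^sub>R (heat (r\<^sup>2 * t) x / (r\<^sup>2 * t)) *\<^sub>R (qvec x \<odot> q))"
    unfolding vq_def using r t by (subst U_cls) (simp_all only: natural_rep_dil eq dil_GG vq_L2)
  also have "\<dots> = r powr (5/2) *\<^sub>R vq (r\<^sup>2 * t) q"
    unfolding vq_def using r t by (intro cls_scaleR[symmetric] vq_L2) simp
  finally show ?thesis .
qed

text \<open>The heat semigroup can be moved across an intertwiner, so the matrix coefficient depends on
  \<open>t + s\<close> only, and dilations make it homogeneous.\<close>

lemma matrix_coefficient:
  fixes \<psi> :: "real \<Rightarrow> Ltwo"
  assumes T: "intertwiner T" and A: "intertwiner A" and adj: "\<And>u v. T u \<bullet> v = u \<bullet> A v"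
    and conv: "\<And>r s v. r > 0 \<Longrightarrow> s > 0 \<Longrightarrow> \<psi> (s + r) \<bullet> v = (LINT y|lborel. heat r y * (transl y (\<psi> s) \<bullet> v))"
    and dil: "\<And>r s. r > 0 \<Longrightarrow> s > 0 \<Longrightarrow> U (r, axis 0 1, 0) (\<psi> s) = r powr e *\<^sub>R \<psi> (r\<^sup>2 * s)"
    and t: "t > 0" and s: "s > 0"
  shows "A (hq t (cq 1)) \<bullet> \<psi> s = (1 / sqrt (t + s)) powr (3/2 + e) * (A (hq (1/2) (cq 1)) \<bullet> \<psi> (1/2))"
proof -
  define \<phi> where "\<phi> t s = A (hq t (cq 1)) \<bullet> \<psi> s" for t s
  \<comment> \<open>Write the added Gaussian factor as an average of translations, carry these
    through \<open>T\<close> to the other argument, where they become their inverses, and use that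
    \<open>heat r\<close> is even.\<close>
  have move: "\<phi> t (s + r) = \<phi> (t + r) s" if "t > 0" "s > 0" "r > 0" for t s r
  proof -
    let ?F = "\<lambda>y. heat r y * (transl y (hq t (cq 1)) \<bullet> T (\<psi> s))"
    have m: "(\<lambda>y. transl y (hq t (cq 1)) \<bullet> T (\<psi> s)) \<in> borel_measurable borel"
    proof -
      have "(\<lambda>y. transl y (hq t (cq 1)) \<bullet> T (\<psi> s))
        = (\<lambda>y. LINT x|lborel. fun_of (T (\<psi> s)) x \<bullet> (heat t (x - y) *\<^sub>R cq 1))"
      proof
        fix y
        have "(\<lambda>x. heat t (x - y) *\<^sub>R cq 1) \<in> L2"
          using L2_transl[OF hq_L2[OF that(1), of "cq 1"], of y] by simp
        then have "T (\<psi> s) \<bullet> transl y (hq t (cq 1)) = (LINT x|lborel. fun_of (T (\<psi> s)) x \<bullet> (heat t (x - y) *\<^sub>R cq 1))"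
          unfolding hq_def by (subst transl_cls[OF hq_L2[OF that(1)]]) (rule inner_cls_right)
        then show "transl y (hq t (cq 1)) \<bullet> T (\<psi> s) = (LINT x|lborel. fun_of (T (\<psi> s)) x \<bullet> (heat t (x - y) *\<^sub>R cq 1))"
          by (simp add: inner_commute)
      qed
      then show ?thesis by simp
    qed
    have "\<phi> t (s + r) = (LINT y|lborel. heat r y * (transl y (\<psi> s) \<bullet> A (hq t (cq 1))))"
      unfolding \<phi>_def by (subst inner_commute) (rule conv[OF that(3,2)])
    also have "\<dots> = (LINT y|lborel. ?F (- y))"
    proof (intro Bochner_Integration.integral_cong refl)
      fix y
      have "transl y (\<psi> s) \<bullet> A (hq t (cq 1)) = transl y (T (\<psi> s)) \<bullet> hq t (cq 1)"
        by (simp add: adj[symmetric] intertwinerD(4)[OF T])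
      also have "\<dots> = transl (- y) (hq t (cq 1)) \<bullet> T (\<psi> s)"
        by (subst inner_transl_left) (rule inner_commute)
      finally show "heat r y * (transl y (\<psi> s) \<bullet> A (hq t (cq 1))) = ?F (- y)" by simp
    qed
    also have "\<dots> = (LINT y|lborel. ?F y)" using m by (intro integral_neg) simp
    also have "\<dots> = hq (t + r) (cq 1) \<bullet> T (\<psi> s)" by (rule hq_convolution[OF that(3,1), symmetric])
    also have "\<dots> = \<phi> (t + r) s" by (simp add: \<phi>_def inner_commute adj)
    finally show ?thesis .
  qed
  have sum_eq: "\<phi> t s = \<phi> t' s'" if "t > 0" "s > 0" "t' > 0" "s' > 0" "t + s = t' + s'" for t s t' s'
  proof (cases t t' rule: linorder_cases)
    case less
    have "s = s' + (t' - t)" using that by simp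
    then have "\<phi> t s = \<phi> t (s' + (t' - t))" by (rule arg_cong)
    then show ?thesis using move[of t s' "t' - t"] that less by simp
  next
    case greater
    have "s' = s + (t - t')" using that by simp
    then have "\<phi> t' s' = \<phi> t' (s + (t - t'))" by (rule arg_cong)
    then show ?thesis using move[of t' s "t - t'"] that greater by simp
  next
    case equal
    then show ?thesis using that by simp
  qed
  have hom: "\<phi> t s = r powr (3/2 + e) * \<phi> (r\<^sup>2 * t) (r\<^sup>2 * s)" if "t > 0" "s > 0" "r > 0" for t s r
  proof -
    let ?D = "U (r, axis 0 1, 0)"
    have "\<phi> t s = ?D (A (hq t (cq 1))) \<bullet> ?D (\<psi> s)" using that by (simp add: \<phi>_def inner_U)
    also have "\<dots> = A (?D (hq t (cq 1))) \<bullet> ?D (\<psi> s)" using that by (simp add: intertwinerD(2)[OF A])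
    also have "\<dots> = r powr (3/2 + e) * \<phi> (r\<^sup>2 * t) (r\<^sup>2 * s)"
      using that by (simp add: \<phi>_def hq_dil dil linear_scale[OF intertwinerD(1)[OF A]] powr_add)
    finally show ?thesis .
  qed
  \<comment> \<open>The dilation that brings \<open>t + s\<close> to 1. Any pair with sum 1 could
    serve as reference; the symmetric one is taken.\<close>
  let ?r = "1 / sqrt (t + s)"
  have r: "?r > 0" "?r\<^sup>2 = 1 / (t + s)" using t s by (simp_all add: power_divide)
  have "\<phi> t s = ?r powr (3/2 + e) * \<phi> (?r\<^sup>2 * t) (?r\<^sup>2 * s)" by (rule hom[OF t s r(1)])
  also have "\<phi> (?r\<^sup>2 * t) (?r\<^sup>2 * s) = \<phi> (1/2) (1/2)"
    unfolding r(2) using t s by (intro sum_eq) (auto simp: add_divide_distrib[symmetric])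
  finally show ?thesis by (simp add: \<phi>_def)
qed

lemma hq_inner_pos: "t > 0 \<Longrightarrow> s > 0 \<Longrightarrow> hq t (cq 1) \<bullet> hq s (cq 1) > 0"
proof -
  assume t: "t > 0" and s: "s > 0"
  have "hq t (cq 1) \<bullet> hq s (cq 1) = (LINT x|lborel. heat t x * heat s (0 - x))"
    unfolding hq_def using t s by (simp add: inner_cls qinner cq_nth mult.commute)
  also have "\<dots> = heat (t + s) 0" by (rule heat_convolution(1)[OF t s])
  finally show ?thesis using t s by (simp add: heat_pos)
qed

lemma intertwiner_id: "intertwiner (\<lambda>u. u)"
  by (simp add: intertwiner_def linear_ident)

text \<open>The identity is an intertwiner too and its coefficient obeys the same law of
  homogeneity. Since that coefficient is positive, the quotient of the two is a constant, with no
  integral to evaluate.\<close>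

lemma scalar_coefficient:
  assumes T: "intertwiner T" and A: "intertwiner A" and adj: "\<And>u v. T u \<bullet> v = u \<bullet> A v"
  obtains c where "\<And>t s. t > 0 \<Longrightarrow> s > 0 \<Longrightarrow> A (hq t (cq 1)) \<bullet> hq s q = c * (hq t (cq 1) \<bullet> hq s (cq 1))"
proof -
  let ?z = "hq (1/2) (cq 1) \<bullet> hq (1/2) (cq 1)"
  have z: "?z > 0" by (rule hq_inner_pos) auto
  show ?thesis
  proof (rule that[of "(A (hq (1/2) (cq 1)) \<bullet> hq (1/2) q) / ?z"])
    fix t s :: real assume ts: "t > 0" "s > 0"
    show "A (hq t (cq 1)) \<bullet> hq s q = (A (hq (1/2) (cq 1)) \<bullet> hq (1/2) q) / ?z * (hq t (cq 1) \<bullet> hq s (cq 1))"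
      using matrix_coefficient[where \<psi>="\<lambda>s. hq s q" and e="3/2", OF T A adj hq_convolution hq_dil ts]
        matrix_coefficient[where \<psi>="\<lambda>s. hq s (cq 1)" and e="3/2", OF intertwiner_id intertwiner_id refl hq_convolution hq_dil ts] z
      by simp
  qed
qed

text \<open>Comparison with the identity is impossible here, since its coefficients vanish by
  parity. The exponents \<open>3/2\<close> of the scalar and \<open>5/2\<close> of the vector
  Gaussian add up to 4, which gives the explicit power of \<open>t + s\<close>.\<close>

lemma vector_coefficient:
  assumes T: "intertwiner T" and A: "intertwiner A" and adj: "\<And>u v. T u \<bullet> v = u \<bullet> A v"
  obtains c where "\<And>t s. t > 0 \<Longrightarrow> s > 0 \<Longrightarrow> A (hq t (cq 1)) \<bullet> vq s q = c / (t + s)\<^sup>2"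
proof (rule that)
  fix t s :: real assume ts: "t > 0" "s > 0"
  have "(1 / sqrt (t + s)) powr (3/2 + 5/2) = (1 / sqrt (t + s)) ^ 4"
    using ts powr_realpow[of "1 / sqrt (t + s)" 4] by simp
  also have "\<dots> = 1 / (t + s)\<^sup>2"
  proof -
    have "sqrt (t + s) ^ 4 = (sqrt (t + s) ^ 2) ^ 2" by simp
    also have "\<dots> = (t + s)\<^sup>2" using ts by simp
    finally show ?thesis by (simp add: power_divide)
  qed
  finally show "A (hq t (cq 1)) \<bullet> vq s q = (A (hq (1/2) (cq 1)) \<bullet> vq (1/2) q) / (t + s)\<^sup>2"
    using matrix_coefficient[where \<psi>="\<lambda>s. vq s q" and e="5/2", OF T A adj vq_convolution vq_dil ts] by simp
qed

section \<open>Gamma integrals\<close>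

lemma nn_integral_gamma:
  assumes a: "a > (0::real)" and p: "p > 0"
  shows "(\<integral>\<^sup>+u. ennreal (indicator {0<..} u * (u powr (p - 1) * exp (- a * u))) \<partial>lborel)
    = ennreal (Gamma p * a powr (- p))"
proof -
  let ?f = "\<lambda>t::real. ennreal (indicator {0<..} t * (t powr (p - 1) * exp (- t)))"
  have [measurable]: "?f \<in> borel_measurable borel" by measurable
  have "ennreal (Gamma p) = (\<integral>\<^sup>+t. ?f t \<partial>lborel)"
    unfolding Gamma_conv_nn_integral_real[OF p]
    by (intro nn_integral_cong arg_cong[where f=ennreal]) (auto simp: indicator_def exp_minus divide_inverse)
  also have "\<dots> = ennreal \<bar>a\<bar> * (\<integral>\<^sup>+u. ?f (0 + a * u) \<partial>lborel)"
    using a by (intro nn_integral_real_affine) auto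
  also have "(\<integral>\<^sup>+u. ?f (0 + a * u) \<partial>lborel)
      = (\<integral>\<^sup>+u. ennreal (a powr (p - 1)) * ennreal (indicator {0<..} u * (u powr (p - 1) * exp (- a * u))) \<partial>lborel)"
    using a by (intro nn_integral_cong) (auto simp: indicator_def powr_mult ennreal_mult[symmetric] zero_less_mult_iff mult_ac)
  also have "\<dots> = ennreal (a powr (p - 1)) * (\<integral>\<^sup>+u. ennreal (indicator {0<..} u * (u powr (p - 1) * exp (- a * u))) \<partial>lborel)"
    by (intro nn_integral_cmult) measurable
  finally have *: "ennreal (Gamma p) = ennreal (a powr p) * (\<integral>\<^sup>+u. ennreal (indicator {0<..} u * (u powr (p - 1) * exp (- a * u))) \<partial>lborel)"
    using a by (simp add: mult.assoc[symmetric] ennreal_mult[symmetric] powr_mult_base)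
  have "ennreal (Gamma p * a powr (- p)) = ennreal (a powr (- p)) * ennreal (Gamma p)"
    using p by (subst ennreal_mult[symmetric]) (auto simp: mult.commute Gamma_real_nonneg)
  also have "\<dots> = (ennreal (a powr (- p)) * ennreal (a powr p)) * (\<integral>\<^sup>+u. ennreal (indicator {0<..} u * (u powr (p - 1) * exp (- a * u))) \<partial>lborel)"
    unfolding * by (simp add: mult.assoc)
  also have "ennreal (a powr (- p)) * ennreal (a powr p) = 1"
    using a by (simp add: ennreal_mult[symmetric] powr_add[symmetric])
  finally show ?thesis by simp
qed

text \<open>Writing the negative power as a Gamma integral turns both sides into the integral of
  \<open>u powr (p - 1) * v powr (q - 1) * exp (- u - v - u * v * s)\<close>, in which
  \<open>(u, p)\<close> and \<open>(v, q)\<close> may be exchanged.\<close>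

lemma nn_integral_gamma_symmetric:
  assumes s: "s > (0::real)" and p: "p > 0" and q: "q > 0"
  shows "ennreal (Gamma q) * (\<integral>\<^sup>+u. ennreal (indicator {0<..} u * (u powr (p - 1) * exp (- u) * (1 + u * s) powr (- q))) \<partial>lborel)
    = ennreal (Gamma p) * (\<integral>\<^sup>+u. ennreal (indicator {0<..} u * (u powr (q - 1) * exp (- u) * (1 + u * s) powr (- p))) \<partial>lborel)"
proof -
  let ?K = "\<lambda>p q u v. ennreal (indicator {0<..} u * (u powr (p - 1) * exp (- u)))
     * ennreal (indicator {0<..} v * (v powr (q - 1) * exp (- (1 + u * s) * v)))"
  have one: "ennreal (Gamma q) * (\<integral>\<^sup>+u. ennreal (indicator {0<..} u * (u powr (p - 1) * exp (- u) * (1 + u * s) powr (- q))) \<partial>lborel)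
    = (\<integral>\<^sup>+u. \<integral>\<^sup>+v. ?K p q u v \<partial>lborel \<partial>lborel)" if p: "p > 0" and q: "q > 0" for p q
  proof -
    have "ennreal (Gamma q) * (\<integral>\<^sup>+u. ennreal (indicator {0<..} u * (u powr (p - 1) * exp (- u) * (1 + u * s) powr (- q))) \<partial>lborel)
      = (\<integral>\<^sup>+u. ennreal (Gamma q) * ennreal (indicator {0<..} u * (u powr (p - 1) * exp (- u) * (1 + u * s) powr (- q))) \<partial>lborel)"
      by (intro nn_integral_cmult[symmetric]) measurable
    also have "\<dots> = (\<integral>\<^sup>+u. \<integral>\<^sup>+v. ?K p q u v \<partial>lborel \<partial>lborel)"
    proof (intro nn_integral_cong)
      fix u :: real
      show "ennreal (Gamma q) * ennreal (indicator {0<..} u * (u powr (p - 1) * exp (- u) * (1 + u * s) powr (- q)))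
        = (\<integral>\<^sup>+v. ?K p q u v \<partial>lborel)"
      proof (cases "u > 0")
        case True
        then have a: "1 + u * s > 0" using s by (simp add: add_pos_pos)
        have "(\<integral>\<^sup>+v. ?K p q u v \<partial>lborel) = ennreal (indicator {0<..} u * (u powr (p - 1) * exp (- u)))
            * (\<integral>\<^sup>+v. ennreal (indicator {0<..} v * (v powr (q - 1) * exp (- (1 + u * s) * v))) \<partial>lborel)"
          by (intro nn_integral_cmult) measurable
        also have "\<dots> = ennreal (indicator {0<..} u * (u powr (p - 1) * exp (- u))) * ennreal (Gamma q * (1 + u * s) powr (- q))"
          by (simp only: nn_integral_gamma[OF a q])
        finally show ?thesis using True q
          by (simp add: ennreal_mult[symmetric] Gamma_real_nonneg mult_ac)
      qed simp
    qed
    finally show ?thesis .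
  qed
  have sw: "?K p q u v = ?K q p v u" for u v
    by (auto simp: indicator_def ennreal_mult[symmetric] exp_add[symmetric] algebra_simps)
  have "(\<integral>\<^sup>+u. \<integral>\<^sup>+v. ?K p q u v \<partial>lborel \<partial>lborel) = (\<integral>\<^sup>+v. \<integral>\<^sup>+u. ?K p q u v \<partial>lborel \<partial>lborel)"
    by (rule lborel_pair.Fubini'[symmetric]) measurable
  also have "\<dots> = (\<integral>\<^sup>+v. \<integral>\<^sup>+u. ?K q p v u \<partial>lborel \<partial>lborel)" by (simp only: sw)
  finally show ?thesis unfolding one[OF p q] one[OF q p] .
qed

section \<open>The Poisson kernel and its conjugate\<close>

text \<open>The factor \<open>pi\<^sup>2\<close> normalises the mass to one
  (\<open>integral_Pk\<close>) and is also the constant in \<open>hilbert\<close>. \<open>Qk\<close>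
  is only the radial factor of the conjugate kernel, which is
  \<open>Qk t x *\<^sub>R qvec x\<close>.\<close>

definition Pk :: "real \<Rightarrow> real ^ 3 \<Rightarrow> real" where "Pk t x = t / (pi\<^sup>2 * (t\<^sup>2 + (norm x)\<^sup>2)\<^sup>2)"
definition Qk :: "real \<Rightarrow> real ^ 3 \<Rightarrow> real" where "Qk t x = 1 / (pi\<^sup>2 * (t\<^sup>2 + (norm x)\<^sup>2)\<^sup>2)"

lemma Pk_measurable [measurable]: "Pk t \<in> borel_measurable borel"
  and Qk_measurable [measurable]: "Qk t \<in> borel_measurable borel"
  unfolding Pk_def Qk_def by measurable

lemma Pk_nonneg [simp]: "t \<ge> 0 \<Longrightarrow> 0 \<le> Pk t x" and Qk_nonneg [simp]: "0 \<le> Qk t x"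
  by (simp_all add: Pk_def Qk_def)

lemma Pk_1: "Pk 1 x = Qk 1 x" by (simp add: Pk_def Qk_def)

text \<open>The weight that writes the Poisson kernel as a mixture of Gaussians,
  \<open>(1 + a)\<^sup>-\<^sup>2 = \<integral> u exp (- u) exp (- u a) du\<close>.\<close>

definition W :: "real \<Rightarrow> real" where "W u = indicator {0<..} u * (u * exp (- u) / pi\<^sup>2)"

lemma W_measurable [measurable]: "W \<in> borel_measurable borel"
  unfolding W_def by measurable

lemma W_nonneg [simp]: "0 \<le> W u"
  by (simp add: W_def indicator_def)

lemma nn_integral_W: "(\<integral>\<^sup>+u. ennreal (W u * exp (- u * (norm x)\<^sup>2)) \<partial>lborel) = ennreal (Pk 1 x)"
proof -
  define a where "a = 1 + (norm x)\<^sup>2"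
  have a: "a > 0" by (simp add: a_def add_pos_nonneg)
  have "(\<integral>\<^sup>+u. ennreal (W u * exp (- u * (norm x)\<^sup>2)) \<partial>lborel)
      = (\<integral>\<^sup>+u. ennreal (1 / pi\<^sup>2) * ennreal (indicator {0<..} u * (u powr (2 - 1) * exp (- a * u))) \<partial>lborel)"
    by (intro nn_integral_cong)
      (auto simp: W_def indicator_def a_def ennreal_mult[symmetric] exp_add[symmetric] algebra_simps)
  also have "\<dots> = ennreal (1 / pi\<^sup>2) * (\<integral>\<^sup>+u. ennreal (indicator {0<..} u * (u powr (2 - 1) * exp (- a * u))) \<partial>lborel)"
    by (intro nn_integral_cmult) measurable
  also have "\<dots> = ennreal (1 / pi\<^sup>2) * ennreal (Gamma 2 * a powr (- 2))"
    by (subst nn_integral_gamma[OF a]) auto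
  also have "\<dots> = ennreal (Pk 1 x)"
    using a Gamma_fact[of 1, where 'a=real] powr_realpow[OF a, of 2]
    by (simp add: ennreal_mult[symmetric] Pk_def a_def powr_minus divide_inverse)
  finally show ?thesis .
qed

lemma integrable_W: "integrable lborel (\<lambda>u. W u * exp (- u * (norm x)\<^sup>2))"
  and integral_W: "(LINT u|lborel. W u * exp (- u * (norm x)\<^sup>2)) = Pk 1 x"
proof -
  show "integrable lborel (\<lambda>u. W u * exp (- u * (norm x)\<^sup>2))"
    by (rule integrableI_nonneg) (auto simp: nn_integral_W[simplified])
  show "(LINT u|lborel. W u * exp (- u * (norm x)\<^sup>2)) = Pk 1 x"
    by (subst integral_eq_nn_integral) (auto simp: nn_integral_W[simplified])
qed

lemma nn_integral_Pk_mult: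
  assumes [measurable]: "\<phi> \<in> borel_measurable borel"
  shows "(\<integral>\<^sup>+x. ennreal (Pk 1 x) * ennreal (\<phi> x) \<partial>lborel)
    = (\<integral>\<^sup>+u. ennreal (W u) * (\<integral>\<^sup>+x. ennreal (exp (- u * (norm x)\<^sup>2)) * ennreal (\<phi> x) \<partial>lborel) \<partial>lborel)"
proof -
  have "(\<integral>\<^sup>+x. ennreal (Pk 1 x) * ennreal (\<phi> x) \<partial>lborel)
      = (\<integral>\<^sup>+x. \<integral>\<^sup>+u. ennreal (W u) * (ennreal (exp (- u * (norm x)\<^sup>2)) * ennreal (\<phi> x)) \<partial>lborel \<partial>lborel)"
    unfolding nn_integral_W[symmetric]
    by (intro nn_integral_cong) (simp add: nn_integral_multc[symmetric] ennreal_mult mult.assoc)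
  also have "\<dots> = (\<integral>\<^sup>+u. \<integral>\<^sup>+x. ennreal (W u) * (ennreal (exp (- u * (norm x)\<^sup>2)) * ennreal (\<phi> x)) \<partial>lborel \<partial>lborel)"
    by (rule lborel_pair.Fubini'[symmetric]) measurable
  also have "\<dots> = (\<integral>\<^sup>+u. ennreal (W u) * (\<integral>\<^sup>+x. ennreal (exp (- u * (norm x)\<^sup>2)) * ennreal (\<phi> x) \<partial>lborel) \<partial>lborel)"
    by (intro nn_integral_cong nn_integral_cmult) measurable
  finally show ?thesis .
qed

lemma powr_half_rules:
  assumes "(u::real) > 0"
  shows "u powr (- (1/2)) = 1 / sqrt u" "u powr (- (3/2)) = 1 / sqrt u ^ 3" "u powr (3/2) = sqrt u ^ 3"
    "u powr (- (5/2)) = 1 / (u * sqrt u ^ 3)"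
proof -
  have e: "u powr (1/2) = sqrt u" using assms by (simp add: powr_half_sqrt)
  have p: "(u powr (1/2)) ^ n = u powr (real n / 2)" for n
    using assms by (simp add: powr_realpow[symmetric] powr_powr)
  show "u powr (- (1/2)) = 1 / sqrt u" using e powr_minus_divide[of u "1/2"] by simp
  show 3: "u powr (3/2) = sqrt u ^ 3" using p[of 3] e by simp
  show "u powr (- (3/2)) = 1 / sqrt u ^ 3" using 3 powr_minus_divide[of u "3/2"] by simp
  have "u powr (5/2) = u * u powr (3/2)"
    using assms powr_add[of u 1 "3/2"] by simp
  then show "u powr (- (5/2)) = 1 / (u * sqrt u ^ 3)" using 3 powr_minus_divide[of u "5/2"] by simp
qed

lemma sqrt_cubed: "u > 0 \<Longrightarrow> sqrt u ^ 3 = u * sqrt u"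
  by (simp add: power3_eq_cube)

text \<open>Integrating the Gaussian mixture over \<open>x\<close> first leaves
  \<open>u powr (1/2 - 1)\<close>, hence \<open>Gamma (1/2) = sqrt pi\<close>; the other three
  factors \<open>sqrt pi\<close> come from the Gaussians.\<close>

lemma nn_integral_Pk: "(\<integral>\<^sup>+x. ennreal (Pk 1 x) \<partial>lborel) = 1"
proof -
  have "(\<integral>\<^sup>+x. ennreal (Pk 1 x) \<partial>lborel) = (\<integral>\<^sup>+u. ennreal (W u) * (\<integral>\<^sup>+x. ennreal (exp (- u * (norm (x::real^3))\<^sup>2)) \<partial>lborel) \<partial>lborel)"
    using nn_integral_Pk_mult[of "\<lambda>_. 1"] by simp
  also have "\<dots> = (\<integral>\<^sup>+u. ennreal (sqrt pi ^ 3 / pi\<^sup>2) * ennreal (indicator {0<..} u * (u powr (1/2 - 1) * exp (- 1 * u))) \<partial>lborel)"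
  proof (intro nn_integral_cong)
    fix u :: real
    show "ennreal (W u) * (\<integral>\<^sup>+x. ennreal (exp (- u * (norm (x::real^3))\<^sup>2)) \<partial>lborel)
      = ennreal (sqrt pi ^ 3 / pi\<^sup>2) * ennreal (indicator {0<..} u * (u powr (1/2 - 1) * exp (- 1 * u)))"
    proof (cases "u > 0")
      case True
      have "W u * sqrt (pi / u) ^ 3 = sqrt pi ^ 3 / pi\<^sup>2 * (u powr (- (1/2)) * exp (- u))"
        using True by (simp add: W_def real_sqrt_divide power_divide powr_half_rules sqrt_cubed)
      then show ?thesis using True by (simp add: nn_integral_gaussian3[simplified] ennreal_mult[symmetric])
    qed (simp add: W_def)
  qed
  also have "\<dots> = ennreal (sqrt pi ^ 3 / pi\<^sup>2) * (\<integral>\<^sup>+u. ennreal (indicator {0<..} u * (u powr (1/2 - 1) * exp (- 1 * u))) \<partial>lborel)"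
    by (intro nn_integral_cmult) measurable
  also have "\<dots> = ennreal (sqrt pi ^ 3 / pi\<^sup>2) * ennreal (Gamma (1/2) * 1 powr (- (1/2)))"
    by (subst nn_integral_gamma) auto
  also have "\<dots> = ennreal (sqrt pi ^ 3 / pi\<^sup>2 * sqrt pi)"
    by (simp add: ennreal_mult[symmetric] Gamma_one_half_real)
  also have "sqrt pi ^ 3 / pi\<^sup>2 * sqrt pi = 1"
    by (simp add: power3_eq_cube power2_eq_square)
  finally show ?thesis by simp
qed

lemma Pk_scale: "t > 0 \<Longrightarrow> Pk t x = (1 / t ^ 3) * Pk 1 ((1 / t) *\<^sub>R x)"
proof -
  assume t: "t > 0"
  define D where "D = t\<^sup>2 + (norm x)\<^sup>2"
  have D: "D > 0" using t by (simp add: D_def add_pos_nonneg)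
  have "1 + (norm x)\<^sup>2 / t\<^sup>2 = D / t\<^sup>2" using t by (simp add: D_def field_simps)
  then have "Pk 1 ((1 / t) *\<^sub>R x) = 1 / (pi\<^sup>2 * (D / t\<^sup>2)\<^sup>2)"
    by (simp add: Pk_def power_divide)
  then have "(1 / t ^ 3) * Pk 1 ((1 / t) *\<^sub>R x) = t / (pi\<^sup>2 * D\<^sup>2)"
    using t D by (simp add: power2_eq_square power3_eq_cube)
  then show ?thesis by (simp add: Pk_def D_def)
qed

lemma integrable_Pk: "t > 0 \<Longrightarrow> integrable lborel (Pk t)"
  and integral_Pk: "t > 0 \<Longrightarrow> (LINT x|lborel. Pk t x) = 1"
proof -
  assume t: "t > 0"
  have i1: "integrable lborel (Pk 1)" by (rule integrableI_nonneg) (auto simp: nn_integral_Pk)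
  have I1: "(LINT x|lborel. Pk 1 x) = 1" by (subst integral_eq_nn_integral) (auto simp: nn_integral_Pk)
  have a: "act (t, axis 0 1, 0) x = (1 / t) *\<^sub>R x" for x by (simp add: act_def spin_rot_one)
  have e: "Pk t = (\<lambda>x. (1 / t ^ 3) * Pk 1 (act (t, axis 0 1, 0) x))"
    by (simp add: fun_eq_iff a Pk_scale[OF t])
  have j: "integrable lborel (\<lambda>x. Pk 1 (act (t, axis 0 1, 0) x))"
    using integral_act(2)[OF dil_GG[OF t], of "Pk 1"] i1 by simp
  have J: "(LINT x|lborel. Pk 1 (act (t, axis 0 1, 0) x)) = t ^ 3"
    using integral_act(1)[OF dil_GG[OF t], of "Pk 1"] I1 by simp
  show "integrable lborel (Pk t)" unfolding e using j by simp
  show "(LINT x|lborel. Pk t x) = 1" unfolding e using j J t by simp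
qed

lemma Pk_le: "t > 0 \<Longrightarrow> Pk t x \<le> Pk t 0"
  unfolding Pk_def by (intro divide_left_mono mult_left_mono power_mono mult_pos_pos) (auto simp: add_pos_nonneg)

lemma Pk_pos: "t > 0 \<Longrightarrow> 0 < Pk t x"
  by (simp add: Pk_def add_pos_nonneg)

lemma Pk_square_integrable: "t > 0 \<Longrightarrow> integrable lborel (\<lambda>x. (Pk t x)\<^sup>2)"
proof (rule Bochner_Integration.integrable_bound[where f="\<lambda>x. Pk t 0 * Pk t x"])
  assume t: "t > 0"
  have "(Pk t x)\<^sup>2 \<le> Pk t 0 * Pk t x" for x
    unfolding power2_eq_square using t by (intro mult_right_mono Pk_le) auto
  then show "AE x in lborel. norm ((Pk t x)\<^sup>2) \<le> norm (Pk t 0 * Pk t x)" using t by auto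
qed (auto simp: integrable_Pk)

lemma Qk_Pk: "t > 0 \<Longrightarrow> Qk t x = Pk t x / t"
  by (simp add: Pk_def Qk_def)

lemma Qk_square_integrable:
  assumes t: "t > 0"
  shows "integrable lborel (\<lambda>x. (norm x)\<^sup>2 * (Qk t x)\<^sup>2)"
proof (rule Bochner_Integration.integrable_bound[where f="\<lambda>x. (1 / (pi\<^sup>2 * t\<^sup>2)) * (Pk t x / t)"])
  have "(norm x)\<^sup>2 * (Qk t x)\<^sup>2 \<le> (1 / (pi\<^sup>2 * t\<^sup>2)) * Qk t x" for x
  proof -
    define D where "D = t\<^sup>2 + (norm x)\<^sup>2"
    have D: "D > 0" "(norm x)\<^sup>2 \<le> D" "t\<^sup>2 \<le> D" using t by (auto simp: D_def add_pos_nonneg)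
    have "(norm x)\<^sup>2 * Qk t x \<le> D * Qk t x" using D by (intro mult_right_mono) auto
    also have "\<dots> = 1 / (pi\<^sup>2 * D)" proof -
      have "Qk t x = 1 / (pi\<^sup>2 * D\<^sup>2)" by (simp add: Qk_def D_def)
      then show ?thesis using D by (simp add: power2_eq_square)
    qed
    also have "\<dots> \<le> 1 / (pi\<^sup>2 * t\<^sup>2)" using D t by (intro divide_left_mono mult_left_mono mult_pos_pos) auto
    finally have "((norm x)\<^sup>2 * Qk t x) * Qk t x \<le> (1 / (pi\<^sup>2 * t\<^sup>2)) * Qk t x" by (intro mult_right_mono) auto
    then show ?thesis by (simp add: power2_eq_square mult_ac)
  qed
  then show "AE x in lborel. norm ((norm x)\<^sup>2 * (Qk t x)\<^sup>2) \<le> norm ((1 / (pi\<^sup>2 * t\<^sup>2)) * (Pk t x / t))"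
    using t by (auto simp: Qk_Pk[symmetric])
qed (use t in \<open>auto simp: integrable_Pk\<close>)

definition Pv :: "real \<Rightarrow> biquat \<Rightarrow> Ltwo" where "Pv t q = cls (\<lambda>x. Pk t x *\<^sub>R q)"
definition Qv :: "real \<Rightarrow> biquat \<Rightarrow> Ltwo" where "Qv t q = cls (\<lambda>x. Qk t x *\<^sub>R (qvec x \<odot> q))"

lemma Pv_L2 [simp]: "t > 0 \<Longrightarrow> (\<lambda>x. Pk t x *\<^sub>R q) \<in> L2"
  by (intro L2_profile Pk_square_integrable) auto

lemma Qv_L2 [simp]: "t > 0 \<Longrightarrow> (\<lambda>x. Qk t x *\<^sub>R (qvec x \<odot> q)) \<in> L2"
  by (intro L2_vector_profile Qk_square_integrable) auto

lemma norm_hq: "t > 0 \<Longrightarrow> norm (hq t q) = norm q * sqrt (heat (2 * t) 0)"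
proof -
  assume t: "t > 0"
  have "(norm (hq t q))\<^sup>2 = (LINT x|lborel. (norm (heat t x *\<^sub>R q))\<^sup>2)"
    unfolding hq_def using t by (intro norm_cls_square hq_L2)
  also have "\<dots> = (norm q)\<^sup>2 * (LINT x|lborel. heat t x * heat t (0 - x))"
    by (simp add: power_mult_distrib power2_eq_square mult_ac)
  also have "\<dots> = (norm q * sqrt (heat (2 * t) 0))\<^sup>2"
    using heat_convolution(1)[OF t t, of 0] t by (simp add: power_mult_distrib)
  finally show ?thesis by (rule power2_eq_imp_eq) (use t in \<open>simp_all\<close>)
qed

text \<open>Carries identities for Gaussians over to the Poisson kernel. Since the pairing is with
  an arbitrary vector, the norms of the Gaussians have to be integrable against the weight, both for
  small and for large \<open>u\<close>.\<close>

lemma Pv_inner_mixture: "Pv 1 q \<bullet> v = (LINT u|lborel. (W u * sqrt (pi / u) ^ 3) * (hq (1 / u) q \<bullet> v))"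
proof -
  define k where "k u x = (W u * exp (- u * (norm x)\<^sup>2)) *\<^sub>R q" for u and x :: "real ^ 3"
  have k: "k u = (\<lambda>x. (W u * sqrt (pi / u) ^ 3) *\<^sub>R heat (1 / u) x *\<^sub>R q)" for u
  proof (cases "u > 0")
    case True then show ?thesis unfolding k_def fun_eq_iff by (simp add: gauss_heat[simplified])
  qed (simp add: k_def fun_eq_iff W_def)
  have kL: "k u \<in> L2" for u
  proof (cases "u > 0")
    case True then show ?thesis unfolding k by (intro L2_scaleR hq_L2) simp
  next
    case False
    then have "k u = (\<lambda>x. 0)" by (simp add: fun_eq_iff k_def W_def)
    then show ?thesis by simp
  qed
  have kc: "cls (k u) = (W u * sqrt (pi / u) ^ 3) *\<^sub>R hq (1 / u) q" for u
  proof (cases "u > 0")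
    case True then show ?thesis unfolding k hq_def by (intro cls_scaleR[symmetric] hq_L2) simp
  next
    case False
    then have "k u = (\<lambda>x. 0)" by (simp add: fun_eq_iff k_def W_def)
    then have "cls (k u) = 0" by (simp add: zero_Ltwo_def)
    then show ?thesis using False by (simp add: W_def)
  qed
  \<comment> \<open>The true size of \<open>u * B\<close> is a multiple of the fourth root of
    \<open>u\<close>. The generous bound \<open>4 + 4 * u\<close> is chosen so that two Gamma
    integrals with whole exponents dominate.\<close>
  have bound: "norm (cls (k u)) \<le> norm q * (indicator {0<..} u * ((4 + 4 * u) * exp (- u)))" for u
  proof (cases "u > 0")
    case u: True
    define B where "B = sqrt (pi / u) ^ 3 * sqrt (heat (2 * (1 / u)) 0)"
    have B0: "B \<ge> 0" using u by (simp add: B_def)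
    have "u * B \<le> 4 + 4 * u"
    proof (rule power2_le_imp_le)
      have "(sqrt (pi / u) ^ 3)\<^sup>2 = (pi / u) ^ 3" proof -
        have "(sqrt (pi / u) ^ 3)\<^sup>2 = ((sqrt (pi / u))\<^sup>2) ^ 3" by (simp only: power_mult[symmetric] mult.commute)
        then show ?thesis using u by simp
      qed
      then have "B\<^sup>2 = (pi / u) ^ 3 * (1 / sqrt (pi * (2 / u))) ^ 3"
        using u by (simp add: B_def power_mult_distrib heat_def)
      also have "\<dots> = (pi / u) ^ 3 * (1 / ((pi * (2 / u)) * sqrt (pi * (2 / u))))"
        using u by (subst power_divide, subst sqrt_cubed) auto
      finally have "(u * B)\<^sup>2 = u\<^sup>2 * ((pi / u) ^ 3 * (1 / ((pi * (2 / u)) * sqrt (pi * (2 / u)))))"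
        by (simp add: power_mult_distrib)
      also have "\<dots> = pi\<^sup>2 / 2 / sqrt (pi * (2 / u))"
        using u by (simp add: field_simps power2_eq_square power3_eq_cube)
      also have "\<dots> = pi\<^sup>2 / 2 * sqrt (u / (2 * pi))"
        using u by (simp add: real_sqrt_divide real_sqrt_mult field_simps)
      also have "\<dots> \<le> pi\<^sup>2 / 2 * (1 + u / (2 * pi))"
      proof (intro mult_left_mono)
        define y where "y = sqrt (u / (2 * pi))"
        have "y\<^sup>2 = u / (2 * pi)" using u by (simp add: y_def)
        moreover have "y \<le> 1 + y\<^sup>2" using zero_le_power2[of "y - 1/2"] by (simp add: power2_eq_square algebra_simps)
        ultimately show "sqrt (u / (2 * pi)) \<le> 1 + u / (2 * pi)" by (simp add: y_def)
      qed simp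
      also have "\<dots> = pi\<^sup>2 / 2 + pi / 4 * u" by (simp add: field_simps power2_eq_square)
      also have "\<dots> \<le> 8 + u" 
      proof -
        have "pi\<^sup>2 \<le> 4\<^sup>2" using pi_less_4 by (intro power_mono) auto
        moreover have "pi / 4 * u \<le> 1 * u" using pi_less_4 u by (intro mult_right_mono) auto
        ultimately show ?thesis by simp
      qed
      also have "\<dots> \<le> (4 + 4 * u)\<^sup>2" using u by (simp add: power2_eq_square algebra_simps)
      finally show "(u * B)\<^sup>2 \<le> (4 + 4 * u)\<^sup>2" .
    qed (use u in simp)
    then have "(u * B) * (norm q * exp (- u) / pi\<^sup>2) \<le> (4 + 4 * u) * (norm q * exp (- u) / pi\<^sup>2)"
      by (intro mult_right_mono) auto
    also have "\<dots> \<le> (4 + 4 * u) * (norm q * exp (- u) / 1)"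
    proof (intro mult_left_mono divide_left_mono)
      have "1\<^sup>2 \<le> pi\<^sup>2" using pi_ge_two by (intro power_mono) auto
      then show "1 \<le> pi\<^sup>2" by simp
    qed (use u in auto)
    finally show ?thesis using u by (simp add: kc norm_hq W_def B_def mult_ac abs_mult)
  qed (simp add: kc W_def)
  have "Pv 1 q \<bullet> v = (LINT u|lborel. cls (k u) \<bullet> v)"
    unfolding Pv_def
  proof (rule inner_cls_integral[OF sigma_finite_lborel _ kL])
    show "case_prod k \<in> borel_measurable (lborel \<Otimes>\<^sub>M lborel)" unfolding k_def by measurable
    show "integrable lborel (\<lambda>u. k u x)" for x unfolding k_def by (intro integrable_scaleR_left integrable_W)
    show "Pk 1 x *\<^sub>R q = (LINT u|lborel. k u x)" for x
      unfolding k_def using integrable_W[of x] by (simp add: integral_W[simplified])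
    have "(\<integral>\<^sup>+u. ennreal (norm (cls (k u))) \<partial>lborel)
        \<le> (\<integral>\<^sup>+u. ennreal (4 * norm q) * ennreal (indicator {0<..} u * (u powr (1 - 1) * exp (- 1 * u)))
          + ennreal (4 * norm q) * ennreal (indicator {0<..} u * (u powr (2 - 1) * exp (- 1 * u))) \<partial>lborel)"
    proof (rule nn_integral_mono)
      fix u :: real
      have "norm q * (indicator {0<..} u * ((4 + 4 * u) * exp (- u)))
        = (4 * norm q) * (indicator {0<..} u * (u powr (1 - 1) * exp (- 1 * u)))
          + (4 * norm q) * (indicator {0<..} u * (u powr (2 - 1) * exp (- 1 * u)))"
        by (auto simp: indicator_def algebra_simps)
      then have "norm (cls (k u)) \<le> (4 * norm q) * (indicator {0<..} u * (u powr (1 - 1) * exp (- 1 * u)))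
          + (4 * norm q) * (indicator {0<..} u * (u powr (2 - 1) * exp (- 1 * u)))" using bound[of u] by simp
      then show "ennreal (norm (cls (k u))) \<le> ennreal (4 * norm q) * ennreal (indicator {0<..} u * (u powr (1 - 1) * exp (- 1 * u)))
          + ennreal (4 * norm q) * ennreal (indicator {0<..} u * (u powr (2 - 1) * exp (- 1 * u)))"
        by (subst (1 2) ennreal_mult[symmetric]) (auto simp: ennreal_plus[symmetric] indicator_def intro: ennreal_leI simp del: ennreal_plus)
    qed
    also have "\<dots> = ennreal (4 * norm q) * (\<integral>\<^sup>+u. ennreal (indicator {0<..} u * (u powr (1 - 1) * exp (- 1 * u))) \<partial>lborel)
      + ennreal (4 * norm q) * (\<integral>\<^sup>+u. ennreal (indicator {0<..} u * (u powr (2 - 1) * exp (- 1 * u))) \<partial>lborel)"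
      by (subst nn_integral_add) (auto intro!: arg_cong2[where f="(+)"] nn_integral_cmult)
    also have "\<dots> < \<infinity>"
      by (subst (1 2) nn_integral_gamma) (auto simp: ennreal_mult_less_top)
    finally show "(\<integral>\<^sup>+u. ennreal (norm (cls (k u))) \<partial>lborel) < \<infinity>" .
  qed simp
  then show ?thesis by (simp add: kc)
qed

text \<open>The vector coefficient of a Poisson image is a multiple of \<open>omega\<close>. It is proportional to the
  coefficient of \<open>Qv\<close> because the double integral in \<open>nn_integral_gamma_symmetric\<close> is
  symmetric in its exponents.\<close>

definition omega :: "real \<Rightarrow> real" where
  "omega s = (LINT u|lborel. (W u * sqrt (pi / u) ^ 3) * (1 / (1 / u + s)\<^sup>2))"

lemma omega_eq:
  obtains K where "\<And>s. s > 0 \<Longrightarrow> omega s = K * (Qv 1 (cq 1) \<bullet> vq s (cq 1))"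
proof (rule that)
  fix s :: real assume s: "s > 0"
  define \<kappa> where "\<kappa> = Qv 1 (cq 1) \<bullet> vq s (cq 1)"
  define \<phi> where "\<phi> x = (norm x)\<^sup>2 * heat s x / s" for x
  have [measurable]: "\<phi> \<in> borel_measurable borel" unfolding \<phi>_def by measurable
  have \<phi>0: "\<phi> x \<ge> 0" for x using s by (simp add: \<phi>_def)
  have in_eq: "(Qk 1 x *\<^sub>R (qvec x \<odot> cq 1)) \<bullet> ((heat s x / s) *\<^sub>R (qvec x \<odot> cq 1)) = Pk 1 x * \<phi> x" for x
    by (simp add: Pk_1 \<phi>_def qmult_units power2_norm_eq_inner[symmetric] mult_ac)
  have \<kappa>: "\<kappa> = (LINT x|lborel. Pk 1 x * \<phi> x)"
    unfolding \<kappa>_def Qv_def vq_def using s by (subst inner_cls) (simp_all only: in_eq Qv_L2 vq_L2 zero_less_one)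
  have int: "integrable lborel (\<lambda>x. Pk 1 x * \<phi> x)"
    using L2_inner_integrable[OF Qv_L2[of 1 "cq 1"] vq_L2[OF s, of "cq 1"]] unfolding in_eq by simp
  \<comment> \<open>The two integrals related by \<open>nn_integral_gamma_symmetric\<close> for the
    exponents 2 and \<open>5/2\<close>. In \<open>X\<close> the \<open>5/2\<close> comes from the
    second moment of a Gaussian, and the 2 from the weight \<open>W\<close>; in \<open>Y\<close> the
    roles are reversed, the negative power being that of \<open>vector_coefficient\<close>.\<close>
  define X where "X = (\<integral>\<^sup>+u. ennreal (indicator {0<..} u * (u powr (2 - 1) * exp (- u) * (1 + u * s) powr (- (5/2)))) \<partial>lborel)"
  define Y where "Y = (\<integral>\<^sup>+u. ennreal (indicator {0<..} u * (u powr (5/2 - 1) * exp (- u) * (1 + u * s) powr (- 2))) \<partial>lborel)"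
  have "ennreal \<kappa> = (\<integral>\<^sup>+x. ennreal (Pk 1 x) * ennreal (\<phi> x) \<partial>lborel)"
    unfolding \<kappa> using int \<phi>0 by (subst nn_integral_eq_integral[symmetric]) (auto simp: ennreal_mult)
  also have "\<dots> = (\<integral>\<^sup>+u. ennreal (W u) * (\<integral>\<^sup>+x. ennreal (exp (- u * (norm x)\<^sup>2)) * ennreal (\<phi> x) \<partial>lborel) \<partial>lborel)"
    by (rule nn_integral_Pk_mult) simp
  also have "\<dots> = (\<integral>\<^sup>+u. ennreal (3 / (2 * pi\<^sup>2)) * ennreal (indicator {0<..} u * (u powr (2 - 1) * exp (- u) * (1 + u * s) powr (- (5/2)))) \<partial>lborel)"
  proof (intro nn_integral_cong)
    fix u :: real
    show "ennreal (W u) * (\<integral>\<^sup>+x. ennreal (exp (- u * (norm x)\<^sup>2)) * ennreal (\<phi> x) \<partial>lborel)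
      = ennreal (3 / (2 * pi\<^sup>2)) * ennreal (indicator {0<..} u * (u powr (2 - 1) * exp (- u) * (1 + u * s) powr (- (5/2))))"
    proof (cases "u > 0")
      case u: True
      define c where "c = (1 / sqrt (pi * s)) ^ 3 / s"
      have c: "c > 0" using s by (simp add: c_def)
      define a where "a = u + 1 / s"
      have a: "a > 0" "a * s = 1 + u * s" using u s by (auto simp: a_def add_pos_pos field_simps)
      have "(\<integral>\<^sup>+x. ennreal (exp (- u * (norm x)\<^sup>2)) * ennreal (\<phi> x) \<partial>lborel)
          = (\<integral>\<^sup>+x. ennreal c * ennreal ((norm (x::real^3))\<^sup>2 * exp (- a * (norm x)\<^sup>2)) \<partial>lborel)"
      proof (intro nn_integral_cong)
        fix x :: "real ^ 3"
        have "exp (- u * (norm x)\<^sup>2) * exp (- ((norm x)\<^sup>2 / s)) = exp (- a * (norm x)\<^sup>2)"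
          unfolding exp_add[symmetric] by (simp add: a_def algebra_simps)
        then have "exp (- u * (norm x)\<^sup>2) * \<phi> x = c * ((norm x)\<^sup>2 * exp (- a * (norm x)\<^sup>2))"
          by (simp add: \<phi>_def heat_def c_def mult_ac)
        then show "ennreal (exp (- u * (norm x)\<^sup>2)) * ennreal (\<phi> x) = ennreal c * ennreal ((norm x)\<^sup>2 * exp (- a * (norm x)\<^sup>2))"
          using c \<phi>0 by (simp add: ennreal_mult[symmetric])
      qed
      also have "\<dots> = ennreal c * ennreal (3 / (2 * a) * sqrt (pi / a) ^ 3)"
        by (subst nn_integral_cmult) (simp_all only: nn_integral_gaussian3_moment[OF a(1)], measurable)
      finally have "ennreal (W u) * (\<integral>\<^sup>+x. ennreal (exp (- u * (norm x)\<^sup>2)) * ennreal (\<phi> x) \<partial>lborel)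
          = ennreal (W u * (c * (3 / (2 * a) * sqrt (pi / a) ^ 3)))"
        using c a by (simp add: ennreal_mult[symmetric])
      also have "W u * (c * (3 / (2 * a) * sqrt (pi / a) ^ 3)) = 3 / (2 * pi\<^sup>2) * (u * exp (- u) * (1 + u * s) powr (- (5/2)))"
      proof -
        define y where "y = 1 + u * s"
        have y: "a * s = y" "y > 0" using a s by (simp_all add: y_def[symmetric], metis mult_pos_pos)
        have "(1 / sqrt (pi * s)) ^ 3 * sqrt (pi / a) ^ 3 = (1 / sqrt y) ^ 3"
          unfolding power_mult_distrib[symmetric] y(1)[symmetric] using s a(1)
          by (simp add: real_sqrt_mult real_sqrt_divide mult.commute)
        moreover have "c * (3 / (2 * a) * sqrt (pi / a) ^ 3) = ((1 / sqrt (pi * s)) ^ 3 * sqrt (pi / a) ^ 3) * (3 / (2 * (a * s)))"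
          using s a(1) by (simp add: c_def mult_ac)
        ultimately have "c * (3 / (2 * a) * sqrt (pi / a) ^ 3) = (1 / sqrt y) ^ 3 * (3 / (2 * y))"
          unfolding y(1) by simp
        moreover have "y powr (- (5/2)) = 1 / (y * sqrt y ^ 3)"
          using powr_half_rules(4)[OF y(2)] by simp
        moreover have "u * exp (- u) / pi\<^sup>2 * ((1 / sqrt y) ^ 3 * (3 / (2 * y))) = 3 / (2 * pi\<^sup>2) * (u * exp (- u) * (1 / (y * sqrt y ^ 3)))"
          by (simp add: power_divide mult_ac)
        moreover have "W u = u * exp (- u) / pi\<^sup>2" using u by (simp add: W_def)
        ultimately show ?thesis unfolding y_def[symmetric] by metis
      qed
      finally show ?thesis using u by (simp add: ennreal_mult[symmetric])
    qed (simp add: W_def)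
  qed
  also have "\<dots> = ennreal (3 / (2 * pi\<^sup>2)) * X" unfolding X_def by (intro nn_integral_cmult) measurable
  finally have \<kappa>X: "ennreal \<kappa> = ennreal (3 / (2 * pi\<^sup>2)) * X" .
  have "(\<integral>\<^sup>+u. ennreal ((W u * sqrt (pi / u) ^ 3) * (1 / (1 / u + s)\<^sup>2)) \<partial>lborel)
    = (\<integral>\<^sup>+u. ennreal (sqrt pi ^ 3 / pi\<^sup>2) * ennreal (indicator {0<..} u * (u powr (5/2 - 1) * exp (- u) * (1 + u * s) powr (- 2))) \<partial>lborel)"
  proof (intro nn_integral_cong)
    fix u :: real
    show "ennreal ((W u * sqrt (pi / u) ^ 3) * (1 / (1 / u + s)\<^sup>2))
      = ennreal (sqrt pi ^ 3 / pi\<^sup>2) * ennreal (indicator {0<..} u * (u powr (5/2 - 1) * exp (- u) * (1 + u * s) powr (- 2)))"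
    proof (cases "u > 0")
      case u: True
      define y where "y = 1 + u * s"
      have y: "y > 0" using u s by (simp add: y_def add_pos_pos)
      define z where "z = sqrt u"
      have z: "z > 0" "u = z\<^sup>2" using u by (simp_all add: z_def)
      have "1 / u + s = y / u" using u by (simp add: y_def field_simps)
      then have 1: "1 / (1 / u + s)\<^sup>2 = u\<^sup>2 / y\<^sup>2" by (simp add: power_divide)
      have 2: "y powr (- 2) = 1 / y\<^sup>2"
        using powr_minus_divide[of y 2] powr_realpow[OF y, of 2] by simp
      have 3: "u powr (5/2 - 1) = z ^ 3" using powr_half_rules(3)[OF u] by (simp add: z_def)
      have 4: "sqrt (pi / u) ^ 3 = sqrt pi ^ 3 / z ^ 3" by (simp add: real_sqrt_divide power_divide z_def)
      have 5: "W u = u * exp (- u) / pi\<^sup>2" using u by (simp add: W_def)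
      have 6: "u / z ^ 3 * u\<^sup>2 = z ^ 3" using z(1) unfolding z(2) by (simp add: power2_eq_square power3_eq_cube)
      have "(u * exp (- u) / pi\<^sup>2 * (sqrt pi ^ 3 / z ^ 3)) * (u\<^sup>2 / y\<^sup>2)
          = sqrt pi ^ 3 / pi\<^sup>2 * ((u / z ^ 3 * u\<^sup>2) * exp (- u) * (1 / y\<^sup>2))"
        by (simp add: mult_ac)
      then have "(W u * sqrt (pi / u) ^ 3) * (1 / (1 / u + s)\<^sup>2)
        = sqrt pi ^ 3 / pi\<^sup>2 * (u powr (5/2 - 1) * exp (- u) * (1 + u * s) powr (- 2))"
        unfolding y_def[symmetric] 1 2 3 4 5 6 .
      then show ?thesis using u by (simp add: ennreal_mult[symmetric])
    qed (simp add: W_def)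
  qed
  also have "\<dots> = ennreal (sqrt pi ^ 3 / pi\<^sup>2) * Y" unfolding Y_def by (intro nn_integral_cmult) measurable
  also have "Y = ennreal (Gamma (5/2)) * X"
    using nn_integral_gamma_symmetric[OF s, of 2 "5/2"] Gamma_fact[of 1, where 'a=real] by (simp add: X_def Y_def)
  also have "X = ennreal (2 * pi\<^sup>2 / 3) * ennreal \<kappa>"
    unfolding \<kappa>X by (simp add: mult.assoc[symmetric] ennreal_mult[symmetric])
  also have "ennreal (sqrt pi ^ 3 / pi\<^sup>2) * (ennreal (Gamma (5/2)) * (ennreal (2 * pi\<^sup>2 / 3) * ennreal \<kappa>))
     = ennreal ((sqrt pi ^ 3 / pi\<^sup>2 * Gamma (5/2) * (2 * pi\<^sup>2 / 3)) * \<kappa>)"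
    using int \<phi>0 by (simp add: ennreal_mult[symmetric] Gamma_real_nonneg \<kappa> mult_ac)
  finally have n: "(\<integral>\<^sup>+u. ennreal ((W u * sqrt (pi / u) ^ 3) * (1 / (1 / u + s)\<^sup>2)) \<partial>lborel)
     = ennreal ((sqrt pi ^ 3 / pi\<^sup>2 * Gamma (5/2) * (2 * pi\<^sup>2 / 3)) * \<kappa>)" .
  have \<kappa>0: "\<kappa> \<ge> 0" unfolding \<kappa> using \<phi>0 by (intro Bochner_Integration.integral_nonneg) simp
  have "0 \<le> (W u * sqrt (pi / u) ^ 3) * (1 / (1 / u + s)\<^sup>2)" for u
    by (cases "u > 0") (auto simp: W_def)
  then show "omega s = (sqrt pi ^ 3 / pi\<^sup>2 * Gamma (5/2) * (2 * pi\<^sup>2 / 3)) * (Qv 1 (cq 1) \<bullet> vq s (cq 1))"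
    unfolding omega_def using \<kappa>0 by (subst integral_eq_nn_integral) (auto simp: n[simplified] \<kappa>_def Gamma_real_nonneg)
qed

lemma inner_cq_qvec: "cq z \<bullet> (qvec x \<odot> cq w) = 0" "(qvec x \<odot> cq w) \<bullet> cq z = 0"
  by (simp_all add: qinner cq_nth qmult_nth qvec_nth)

lemma inner_cq: "cq z \<bullet> cq w = Re (z * cnj w)"
  by (simp add: qinner cq_nth)

lemma inner_qvec_cq: "(qvec x \<odot> cq z) \<bullet> (qvec x \<odot> cq w) = (norm x)\<^sup>2 * Re (z * cnj w)"
  by (simp add: qinner cq_nth qmult_nth qvec_nth power2_norm_eq_inner inner_vec3)
    (simp add: algebra_simps)

text \<open>Mixing the Gaussian coefficients gives those of \<open>A (Pv 1 (cq 1))\<close>. Parity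
  separates the two kernels: \<open>Pv\<close> is orthogonal to all \<open>vq\<close>,
  \<open>Qv\<close> to all \<open>hq\<close>, so \<open>l\<close> and \<open>m\<close> can be fitted
  independently.\<close>

lemma intertwiner_Poisson:
  assumes T: "intertwiner T" and A: "intertwiner A" and adj: "\<And>u v. T u \<bullet> v = u \<bullet> A v"
  obtains l m where
    "\<And>s z. s > 0 \<Longrightarrow> z \<in> {1, \<i>} \<Longrightarrow> (A (Pv 1 (cq 1)) - Pv 1 (cq l) - Qv 1 (cq m)) \<bullet> hq s (cq z) = 0"
    "\<And>s z. s > 0 \<Longrightarrow> z \<in> {1, \<i>} \<Longrightarrow> (A (Pv 1 (cq 1)) - Pv 1 (cq l) - Qv 1 (cq m)) \<bullet> vq s (cq z) = 0"
proof -
  have AP: "A (Pv 1 (cq 1)) \<bullet> w = (LINT u|lborel. (W u * sqrt (pi / u) ^ 3) * (A (hq (1 / u) (cq 1)) \<bullet> w))" for w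
  proof -
    have sw: "A x \<bullet> w = x \<bullet> T w" for x by (metis adj inner_commute)
    show ?thesis unfolding sw by (rule Pv_inner_mixture)
  qed
  have W0: "W u = 0" if "\<not> u > 0" for u using that by (simp add: W_def)
  have "\<exists>c. \<forall>t s. t > 0 \<longrightarrow> s > 0 \<longrightarrow> A (hq t (cq 1)) \<bullet> hq s (cq z) = c * (hq t (cq 1) \<bullet> hq s (cq 1))" for z
    by (rule scalar_coefficient[OF T A adj, of "cq z"]) blast
  then obtain c where c: "\<And>z t s. t > 0 \<Longrightarrow> s > 0 \<Longrightarrow> A (hq t (cq 1)) \<bullet> hq s (cq z) = c z * (hq t (cq 1) \<bullet> hq s (cq 1))"
    by metis
  have "\<exists>c. \<forall>t s. t > 0 \<longrightarrow> s > 0 \<longrightarrow> A (hq t (cq 1)) \<bullet> vq s (cq z) = c / (t + s)\<^sup>2" for z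
    by (rule vector_coefficient[OF T A adj, of "cq z"]) blast
  then obtain d where d: "\<And>z t s. t > 0 \<Longrightarrow> s > 0 \<Longrightarrow> A (hq t (cq 1)) \<bullet> vq s (cq z) = d z / (t + s)\<^sup>2"
    by metis
  obtain K where K: "\<And>s. s > 0 \<Longrightarrow> omega s = K * (Qv 1 (cq 1) \<bullet> vq s (cq 1))" by (rule omega_eq) blast
  have h1: "A (Pv 1 (cq 1)) \<bullet> hq s (cq z) = c z * (Pv 1 (cq 1) \<bullet> hq s (cq 1))" if s: "s > 0" for s z
  proof -
    have "A (Pv 1 (cq 1)) \<bullet> hq s (cq z)
      = (LINT u|lborel. c z * ((W u * sqrt (pi / u) ^ 3) * (hq (1 / u) (cq 1) \<bullet> hq s (cq 1))))"
      unfolding AP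
    proof (intro Bochner_Integration.integral_cong refl)
      fix u
      show "(W u * sqrt (pi / u) ^ 3) * (A (hq (1 / u) (cq 1)) \<bullet> hq s (cq z)) = c z * ((W u * sqrt (pi / u) ^ 3) * (hq (1 / u) (cq 1) \<bullet> hq s (cq 1)))"
        by (cases "u > 0") (simp_all add: c s W0)
    qed
    also have "\<dots> = c z * (Pv 1 (cq 1) \<bullet> hq s (cq 1))" by (simp add: Pv_inner_mixture)
    finally show ?thesis .
  qed
  have v1: "A (Pv 1 (cq 1)) \<bullet> vq s (cq z) = d z * K * (Qv 1 (cq 1) \<bullet> vq s (cq 1))" if s: "s > 0" for s z
  proof -
    have "A (Pv 1 (cq 1)) \<bullet> vq s (cq z) = (LINT u|lborel. d z * ((W u * sqrt (pi / u) ^ 3) * (1 / (1 / u + s)\<^sup>2)))"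
      unfolding AP
    proof (intro Bochner_Integration.integral_cong refl)
      fix u
      show "(W u * sqrt (pi / u) ^ 3) * (A (hq (1 / u) (cq 1)) \<bullet> vq s (cq z)) = d z * ((W u * sqrt (pi / u) ^ 3) * (1 / (1 / u + s)\<^sup>2))"
        by (cases "u > 0") (simp_all add: d s W0)
    qed
    also have "\<dots> = d z * omega s" unfolding omega_def by (rule integral_mult_right_zero)
    finally show ?thesis using K[OF s] by simp
  qed
  show ?thesis
  \<comment> \<open>The inner product is real. Testing with 1 reads off the real part of a
    coefficient and testing with \<open>\<i>\<close> its imaginary part.\<close>
  proof (rule that[of "Complex (c 1) (c \<i>)" "Complex (d 1 * K) (d \<i> * K)"])
    fix s :: real and z :: complex assume s: "s > 0" and z: "z \<in> {1, \<i>}"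
    have P_h: "Pv 1 (cq l) \<bullet> hq s (cq z) = Re (l * cnj z) * (Pv 1 (cq 1) \<bullet> hq s (cq 1))" for l
    proof -
      have "(Pk 1 x *\<^sub>R cq l) \<bullet> (heat s x *\<^sub>R cq z) = Re (l * cnj z) * ((Pk 1 x *\<^sub>R cq 1) \<bullet> (heat s x *\<^sub>R cq 1))" for x
        unfolding inner_scaleR_left inner_scaleR_right inner_cq by simp
      then show ?thesis
        unfolding Pv_def hq_def inner_cls[OF Pv_L2[OF zero_less_one] hq_L2[OF s]] by (simp only: integral_mult_right_zero)
    qed
    have Q_h: "Qv 1 (cq m) \<bullet> hq s (cq z) = 0" for m
      unfolding Qv_def hq_def using s by (simp add: inner_cls inner_cq_qvec)
    have P_v: "Pv 1 (cq l) \<bullet> vq s (cq z) = 0" for l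
      unfolding Pv_def vq_def using s by (simp add: inner_cls inner_cq_qvec)
    have Q_v: "Qv 1 (cq m) \<bullet> vq s (cq z) = Re (m * cnj z) * (Qv 1 (cq 1) \<bullet> vq s (cq 1))" for m
    proof -
      have "(Qk 1 x *\<^sub>R (qvec x \<odot> cq m)) \<bullet> ((heat s x / s) *\<^sub>R (qvec x \<odot> cq z))
          = Re (m * cnj z) * ((Qk 1 x *\<^sub>R (qvec x \<odot> cq 1)) \<bullet> ((heat s x / s) *\<^sub>R (qvec x \<odot> cq 1)))" for x
        unfolding inner_scaleR_left inner_scaleR_right inner_qvec_cq by simp
      then show ?thesis
        unfolding Qv_def vq_def inner_cls[OF Qv_L2[OF zero_less_one] vq_L2[OF s]] by (simp only: integral_mult_right_zero)
    qed
    show "(A (Pv 1 (cq 1)) - Pv 1 (cq (Complex (c 1) (c \<i>))) - Qv 1 (cq (Complex (d 1 * K) (d \<i> * K)))) \<bullet> hq s (cq z) = 0"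
      using z by (auto simp: inner_diff_left h1[OF s] P_h Q_h)
    show "(A (Pv 1 (cq 1)) - Pv 1 (cq (Complex (c 1) (c \<i>))) - Qv 1 (cq (Complex (d 1 * K) (d \<i> * K)))) \<bullet> vq s (cq z) = 0"
      using z by (auto simp: inner_diff_left v1[OF s] P_v Q_v)
  qed
qed

section \<open>Lebesgue points of Poisson averages\<close>

lemma emeasure_cube: "h > 0 \<Longrightarrow> emeasure lborel (cbox x (x + h *\<^sub>R One :: real ^ 3)) = ennreal (h ^ 3)"
proof -
  assume h: "h > 0"
  have "(\<Prod>b\<in>Basis. (x + h *\<^sub>R One - x) \<bullet> b) = (\<Prod>b\<in>(Basis :: (real^3) set). h)"
    by (rule prod.cong) auto
  then show ?thesis
    using h by (subst emeasure_lborel_cbox) (auto simp: inner_add_left)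
qed

lemma set_integrable_norm_diff:
  assumes f: "f \<in> L2"
  shows "set_integrable lborel (cbox a b) (\<lambda>y. norm (f y - q))"
  unfolding set_integrable_def
proof (rule Bochner_Integration.integrable_bound)
  have [measurable]: "f \<in> borel_measurable borel" using f by (rule L2_measurable)
  show "integrable lborel (\<lambda>y. indicat_real (cbox a b) y * (1 + norm q) + (norm (f y))\<^sup>2)"
    using L2_integrable[OF f] by (auto intro!: Bochner_Integration.integrable_add integrable_real_indicator
      integrable_mult_left simp: emeasure_lborel_cbox_eq)
  show "AE y in lborel. norm (indicat_real (cbox a b) y *\<^sub>R norm (f y - q)) \<le> norm (indicat_real (cbox a b) y * (1 + norm q) + (norm (f y))\<^sup>2)"
  proof (rule AE_I2)
    fix y
    have "norm (f y - q) \<le> norm (f y) + norm q" by (rule norm_triangle_ineq4)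
    also have "norm (f y) \<le> 1 + (norm (f y))\<^sup>2"
      using zero_le_power2[of "norm (f y) - 1/2"] by (simp add: power2_eq_square algebra_simps)
    finally have "norm (f y - q) \<le> (1 + norm q) + (norm (f y))\<^sup>2" by simp
    then show "norm (indicat_real (cbox a b) y *\<^sub>R norm (f y - q)) \<le> norm (indicat_real (cbox a b) y * (1 + norm q) + (norm (f y))\<^sup>2)"
      by (auto simp: indicator_def)
  qed
  show "(\<lambda>x. indicat_real (cbox a b) x *\<^sub>R norm (f x - q)) \<in> borel_measurable lborel" by measurable
qed

text \<open>Differentiation of the integral is applied to \<open>norm (f y - q)\<close> for
  \<open>q\<close> in a countable dense set. Outside a single null set all these statements hold,
  and a \<open>q\<close> close to \<open>f x\<close> gives the Lebesgue point property.\<close>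

lemma AE_corner_mean:
  fixes f :: "real ^ 3 \<Rightarrow> biquat"
  assumes f: "f \<in> L2"
  shows "AE x in lborel. \<forall>e>0. \<exists>d>0. \<forall>h. 0 < h \<and> h < d \<longrightarrow>
    (\<integral>\<^sup>+y. ennreal (indicator (cbox x (x + h *\<^sub>R One)) y * norm (f y - f x)) \<partial>lborel) \<le> ennreal (h ^ 3 * e)"
proof -
  have [measurable]: "f \<in> borel_measurable borel" using f by (rule L2_measurable)
  define P where "P q x \<longleftrightarrow> (\<forall>e>0. \<exists>d>0. \<forall>h. 0 < h \<and> h < d \<longrightarrow>
     norm (integral (cbox x (x + h *\<^sub>R One)) (\<lambda>y. norm (f y - q)) /\<^sub>R h ^ DIM(real ^ 3) - norm (f x - q)) < e)"
    for q and x :: "real ^ 3"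
  have "\<exists>N. negligible N \<and> (\<forall>x. x \<notin> N \<longrightarrow> P q x)" for q
  proof -
    have "(\<lambda>y. norm (f y - q)) integrable_on cbox a b" for a b
      using set_borel_integral_eq_integral(1)[OF set_integrable_norm_diff[OF f]] .
    then obtain N where "negligible N" "\<And>x e. \<lbrakk>x \<notin> N; 0 < e\<rbrakk> \<Longrightarrow> \<exists>d>0. \<forall>h. 0 < h \<and> h < d \<longrightarrow>
        norm (integral (cbox x (x + h *\<^sub>R One)) (\<lambda>y. norm (f y - q)) /\<^sub>R h ^ DIM(real ^ 3) - norm (f x - q)) < e"
      using integrable_ccontinuous_explicit[of "\<lambda>y. norm (f y - q)"] by metis
    then show ?thesis unfolding P_def by blast
  qed
  then have aeP: "AE x in lebesgue. P q x" for q
    by (metis (mono_tags, lifting) AE_not_in eventually_mono negligible_iff_null_sets)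
  obtain D :: "biquat set" where D: "countable D" "\<And>X. open X \<Longrightarrow> X \<noteq> {} \<Longrightarrow> \<exists>d\<in>D. d \<in> X"
    using countable_dense_exists by metis
  have "AE x in lebesgue. \<forall>q\<in>D. P q x" using D(1) aeP by (subst AE_ball_countable) auto
  then have "AE x in lborel. \<forall>q\<in>D. P q x" by (simp add: AE_completion_iff)
  then show ?thesis
  proof eventually_elim
    fix x assume Px: "\<forall>q\<in>D. P q x"
    show "\<forall>e>0. \<exists>d>0. \<forall>h. 0 < h \<and> h < d \<longrightarrow>
      (\<integral>\<^sup>+y. ennreal (indicator (cbox x (x + h *\<^sub>R One)) y * norm (f y - f x)) \<partial>lborel) \<le> ennreal (h ^ 3 * e)"
    proof (intro allI impI)
      fix e :: real assume e: "e > 0"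
      obtain q where q: "q \<in> D" "dist (f x) q < e / 3"
        using D(2)[of "ball (f x) (e / 3)"] e by auto
      have "P q x" using Px q(1) by blast
      then have "\<exists>d>0. \<forall>h. 0 < h \<and> h < d \<longrightarrow>
        norm (integral (cbox x (x + h *\<^sub>R One)) (\<lambda>y. norm (f y - q)) /\<^sub>R h ^ DIM(real ^ 3) - norm (f x - q)) < e / 3"
        unfolding P_def using e by (elim allE[of _ "e / 3"] impE) simp_all
      then obtain d where d: "d > 0" "\<And>h. 0 < h \<Longrightarrow> h < d \<Longrightarrow>
        norm (integral (cbox x (x + h *\<^sub>R One)) (\<lambda>y. norm (f y - q)) /\<^sub>R h ^ 3 - norm (f x - q)) < e / 3"
        unfolding card_Basis_vec3 by blast
      show "\<exists>d>0. \<forall>h. 0 < h \<and> h < d \<longrightarrow>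
        (\<integral>\<^sup>+y. ennreal (indicator (cbox x (x + h *\<^sub>R One)) y * norm (f y - f x)) \<partial>lborel) \<le> ennreal (h ^ 3 * e)"
      proof (intro exI[of _ d] conjI d(1) allI impI)
        fix h assume h: "0 < h \<and> h < d"
        let ?B = "cbox x (x + h *\<^sub>R One)"
        define I where "I = integral ?B (\<lambda>y. norm (f y - q))"
        have I0: "I \<ge> 0" unfolding I_def by (intro Henstock_Kurzweil_Integration.integral_nonneg
            set_borel_integral_eq_integral(1) set_integrable_norm_diff f) auto
        have "\<bar>I /\<^sub>R h ^ 3 - norm (f x - q)\<bar> < e / 3" using d(2) h by (simp only: I_def real_norm_def)
        then have "I /\<^sub>R h ^ 3 < 2 * e / 3" using q(2) unfolding dist_norm by linarith
        then have I: "I \<le> h ^ 3 * (2 * e / 3)" using h by (simp add: divide_simps mult_ac)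
        have nI: "(\<integral>\<^sup>+y. ennreal (indicator ?B y * norm (f y - q)) \<partial>lborel) = ennreal I"
        proof -
          have "(\<integral>\<^sup>+y. ennreal (indicator ?B y * norm (f y - q)) \<partial>lborel) = ennreal (LINT y:?B|lborel. norm (f y - q))"
            using set_integrable_norm_diff[OF f, of x "x + h *\<^sub>R One" q] unfolding set_integrable_def set_lebesgue_integral_def
            by (subst nn_integral_eq_integral) auto
          also have "(LINT y:?B|lborel. norm (f y - q)) = I"
            unfolding I_def by (rule set_borel_integral_eq_integral(2)[OF set_integrable_norm_diff[OF f]])
          finally show ?thesis .
        qed
        have "(\<integral>\<^sup>+y. ennreal (indicator ?B y * norm (f y - f x)) \<partial>lborel)
            \<le> (\<integral>\<^sup>+y. ennreal (indicator ?B y * norm (f y - q)) + ennreal (e / 3) * indicator ?B y \<partial>lborel)"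
        proof (rule nn_integral_mono)
          fix y
          have "norm (f y - f x) \<le> norm (f y - q) + norm (q - f x)" using norm_triangle_ineq[of "f y - q" "q - f x"] by simp
          then have "norm (f y - f x) \<le> norm (f y - q) + e / 3" using q(2) by (simp add: dist_norm norm_minus_commute)
          then show "ennreal (indicator ?B y * norm (f y - f x)) \<le> ennreal (indicator ?B y * norm (f y - q)) + ennreal (e / 3) * indicator ?B y"
            using e by (auto simp: indicator_def ennreal_plus[symmetric] intro: ennreal_leI simp del: ennreal_plus)
        qed
        also have "\<dots> = ennreal I + ennreal (e / 3) * ennreal (h ^ 3)"
          using h by (subst nn_integral_add) (auto simp: nI nn_integral_cmult_indicator emeasure_cube)
        also have "\<dots> = ennreal (I + e / 3 * h ^ 3)"
          using e h I0 by (subst ennreal_mult[symmetric]) (auto simp flip: ennreal_plus)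
        also have "\<dots> \<le> ennreal (h ^ 3 * e)" using I by (intro ennreal_leI) (simp add: field_simps)
        finally show "(\<integral>\<^sup>+y. ennreal (indicator ?B y * norm (f y - f x)) \<partial>lborel) \<le> ennreal (h ^ 3 * e)" .
      qed
    qed
  qed
qed

text \<open>The weight on the right is \<open>16 * (1/2) ^ k\<close> divided by the volume of the
  cube of side \<open>2 ^ k * t\<close>. The Poisson kernel is thus dominated by a convergent series
  of cube averages.\<close>

lemma Pk_dyadic:
  assumes t: "t > 0" and z: "\<And>i. 0 \<le> z $ i"
  shows "\<exists>k::nat. Pk t z \<le> 16 * (1/2) ^ k / (2 ^ k * t) ^ 3 \<and> z \<in> cbox 0 ((2 ^ k * t) *\<^sub>R One)"
proof -
  obtain n :: nat where "norm z / t < real n" using reals_Archimedean2 by blast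
  also have "real n \<le> 2 ^ n" using less_exp[of n] by (metis less_imp_le numeral_power_eq_of_nat_cancel_iff of_nat_le_iff)
  finally have ex: "norm z \<le> 2 ^ n * t" using t by (simp add: field_simps)
  \<comment> \<open>By minimality \<open>norm z\<close> exceeds half of \<open>2 ^ k * t\<close> for
    \<open>k > 0\<close>. The fourth power in the decay of the kernel turns this half into the
    constant 16.\<close>
  define k where "k = (LEAST n. norm z \<le> 2 ^ n * t)"
  have k: "norm z \<le> 2 ^ k * t" unfolding k_def by (rule LeastI[of "\<lambda>n. norm z \<le> 2 ^ n * t", OF ex])
  have mem: "z \<in> cbox 0 ((2 ^ k * t) *\<^sub>R One)"
  proof -
    have "z $ i \<le> 2 ^ k * t" for i using component_le_norm_cart[of z i] k by linarith
    moreover have "(One :: real ^ 3) $ i = 1" for i by (simp add: cart_eq_inner_axis axis_in_Basis_iff)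
    ultimately show ?thesis using z by (simp add: mem_box_cart)
  qed
  have pi1: "pi\<^sup>2 \<ge> 1" using pi_ge_two power_mono[of 1 pi 2] by simp
  have "Pk t z \<le> 16 * (1/2) ^ k / (2 ^ k * t) ^ 3"
  proof (cases k)
    case 0
    have "Pk t z \<le> Pk t 0" by (rule Pk_le[OF t])
    also have "\<dots> = 1 / (pi\<^sup>2 * t ^ 3)" using t by (simp add: Pk_def power2_eq_square power3_eq_cube)
    also have "\<dots> \<le> 16 / t ^ 3" using t pi1 by (intro frac_le) (auto intro: order_trans[OF _ mult_right_mono[OF pi1]])
    finally show ?thesis using 0 by simp
  next
    case (Suc m)
    have "\<not> norm z \<le> 2 ^ m * t" using not_less_Least[of m "\<lambda>n. norm z \<le> 2 ^ n * t"] Suc by (simp add: k_def[symmetric])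
    then have "(2 ^ m * t)\<^sup>2 \<le> (norm z)\<^sup>2" using t by (intro power_mono) auto
    then have "(2 ^ m * t)\<^sup>2 \<le> t\<^sup>2 + (norm z)\<^sup>2" by (meson add_increasing zero_le_power2)
    then have "((2 ^ m * t)\<^sup>2)\<^sup>2 \<le> (t\<^sup>2 + (norm z)\<^sup>2)\<^sup>2" by (intro power_mono) auto
    also have "\<dots> \<le> pi\<^sup>2 * (t\<^sup>2 + (norm z)\<^sup>2)\<^sup>2" using mult_right_mono[OF pi1, of "(t\<^sup>2 + (norm z)\<^sup>2)\<^sup>2"] by simp
    finally have "Pk t z \<le> t / ((2 ^ m * t)\<^sup>2)\<^sup>2" unfolding Pk_def using t by (intro divide_left_mono) (auto simp: add_pos_nonneg)
    also have "\<dots> = 16 * (1/2) ^ k / (2 ^ k * t) ^ 3"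
      using t by (simp add: Suc power_mult_distrib power_divide power2_eq_square power3_eq_cube)
    finally show ?thesis .
  qed
  with mem show ?thesis by blast
qed

text \<open>The Lebesgue differentiation theorem of the library averages over cubes with corner \<open>x\<close>, which
  see one octant only; the other octants are images of this one under rotations and \<open>- id\<close>.\<close>

definition octant :: "(real ^ 3) set" where "octant = {z. \<forall>i. 0 \<le> z $ i}"

text \<open>Formulated for a set of displacements, so that the property can be moved by isometries
  and added up until the sets cover the space. Nonnegative integrals keep questions of integrability
  out of these steps.\<close>

definition good_cone :: "(real ^ 3) set \<Rightarrow> bool" where
  "good_cone C \<longleftrightarrow> C \<in> sets borel \<and> (\<forall>f\<in>L2. AE x in lborel.
     ((\<lambda>t. \<integral>\<^sup>+z. ennreal (indicator C z * (Pk t z * norm (f (x + z) - f x))) \<partial>lborel) \<longlongrightarrow> 0) (at_right 0))"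

lemma octant_borel [measurable]: "octant \<in> sets borel"
proof -
  have "closed octant" unfolding octant_def by (intro closed_Collect_all closed_Collect_le continuous_intros)
  then show ?thesis by simp
qed

lemma L2_nn_finite: "f \<in> L2 \<Longrightarrow> (\<integral>\<^sup>+y. ennreal ((norm (f y))\<^sup>2) \<partial>lborel) = ennreal (LINT y|lborel. (norm (f y))\<^sup>2)"
  by (rule nn_integral_eq_integral) (auto simp: L2_integrable)

lemma nn_integral_transl:
  assumes [measurable]: "F \<in> borel_measurable borel"
  shows "(\<integral>\<^sup>+z. F (b + z) \<partial>lborel) = (\<integral>\<^sup>+z. F z \<partial>(lborel :: (real^3) measure))"
proof -
  have "lborel = distr lborel borel (\<lambda>z :: real^3. b + z)" using lborel_affine[of 1 b] by (simp add: density_1)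
  then have "(\<integral>\<^sup>+z. F z \<partial>(lborel :: (real^3) measure)) = (\<integral>\<^sup>+z. F z \<partial>distr lborel borel (\<lambda>z. b + z))" by simp
  also have "\<dots> = (\<integral>\<^sup>+z. F (b + z) \<partial>lborel)" by (rule nn_integral_distr) auto
  finally show ?thesis ..
qed

text \<open>The dyadic series of cube averages is estimated by two regimes: small cubes by the
  Lebesgue point property, large ones by the norm of \<open>f\<close>. A bound
  \<open>e + M * sqrt h\<close> covers both; the square root grows slowly enough for the series to
  converge and still contributes a term tending to 0 with \<open>t\<close>.\<close>

lemma good_octant: "good_cone octant"
  unfolding good_cone_def
proof (intro conjI ballI octant_borel)
  fix f :: "real ^ 3 \<Rightarrow> biquat" assume f: "f \<in> L2"
  have [measurable]: "f \<in> borel_measurable borel" using f by (rule L2_measurable)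
  show "AE x in lborel. ((\<lambda>t. \<integral>\<^sup>+z. ennreal (indicator octant z * (Pk t z * norm (f (x + z) - f x))) \<partial>lborel) \<longlongrightarrow> 0) (at_right 0)"
    using AE_corner_mean[OF f]
  proof eventually_elim
    fix x
    assume mean: "\<forall>e>0. \<exists>d>0. \<forall>h. 0 < h \<and> h < d \<longrightarrow>
      (\<integral>\<^sup>+y. ennreal (indicator (cbox x (x + h *\<^sub>R One)) y * norm (f y - f x)) \<partial>lborel) \<le> ennreal (h ^ 3 * e)"
    define G where "G h = (\<integral>\<^sup>+z. ennreal (indicator (cbox 0 (h *\<^sub>R One)) z * norm (f (x + z) - f x)) \<partial>lborel)" for h
    have Gx: "G h = (\<integral>\<^sup>+y. ennreal (indicator (cbox x (x + h *\<^sub>R One)) y * norm (f y - f x)) \<partial>lborel)" for h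
    proof -
      have "indicat_real (cbox 0 (h *\<^sub>R One)) z = indicator (cbox x (x + h *\<^sub>R One)) (x + z)" for z
        by (auto simp: indicator_def mem_box inner_add_left)
      then show ?thesis unfolding G_def by (subst nn_integral_transl[symmetric, of _ x]) auto
    qed
    define N where "N = (LINT y|lborel. (norm (f y))\<^sup>2)"
    have N0: "N \<ge> 0" by (simp add: N_def)
    have crude: "G h \<le> ennreal (h ^ 3 * (1 + norm (f x)) + N)" if h: "h > 0" for h
    proof -
      have "G h \<le> (\<integral>\<^sup>+y. ennreal (1 + norm (f x)) * indicator (cbox x (x + h *\<^sub>R One)) y + ennreal ((norm (f y))\<^sup>2) \<partial>lborel)"
        unfolding Gx
      proof (rule nn_integral_mono)
        fix y
        have "norm (f y - f x) \<le> norm (f y) + norm (f x)" by (rule norm_triangle_ineq4)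
        also have "norm (f y) \<le> 1 + (norm (f y))\<^sup>2"
          using zero_le_power2[of "norm (f y) - 1/2"] by (simp add: power2_eq_square algebra_simps)
        finally have "norm (f y - f x) \<le> (1 + norm (f x)) + (norm (f y))\<^sup>2" by simp
        then show "ennreal (indicator (cbox x (x + h *\<^sub>R One)) y * norm (f y - f x))
          \<le> ennreal (1 + norm (f x)) * indicator (cbox x (x + h *\<^sub>R One)) y + ennreal ((norm (f y))\<^sup>2)"
          by (auto simp: indicator_def ennreal_plus[symmetric] intro: ennreal_leI simp del: ennreal_plus)
      qed
      also have "\<dots> = ennreal (1 + norm (f x)) * ennreal (h ^ 3) + ennreal N"
        using h by (subst nn_integral_add) (auto simp: nn_integral_cmult_indicator emeasure_cube L2_nn_finite f N_def)
      also have "\<dots> = ennreal (h ^ 3 * (1 + norm (f x)) + N)"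
        using h N0 by (simp add: ennreal_mult[symmetric] mult.commute flip: ennreal_plus)
      finally show ?thesis .
    qed
    have bound: "\<exists>M\<ge>0. \<forall>t>0. (\<integral>\<^sup>+z. ennreal (indicator octant z * (Pk t z * norm (f (x + z) - f x))) \<partial>lborel)
        \<le> ennreal (32 * e + M * sqrt t)" if e: "e > 0" for e
    proof -
      obtain d where d: "d > 0" "\<And>h. 0 < h \<Longrightarrow> h < d \<Longrightarrow> G h \<le> ennreal (h ^ 3 * e)"
        using mean[rule_format, OF e] unfolding Gx by blast
      \<comment> \<open>At \<open>h = d\<close> the term \<open>M * sqrt h\<close> equals the crude
        bound divided by the volume, so from there on it dominates.\<close>
      define M where "M = (1 + norm (f x) + N / d ^ 3) / sqrt d"
      have M0: "M \<ge> 0" using N0 d by (simp add: M_def)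
      have Gb: "G h \<le> ennreal (h ^ 3 * (e + M * sqrt h))" if h: "h > 0" for h
      proof (cases "h < d")
        case True
        then have "G h \<le> ennreal (h ^ 3 * e)" using d h by simp
        also have "\<dots> \<le> ennreal (h ^ 3 * (e + M * sqrt h))" using h M0 by (intro ennreal_leI mult_left_mono) auto
        finally show ?thesis .
      next
        case False
        have "N \<le> h ^ 3 * (N / d ^ 3)"
        proof -
          have "d ^ 3 \<le> h ^ 3" using False d by (intro power_mono) auto
          then have "N * d ^ 3 \<le> N * h ^ 3" using N0 by (rule mult_left_mono)
          then show ?thesis using d by (simp add: field_simps)
        qed
        then have "h ^ 3 * (1 + norm (f x)) + N \<le> h ^ 3 * (1 + norm (f x) + N / d ^ 3)" by (simp add: algebra_simps)
        also have "\<dots> \<le> h ^ 3 * (e + M * sqrt h)"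
        proof (rule mult_left_mono)
          have "1 + norm (f x) + N / d ^ 3 = M * sqrt d" using d by (simp add: M_def)
          also have "\<dots> \<le> M * sqrt h" using False M0 by (intro mult_left_mono) auto
          finally show "1 + norm (f x) + N / d ^ 3 \<le> e + M * sqrt h" using e by simp
        qed (use h in simp)
        finally show ?thesis using crude[OF h] by (meson ennreal_leI order_trans)
      qed
      have key: "(\<integral>\<^sup>+z. ennreal (indicator octant z * (Pk t z * norm (f (x + z) - f x))) \<partial>lborel)
        \<le> ennreal (32 * e + (16 * M / (1 - sqrt (1/2))) * sqrt t)" if t: "t > 0" for t
      proof -
        let ?w = "\<lambda>k::nat. 16 * (1/2) ^ k / (2 ^ k * t) ^ 3"
        have w0: "?w k \<ge> 0" for k using t by simp
        have "(\<integral>\<^sup>+z. ennreal (indicator octant z * (Pk t z * norm (f (x + z) - f x))) \<partial>lborel)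
          \<le> (\<integral>\<^sup>+z. (\<Sum>k. ennreal (?w k) * ennreal (indicator (cbox 0 ((2 ^ k * t) *\<^sub>R One)) z * norm (f (x + z) - f x))) \<partial>lborel)"
        proof (rule nn_integral_mono)
          fix z
          show "ennreal (indicator octant z * (Pk t z * norm (f (x + z) - f x)))
            \<le> (\<Sum>k. ennreal (?w k) * ennreal (indicator (cbox 0 ((2 ^ k * t) *\<^sub>R One)) z * norm (f (x + z) - f x)))"
          proof (cases "z \<in> octant")
            case True
            then obtain k where k: "Pk t z \<le> ?w k" "z \<in> cbox 0 ((2 ^ k * t) *\<^sub>R One)"
              using Pk_dyadic[OF t, of z] by (auto simp: octant_def)
            have "ennreal (indicator octant z * (Pk t z * norm (f (x + z) - f x)))
              \<le> ennreal (?w k) * ennreal (indicator (cbox 0 ((2 ^ k * t) *\<^sub>R One)) z * norm (f (x + z) - f x))"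
            proof -
              have "Pk t z * norm (f (x + z) - f x) \<le> ?w k * norm (f (x + z) - f x)"
                using k(1) by (rule mult_right_mono) simp
              then have "ennreal (Pk t z * norm (f (x + z) - f x)) \<le> ennreal (?w k) * ennreal (norm (f (x + z) - f x))"
                using w0[of k] by (subst ennreal_mult[symmetric]) (auto intro: ennreal_leI)
              then show ?thesis using True k(2) by simp
            qed
            also have "\<dots> \<le> (\<Sum>k. ennreal (?w k) * ennreal (indicator (cbox 0 ((2 ^ k * t) *\<^sub>R One)) z * norm (f (x + z) - f x)))"
              using sum_le_suminf[of "\<lambda>k. ennreal (?w k) * ennreal (indicator (cbox 0 ((2 ^ k * t) *\<^sub>R One)) z * norm (f (x + z) - f x))" "{k}"] by simp
            finally show ?thesis .
          qed simp
        qed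
        also have "\<dots> = (\<Sum>k. ennreal (?w k) * G (2 ^ k * t))"
          unfolding G_def by (subst nn_integral_suminf) (auto simp: nn_integral_cmult)
        also have "\<dots> \<le> (\<Sum>k. ennreal (16 * e * (1/2) ^ k + 16 * M * sqrt t * sqrt (1/2) ^ k))"
        proof (rule suminf_le)
          fix k
          let ?h = "2 ^ k * t"
          have h: "?h > 0" using t by simp
          have "ennreal (?w k) * G ?h \<le> ennreal (?w k) * ennreal (?h ^ 3 * (e + M * sqrt ?h))"
            by (intro mult_left_mono Gb h) simp
          also have "\<dots> = ennreal (?w k * (?h ^ 3 * (e + M * sqrt ?h)))"
            using w0[of k] h e M0 by (subst ennreal_mult[symmetric]) auto
          also have "?w k * (?h ^ 3 * (e + M * sqrt ?h)) = 16 * (1/2) ^ k * (e + M * sqrt ?h)"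
            using h t by simp
          also have "\<dots> = 16 * e * (1/2) ^ k + 16 * M * sqrt t * ((1/2) ^ k * sqrt (2 ^ k))"
            by (simp add: real_sqrt_mult algebra_simps)
          also have "(1/2) ^ k * sqrt (2 ^ k) = sqrt (1/2) ^ k"
          proof -
            have "(1/2) * sqrt 2 = sqrt (1/2)" by (simp add: real_sqrt_divide field_simps)
            then show ?thesis by (metis power_mult_distrib real_sqrt_power)
          qed
          finally show "ennreal (?w k) * G ?h \<le> ennreal (16 * e * (1/2) ^ k + 16 * M * sqrt t * sqrt (1/2) ^ k)" .
        qed auto
        also have "\<dots> = ennreal (\<Sum>k. 16 * e * (1/2) ^ k + 16 * M * sqrt t * sqrt (1/2) ^ k)"
          using e M0 t by (intro suminf_ennreal2 summable_add summable_mult summable_geometric) (auto simp: real_sqrt_divide)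
        also have "(\<Sum>k. 16 * e * (1/2) ^ k + 16 * M * sqrt t * sqrt (1/2) ^ k)
          = 16 * e * (1 / (1 - 1/2)) + 16 * M * sqrt t * (1 / (1 - sqrt (1/2)))"
          by (rule sums_unique[symmetric]) (intro sums_add sums_mult geometric_sums; simp)
        also have "\<dots> = 32 * e + (16 * M / (1 - sqrt (1/2))) * sqrt t" by simp
        finally show ?thesis .
      qed
      have "sqrt (1/2) < 1" by simp
      then have "16 * M / (1 - sqrt (1/2)) \<ge> 0" using M0 by (intro divide_nonneg_pos) auto
      then show ?thesis using key by blast
    qed
    show "((\<lambda>t. \<integral>\<^sup>+z. ennreal (indicator octant z * (Pk t z * norm (f (x + z) - f x))) \<partial>lborel) \<longlongrightarrow> 0) (at_right 0)"
    proof (rule tendsto_zero_ennreal)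
      fix r :: real assume r: "0 < r"
      then obtain M where M: "\<And>t. t > 0 \<Longrightarrow> (\<integral>\<^sup>+z. ennreal (indicator octant z * (Pk t z * norm (f (x + z) - f x))) \<partial>lborel)
          \<le> ennreal (32 * (r / 64) + M * sqrt t)" using bound[of "r / 64"] by auto
      have "((\<lambda>t. 32 * (r / 64) + M * sqrt t) \<longlongrightarrow> 32 * (r / 64) + M * sqrt 0) (at_right 0)"
        by (intro tendsto_intros)
      then have "eventually (\<lambda>t. 32 * (r / 64) + M * sqrt t < r) (at_right 0)"
        by (rule order_tendstoD(2)) (use r in simp)
      moreover have "eventually (\<lambda>t::real. t > 0) (at_right 0)" by (rule eventually_at_right_less)
      ultimately show "eventually (\<lambda>t. (\<integral>\<^sup>+z. ennreal (indicator octant z * (Pk t z * norm (f (x + z) - f x))) \<partial>lborel) < ennreal r) (at_right 0)"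
        by eventually_elim (use M r in \<open>auto intro: le_less_trans ennreal_lessI\<close>)
    qed
  qed
qed


section \<open>From one octant to the whole space\<close>

lemma good_cone_Un:
  assumes C: "good_cone C" and D: "good_cone D"
  shows "good_cone (C \<union> D)"
  unfolding good_cone_def
proof (intro conjI ballI)
  show "C \<union> D \<in> sets borel" using C D by (auto simp: good_cone_def)
  have [measurable]: "C \<in> sets borel" "D \<in> sets borel" using C D by (auto simp: good_cone_def)
  fix f :: "real ^ 3 \<Rightarrow> biquat" assume f: "f \<in> L2"
  have [measurable]: "f \<in> borel_measurable borel" using f by (rule L2_measurable)
  let ?I = "\<lambda>E x t. \<integral>\<^sup>+z. ennreal (indicator E z * (Pk t z * norm (f (x + z) - f x))) \<partial>lborel"
  have "AE x in lborel. (?I C x \<longlongrightarrow> 0) (at_right 0)" "AE x in lborel. (?I D x \<longlongrightarrow> 0) (at_right 0)"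
    using C D f by (auto simp: good_cone_def)
  then show "AE x in lborel. (?I (C \<union> D) x \<longlongrightarrow> 0) (at_right 0)"
  proof eventually_elim
    fix x assume lim: "(?I C x \<longlongrightarrow> 0) (at_right 0)" "(?I D x \<longlongrightarrow> 0) (at_right 0)"
    have sum: "((\<lambda>t. ?I C x t + ?I D x t) \<longlongrightarrow> 0) (at_right 0)"
      using tendsto_add[OF lim] by simp
    have le: "eventually (\<lambda>t. ?I (C \<union> D) x t \<le> ?I C x t + ?I D x t) (at_right 0)"
      using eventually_at_right_less[of "0::real"]
    proof eventually_elim
      case (elim t)
      have "?I (C \<union> D) x t \<le> (\<integral>\<^sup>+z. ennreal (indicator C z * (Pk t z * norm (f (x + z) - f x)))
          + ennreal (indicator D z * (Pk t z * norm (f (x + z) - f x))) \<partial>lborel)"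
        using elim by (intro nn_integral_mono) (auto simp: indicator_def)
      also have "\<dots> = ?I C x t + ?I D x t" by (intro nn_integral_add) auto
      finally show ?case .
    qed
    show "(?I (C \<union> D) x \<longlongrightarrow> 0) (at_right 0)"
      by (rule tendsto_sandwich[OF _ le tendsto_const sum]) simp
  qed
qed

text \<open>The property of \<open>C\<close> is used for the function composed with
  \<open>\<rho>'\<close> and at the point \<open>\<rho> x\<close>; the change of variables leaves
  the radial kernel unchanged.\<close>

lemma good_cone_isometry:
  assumes C: "good_cone C"
    and [measurable]: "\<rho> \<in> borel_measurable (borel :: (real ^ 3) measure)" "\<rho>' \<in> borel_measurable borel"
    and dist: "distr lborel borel \<rho> = lborel" "distr lborel borel \<rho>' = lborel"
    and inv: "\<And>x. \<rho>' (\<rho> x) = x" and add: "\<And>x y. \<rho> x + \<rho> y = \<rho> (x + y)" and norm: "\<And>x. norm (\<rho> x) = norm x"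
  shows "good_cone (\<rho> -` C)"
  unfolding good_cone_def
proof (intro conjI ballI)
  have [measurable]: "C \<in> sets borel" using C by (auto simp: good_cone_def)
  show "\<rho> -` C \<in> sets borel" using measurable_sets[of \<rho> borel borel C] by simp
  fix f :: "real ^ 3 \<Rightarrow> biquat" assume f: "f \<in> L2"
  have [measurable]: "f \<in> borel_measurable borel" using f by (rule L2_measurable)
  have h: "(\<lambda>x. f (\<rho>' x)) \<in> L2"
  proof -
    have "integrable (distr lborel borel \<rho>') (\<lambda>x. (norm (f x))\<^sup>2)" using L2_integrable[OF f] by (simp add: dist)
    then show ?thesis by (simp add: L2_def integrable_distr_eq)
  qed
  let ?I = "\<lambda>x t. \<integral>\<^sup>+z. ennreal (indicator C z * (Pk t z * norm (f (\<rho>' (x + z)) - f (\<rho>' x)))) \<partial>lborel"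
  have "AE x in lborel. (?I x \<longlongrightarrow> 0) (at_right 0)" using C h by (auto simp: good_cone_def)
  then have "AE x in distr lborel borel \<rho>. (?I x \<longlongrightarrow> 0) (at_right 0)" unfolding dist(1) .
  then have "AE x in lborel. (?I (\<rho> x) \<longlongrightarrow> 0) (at_right 0)" by (rule AE_distrD[rotated]) simp
  moreover have "?I (\<rho> x) t = (\<integral>\<^sup>+z. ennreal (indicator (\<rho> -` C) z * (Pk t z * norm (f (x + z) - f x))) \<partial>lborel)" for x t
  proof -
    have "?I (\<rho> x) t = (\<integral>\<^sup>+z. ennreal (indicator C z * (Pk t z * norm (f (\<rho>' (\<rho> x + z)) - f (\<rho>' (\<rho> x))))) \<partial>distr lborel borel \<rho>)"
      by (simp add: dist)
    also have "\<dots> = (\<integral>\<^sup>+z. ennreal (indicator C (\<rho> z) * (Pk t (\<rho> z) * norm (f (\<rho>' (\<rho> x + \<rho> z)) - f (\<rho>' (\<rho> x))))) \<partial>lborel)"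
      by (subst nn_integral_distr) auto
    also have "\<dots> = (\<integral>\<^sup>+z. ennreal (indicator (\<rho> -` C) z * (Pk t z * norm (f (x + z) - f x))) \<partial>lborel)"
      by (intro nn_integral_cong) (simp add: add inv Pk_def norm indicator_def)
    finally show ?thesis .
  qed
  ultimately show "AE x in lborel. ((\<lambda>t. \<integral>\<^sup>+z. ennreal (indicator (\<rho> -` C) z * (Pk t z * norm (f (x + z) - f x))) \<partial>lborel) \<longlongrightarrow> 0) (at_right 0)"
    by simp
qed

lemma good_cone_spin:
  assumes "good_cone C" "s \<in> Spin3"
  shows "good_cone (spin_rot s -` C)"
  by (rule good_cone_isometry[OF assms(1), of _ "spin_rot (qconj s)"])
    (simp_all add: distr_lborel_spin_rot assms qconj_Spin3 spin_rot_inverse spin_rot_add norm_spin_rot)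

lemma good_cone_uminus:
  assumes "good_cone C"
  shows "good_cone (uminus -` C)"
proof (rule good_cone_isometry[OF assms, of _ uminus])
  show "distr lborel borel uminus = (lborel :: (real ^ 3) measure)"
    "distr lborel borel uminus = (lborel :: (real ^ 3) measure)"
    using lborel_affine[of "-1" "0 :: real ^ 3"] by (simp_all add: density_1)
qed auto

lemma axis_Spin3: "axis 1 1 \<in> Spin3" "axis 2 1 \<in> Spin3"
  by (auto simp: Spin3_def axis_def norm_eq_sqrt_inner qinner)

lemma spin_rot_axis:
  "spin_rot (axis 1 1) z $ 1 = z $ 1" "spin_rot (axis 1 1) z $ 2 = - z $ 2" "spin_rot (axis 1 1) z $ 3 = - z $ 3"
  "spin_rot (axis 2 1) z $ 1 = - z $ 1" "spin_rot (axis 2 1) z $ 2 = z $ 2" "spin_rot (axis 2 1) z $ 3 = - z $ 3"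
  by (simp_all add: spin_rot_def vec_of_q_def qmult_nth qconj_nth qvec_nth axis_def)

text \<open>The half turns about the first two axes reverse two coordinates each and produce the
  four octants with an even number of negative signs. The map \<open>- id\<close> supplies the other
  four.\<close>

lemma good_UNIV: "good_cone UNIV"
proof -
  define C1 where "C1 = octant \<union> spin_rot (axis 1 1) -` octant"
  define C2 where "C2 = C1 \<union> spin_rot (axis 2 1) -` C1"
  have "good_cone (C2 \<union> uminus -` C2)"
    unfolding C2_def C1_def
    by (intro good_cone_Un good_cone_spin good_cone_uminus good_octant axis_Spin3)
  moreover have "C2 \<union> uminus -` C2 = UNIV"
  proof -
    have "z \<in> C2 \<union> uminus -` C2" for z
      unfolding C2_def C1_def octant_def Un_iff vimage_eq mem_Collect_eq forall_3 spin_rot_axis vector_uminus_component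
      by (cases "0 \<le> z $ 1"; cases "0 \<le> z $ 2"; cases "0 \<le> z $ 3") simp_all
    then show ?thesis by blast
  qed
  ultimately show ?thesis by simp
qed

theorem Poisson_Lebesgue_points:
  assumes f: "f \<in> L2"
  shows "AE x in lborel. ((\<lambda>t. LINT z|lborel. Pk t z * norm (f (x + z) - f x)) \<longlongrightarrow> 0) (at_right 0)"
proof -
  have [measurable]: "f \<in> borel_measurable borel" using f by (rule L2_measurable)
  let ?I = "\<lambda>x t. \<integral>\<^sup>+z. ennreal (Pk t z * norm (f (x + z) - f x)) \<partial>lborel"
  have "AE x in lborel. (?I x \<longlongrightarrow> 0) (at_right 0)"
    using good_UNIV f by (auto simp: good_cone_def)
  then show ?thesis
  proof eventually_elim
    fix x assume "(?I x \<longlongrightarrow> 0) (at_right 0)"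
    then have "((\<lambda>t. enn2real (?I x t)) \<longlongrightarrow> enn2real 0) (at_right 0)"
      by (intro tendsto_enn2real) (auto simp: ennreal_0[symmetric] simp del: ennreal_0)
    moreover have "eventually (\<lambda>t. enn2real (?I x t) = (LINT z|lborel. Pk t z * norm (f (x + z) - f x))) (at_right 0)"
      using eventually_at_right_less[of "0::real"]
      by eventually_elim (intro integral_eq_nn_integral[symmetric]; simp)
    ultimately show "((\<lambda>t. LINT z|lborel. Pk t z * norm (f (x + z) - f x)) \<longlongrightarrow> 0) (at_right 0)"
      by (simp add: tendsto_cong)
  qed
qed

lemma integrable_Pk_diff:
  assumes f: "f \<in> L2" and t: "t > 0"
  shows "integrable lborel (\<lambda>z. Pk t z * norm (f (x + z) - f x))"
    and "integrable lborel (\<lambda>z. Pk t z *\<^sub>R f (x + z))"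
proof -
  have [measurable]: "f \<in> borel_measurable borel" using f by (rule L2_measurable)
  have g: "(\<lambda>z. f (x + z)) \<in> L2" using L2_transl[OF f, of "- x"] by (simp add: add.commute)
  have n: "integrable lborel (\<lambda>z. Pk t z * norm (f (x + z)))"
  proof (rule Bochner_Integration.integrable_bound)
    show "integrable lborel (\<lambda>z. (Pk t z)\<^sup>2 + (norm (f (x + z)))\<^sup>2)"
      using Pk_square_integrable[OF t] L2_integrable[OF g] by simp
    show "AE z in lborel. norm (Pk t z * norm (f (x + z))) \<le> norm ((Pk t z)\<^sup>2 + (norm (f (x + z)))\<^sup>2)"
      using abs_inner_le[of "Pk t z" "norm (f (x + z))" for z] by simp
  qed simp
  show "integrable lborel (\<lambda>z. Pk t z *\<^sub>R f (x + z))"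
    by (rule Bochner_Integration.integrable_bound[OF n]) (use t in auto)
  show "integrable lborel (\<lambda>z. Pk t z * norm (f (x + z) - f x))"
  proof (rule Bochner_Integration.integrable_bound)
    show "integrable lborel (\<lambda>z. Pk t z * norm (f (x + z)) + Pk t z * norm (f x))"
      using n integrable_Pk[OF t] by simp
    show "AE z in lborel. norm (Pk t z * norm (f (x + z) - f x)) \<le> norm (Pk t z * norm (f (x + z)) + Pk t z * norm (f x))"
      using t by (intro AE_I2) (auto simp: distrib_left[symmetric] intro!: mult_left_mono norm_triangle_ineq4)
  qed simp
qed

lemma dominated_kernel_tendsto:
  fixes I :: "real \<Rightarrow> 'a::real_normed_vector"
  assumes lim: "((\<lambda>t. LINT z|lborel. Pk t z * norm (f (x + z) - f x)) \<longlongrightarrow> 0) (at_right 0)"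
    and k: "\<And>t. t > 0 \<Longrightarrow> norm (I t) \<le> c * (LINT z|lborel. Pk t z * norm (f (x + z) - f x))"
  shows "(I \<longlongrightarrow> 0) (at_right 0)"
proof (rule tendsto_norm_zero_cancel, rule tendsto_sandwich[OF _ _ tendsto_const])
  show "eventually (\<lambda>t. norm (I t) \<le> c * (LINT z|lborel. Pk t z * norm (f (x + z) - f x))) (at_right 0)"
    using eventually_at_right_less[of "0::real"] by eventually_elim (rule k)
  show "((\<lambda>t. c * (LINT z|lborel. Pk t z * norm (f (x + z) - f x))) \<longlongrightarrow> 0) (at_right 0)"
    using tendsto_mult[OF tendsto_const[of c] lim] by simp
qed simp

section \<open>Rotation invariant vectors\<close>

text \<open>In the variable \<open>y = exp (- |x|\<^sup>2)\<close> the Gaussians are powers of \<open>y\<close>, and polynomials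
  are dense.\<close>

lemma heat_transform_zero:
  fixes f :: "real ^ 3 \<Rightarrow> real"
  assumes cont: "continuous_on UNIV f"
    and rad: "\<And>x y. norm x = norm y \<Longrightarrow> f x = f y"
    and bd: "\<And>x. \<bar>f x\<bar> \<le> C * (1 + norm x)"
    and z: "\<And>s. s > 0 \<Longrightarrow> (LINT x|lborel. f x * heat s x) = 0"
  shows "f x = 0"
proof -
  have [measurable]: "f \<in> borel_measurable borel" using cont by (rule borel_measurable_continuous_onI)
  have C0: "C \<ge> 0" using bd[of 0] by simp
  let ?E = "\<lambda>w x. exp (- w * (norm (x :: real ^ 3))\<^sup>2)"
  have int: "integrable lborel (\<lambda>x. f x * ?E w x)" if w: "w > 0" for w
  proof -
    have "integrable lborel (\<lambda>x. f x * heat (1 / w) x)"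
    proof (rule Bochner_Integration.integrable_bound)
      show "integrable lborel (\<lambda>x. 2 * C * (heat (1 / w) x + (norm x)\<^sup>2 * heat (1 / w) x))"
        using has_integral_heat[of "1 / w"] w by simp
      show "AE x in lborel. norm (f x * heat (1 / w) x) \<le> norm (2 * C * (heat (1 / w) x + (norm x)\<^sup>2 * heat (1 / w) x))"
      proof (rule AE_I2)
        fix x :: "real ^ 3"
        have h: "0 \<le> heat (1 / w) x" using w by simp
        have "1 + norm x \<le> 2 * (1 + (norm x)\<^sup>2)"
          using zero_le_power2[of "norm x - 1/4"] by (simp add: power2_eq_square algebra_simps)
        then have "C * (1 + norm x) \<le> C * (2 * (1 + (norm x)\<^sup>2))" using C0 by (rule mult_left_mono)
        then have "\<bar>f x\<bar> \<le> 2 * C * (1 + (norm x)\<^sup>2)" using bd[of x] by (simp add: algebra_simps)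
        then have "\<bar>f x\<bar> * heat (1 / w) x \<le> (2 * C * (1 + (norm x)\<^sup>2)) * heat (1 / w) x"
          using h by (rule mult_right_mono)
        then show "norm (f x * heat (1 / w) x) \<le> norm (2 * C * (heat (1 / w) x + (norm x)\<^sup>2 * heat (1 / w) x))"
          using h C0 by (simp add: abs_mult algebra_simps)
      qed
    qed simp
    then have "integrable lborel (\<lambda>x. sqrt (pi / w) ^ 3 * (f x * heat (1 / w) x))" by simp
    then show ?thesis unfolding gauss_heat[OF w] by (simp only: mult.left_commute)
  qed
  have zero: "(LINT x|lborel. f x * ?E w x) = 0" if w: "w > 0" for w
  proof -
    have "(LINT x|lborel. f x * ?E w x) = (LINT x|lborel. sqrt (pi / w) ^ 3 * (f x * heat (1 / w) x))"
      unfolding gauss_heat[OF w] by (simp only: mult.left_commute)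
    also have "\<dots> = 0" using z[of "1 / w"] w by simp
    finally show ?thesis .
  qed
  \<comment> \<open>\<open>f\<close> times a Gaussian as a function of \<open>y\<close>. The factor
    \<open>y\<close> outweighs the at most linear growth of \<open>f\<close>, since
    \<open>y * sqrt (- ln y) \<le> sqrt y\<close>, so \<open>g\<close> extends continuously by 0 to
    the point that represents infinity.\<close>
  define g where "g y = (if y \<le> 0 then 0 else y * f (sqrt (- ln y) *\<^sub>R axis 1 1))" for y :: real
  have gb: "\<bar>g y\<bar> \<le> C * (y + sqrt y)" if y: "0 \<le> y" "y \<le> 1" for y
  proof (cases "y = 0")
    case False
    then have y0: "y > 0" using y by simp
    have "ln (1 / y) \<le> 1 / y - 1" using y0 by (intro ln_le_minus_one) simp
    then have "- ln y \<le> 1 / y" using y0 by (simp add: ln_div)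
    then have s: "sqrt (- ln y) \<le> 1 / sqrt y" by (metis real_sqrt_divide real_sqrt_le_mono real_sqrt_one)
    have "y * sqrt (- ln y) \<le> y * (1 / sqrt y)" using s y0 by (intro mult_left_mono) auto
    also have "\<dots> = sqrt y" using y0 by (simp add: real_div_sqrt)
    finally have ys: "y * sqrt (- ln y) \<le> sqrt y" .
    have ln: "0 \<le> - ln y" using y y0 by simp
    have "\<bar>g y\<bar> = y * \<bar>f (sqrt (- ln y) *\<^sub>R axis 1 1)\<bar>" using y0 by (simp add: g_def abs_mult)
    also have "\<dots> \<le> y * (C * (1 + norm (sqrt (- ln y) *\<^sub>R axis 1 1 :: real ^ 3)))"
      using y0 by (intro mult_left_mono bd) auto
    also have "\<dots> = C * (y + y * sqrt (- ln y))" using ln by (simp add: algebra_simps)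
    also have "\<dots> \<le> C * (y + sqrt y)" using ys C0 by (intro mult_left_mono) auto
    finally show ?thesis .
  qed (simp add: g_def)
  have gc: "continuous_on {0..1} g"
    unfolding continuous_on_def
  proof
    fix y :: real assume y: "y \<in> {0..1}"
    show "(g \<longlongrightarrow> g y) (at y within {0..1})"
    proof (cases "y = 0")
      case True
      have "((\<lambda>y. C * (y + sqrt y)) \<longlongrightarrow> C * (0 + sqrt 0)) (at 0 within {0..1})"
        by (intro tendsto_intros)
      then have lim: "((\<lambda>y. C * (y + sqrt y)) \<longlongrightarrow> 0) (at 0 within {0..1})" by simp
      have le: "eventually (\<lambda>y. norm (g y) \<le> C * (y + sqrt y)) (at 0 within {0..1})"
        using gb by (auto simp: eventually_at_filter)
      have "((\<lambda>y. norm (g y)) \<longlongrightarrow> 0) (at 0 within {0..1})"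
        by (rule tendsto_sandwich[OF _ le tendsto_const lim]) simp
      then have "(g \<longlongrightarrow> 0) (at 0 within {0..1})" by (rule tendsto_norm_zero_cancel)
      moreover have "g 0 = 0" by (simp add: g_def)
      ultimately show ?thesis using True by simp
    next
      case False
      then have y0: "y > 0" using y by simp
      have fc: "isCont f x" for x using cont by (simp add: continuous_on_eq_continuous_at)
      have "isCont (\<lambda>y. y * f (sqrt (- ln y) *\<^sub>R axis 1 1)) y"
        by (rule isCont_mult[OF continuous_ident], rule isCont_o2[OF _ fc]) (use y0 in \<open>intro continuous_intros; simp\<close>)
      moreover have "eventually (\<lambda>u. u \<in> {0<..}) (nhds y)" using y0 by (intro eventually_nhds_in_open) auto
      then have "eventually (\<lambda>u. g u = u * f (sqrt (- ln u) *\<^sub>R axis 1 1)) (nhds y)"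
        by eventually_elim (simp add: g_def)
      ultimately have "isCont g y" by (subst isCont_cong) auto
      then show ?thesis by (simp add: isCont_def tendsto_within_subset[of _ _ _ UNIV])
    qed
  qed
  have gE: "g (?E 1 x) = f x * ?E 1 x" for x
    using rad[of "norm x *\<^sub>R axis 1 1" x] by (simp add: g_def mult.commute)
  have E01: "?E 1 x \<in> {0..1}" for x by simp
  have bE: "\<bar>f x * ?E 1 x\<bar> \<le> 2 * C" for x
  proof -
    have "?E 1 x \<le> 1" "sqrt (?E 1 x) \<le> 1" by simp_all
    then have "?E 1 x + sqrt (?E 1 x) \<le> 2" by linarith
    then have "C * (?E 1 x + sqrt (?E 1 x)) \<le> C * 2" using C0 by (rule mult_left_mono)
    then show ?thesis using gb[of "?E 1 x"] by (simp add: gE[simplified])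
  qed
  have i1: "integrable lborel (\<lambda>x. \<bar>f x * ?E 1 x\<bar>)" using int[of 1] by (intro integrable_abs) simp
  have i2: "integrable lborel (\<lambda>x. (f x * ?E 1 x)\<^sup>2)"
  proof (rule Bochner_Integration.integrable_bound)
    show "integrable lborel (\<lambda>x. 2 * C * \<bar>f x * ?E 1 x\<bar>)" using i1 by simp
    show "AE x in lborel. norm ((f x * ?E 1 x)\<^sup>2) \<le> norm (2 * C * \<bar>f x * ?E 1 x\<bar>)"
    proof (rule AE_I2)
      fix x
      have "\<bar>f x * ?E 1 x\<bar> * \<bar>f x * ?E 1 x\<bar> \<le> 2 * C * \<bar>f x * ?E 1 x\<bar>" by (intro mult_right_mono bE) simp
      then show "norm ((f x * ?E 1 x)\<^sup>2) \<le> norm (2 * C * \<bar>f x * ?E 1 x\<bar>)"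
        using C0 by (simp only: real_norm_def abs_power2 abs_mult abs_abs power2_eq_square) (simp add: abs_mult)
    qed
  qed simp
  define J where "J = (LINT x|lborel. \<bar>f x * ?E 1 x\<bar>)"
  \<comment> \<open>A monomial in \<open>y\<close> times the Gaussian is a Gaussian of larger
    exponent, so \<open>f\<close> is orthogonal to it. Subtracting a polynomial close to
    \<open>g\<close> from one factor of the square therefore costs nothing.\<close>
  have small: "(LINT x|lborel. (f x * ?E 1 x)\<^sup>2) \<le> e * J" if e: "e > 0" for e
  proof -
    obtain p where p: "real_polynomial_function p" "\<And>y. y \<in> {0..1} \<Longrightarrow> \<bar>g y - p y\<bar> < e"
      using Stone_Weierstrass_real_polynomial_function[OF compact_Icc gc e] by blast
    obtain a n where an: "p = (\<lambda>y. \<Sum>i\<le>n. a i * y ^ i)" using p(1) unfolding real_polynomial_function_iff_sum by blast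
    have fp: "f x * ?E 1 x * p (?E 1 x) = (\<Sum>i\<le>n. a i * (f x * ?E (real i + 1) x))" for x
      unfolding an by (simp add: sum_distrib_left exp_add[symmetric] exp_of_nat_mult[symmetric] algebra_simps)
    have ip: "integrable lborel (\<lambda>x. f x * ?E 1 x * p (?E 1 x))" unfolding fp using int by (auto simp del: minus_add_distrib)
    have zp: "(LINT x|lborel. f x * ?E 1 x * p (?E 1 x)) = 0" unfolding fp
      by (subst Bochner_Integration.integral_sum) (use int zero in \<open>auto intro!: integrable_mult_right sum.neutral simp del: minus_add_distrib\<close>)
    have "(LINT x|lborel. (f x * ?E 1 x)\<^sup>2) = (LINT x|lborel. (f x * ?E 1 x)\<^sup>2 - f x * ?E 1 x * p (?E 1 x))"
      using i2 ip zp by simp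
    also have "\<dots> \<le> (LINT x|lborel. e * \<bar>f x * ?E 1 x\<bar>)"
    proof (rule integral_mono)
      show "integrable lborel (\<lambda>x. (f x * ?E 1 x)\<^sup>2 - f x * ?E 1 x * p (?E 1 x))" using i2 ip by simp
      show "integrable lborel (\<lambda>x. e * \<bar>f x * ?E 1 x\<bar>)" using i1 by simp
      fix x
      have "(f x * ?E 1 x)\<^sup>2 - f x * ?E 1 x * p (?E 1 x) = (f x * ?E 1 x) * (g (?E 1 x) - p (?E 1 x))"
        unfolding gE by (simp add: power2_eq_square algebra_simps)
      also have "\<dots> \<le> \<bar>f x * ?E 1 x\<bar> * \<bar>g (?E 1 x) - p (?E 1 x)\<bar>" by (metis abs_ge_self abs_mult)
      also have "\<dots> \<le> \<bar>f x * ?E 1 x\<bar> * e" using p(2)[OF E01[of x]] by (intro mult_left_mono) auto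
      finally show "(f x * ?E 1 x)\<^sup>2 - f x * ?E 1 x * p (?E 1 x) \<le> e * \<bar>f x * ?E 1 x\<bar>" by (simp add: mult.commute)
    qed
    also have "\<dots> = e * J" by (simp add: J_def)
    finally show ?thesis .
  qed
  have "(LINT x|lborel. (f x * ?E 1 x)\<^sup>2) \<le> 0"
  proof (rule field_le_epsilon)
    fix e :: real assume e: "e > 0"
    have J0: "J \<ge> 0" by (simp add: J_def)
    have "(LINT x|lborel. (f x * ?E 1 x)\<^sup>2) \<le> e / (J + 1) * J" using e J0 by (intro small) simp
    also have "\<dots> \<le> e" using e J0 by (simp add: field_simps)
    finally show "(LINT x|lborel. (f x * ?E 1 x)\<^sup>2) \<le> 0 + e" by simp
  qed
  moreover have "(LINT x|lborel. (f x * ?E 1 x)\<^sup>2) \<ge> 0" by simp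
  ultimately have "(LINT x|lborel. (f x * ?E 1 x)\<^sup>2) = 0" by linarith
  \<comment> \<open>The zero set of the continuous \<open>f\<close> is closed and of full measure,
    hence everything.\<close>
  then have "AE x in lborel. (f x * ?E 1 x)\<^sup>2 = 0"
    using i2 by (subst (asm) integral_nonneg_eq_0_iff_AE) auto
  then have "AE x in lborel. x \<in> {x. f x = 0}" by eventually_elim simp
  then have "AE x in lebesgue. x \<in> {x. f x = 0}" by (rule AE_completion)
  moreover have "closed {x. f x = 0}" using cont by (intro closed_Collect_eq) (auto intro: continuous_intros)
  ultimately show ?thesis using mem_closed_if_AE_lebesgue by blast
qed

section \<open>Transitivity of rotations and the conjugation action\<close>

lemma qvec_unit_Spin3: "norm n = 1 \<Longrightarrow> qvec n \<in> Spin3"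
  by (simp add: Spin3_def forall_index4 qvec_nth)

text \<open>A unit vector, read as a unit quaternion, acts as the half turn about its own axis.
  These half turns are all the rotations that the remaining arguments need to construct.\<close>

lemma spin_rot_qvec:
  assumes "norm n = 1"
  shows "spin_rot (qvec n) x = 2 *\<^sub>R (n \<bullet> x) *\<^sub>R n - x"
proof -
  have "n $ 1 * n $ 1 + n $ 2 * n $ 2 + n $ 3 * n $ 3 = 1"
    using assms by (simp add: norm_eq_1 inner_vec3)
  then have n: "n $ 1 * n $ 1 - n $ 2 * n $ 2 - n $ 3 * n $ 3 = 2 * (n $ 1 * n $ 1) - 1"
    "n $ 2 * n $ 2 - n $ 1 * n $ 1 - n $ 3 * n $ 3 = 2 * (n $ 2 * n $ 2) - 1"
    "n $ 3 * n $ 3 - n $ 2 * n $ 2 - n $ 1 * n $ 1 = 2 * (n $ 3 * n $ 3) - 1" by simp_all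
  have "spin_rot (qvec n) x $ 1 = (n $ 1 * n $ 1 - n $ 2 * n $ 2 - n $ 3 * n $ 3) * x $ 1
        + 2 * n $ 1 * (n $ 2 * x $ 2 + n $ 3 * x $ 3)"
    "spin_rot (qvec n) x $ 2 = (n $ 2 * n $ 2 - n $ 1 * n $ 1 - n $ 3 * n $ 3) * x $ 2
        + 2 * n $ 2 * (n $ 1 * x $ 1 + n $ 3 * x $ 3)"
    "spin_rot (qvec n) x $ 3 = (n $ 3 * n $ 3 - n $ 2 * n $ 2 - n $ 1 * n $ 1) * x $ 3
        + 2 * n $ 3 * (n $ 2 * x $ 2 + n $ 1 * x $ 1)"
    by (simp_all add: spin_rot_def vec_of_q_def qmult_nth qconj_nth qvec_nth) (simp_all add: algebra_simps)
  then show ?thesis unfolding n by (simp add: vec_eq_iff forall_3 inner_vec3 algebra_simps)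
qed

text \<open>The half turn about the bisector \<open>x + y\<close> exchanges two vectors of equal
  length. If they are opposite, any axis orthogonal to \<open>x\<close> serves.\<close>

lemma spin_rot_transitive:
  assumes "norm x = norm y"
  shows "\<exists>s\<in>Spin3. spin_rot s x = y"
proof (cases "x + y = 0")
  case True
  obtain v :: "real ^ 3" where v: "v \<noteq> 0" "orthogonal x v"
    using orthogonal_to_vector_exists[of x] by (auto simp: orthogonal_commute)
  define n where "n = (1 / norm v) *\<^sub>R v"
  have n: "norm n = 1" "n \<bullet> x = 0" using v by (simp_all add: n_def orthogonal_def inner_commute)
  have "- x = y" using True by (rule minus_unique)
  then show ?thesis using n by (intro bexI[of _ "qvec n"]) (simp_all add: spin_rot_qvec qvec_unit_Spin3)
next
  case False
  define n where "n = (1 / norm (x + y)) *\<^sub>R (x + y)"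
  have n: "norm n = 1" using False by (simp add: n_def)
  have "(norm (x + y))\<^sup>2 = 2 * ((x + y) \<bullet> x)"
  proof -
    have "x \<bullet> x = y \<bullet> y" using assms by (simp add: dot_square_norm)
    then show ?thesis by (simp add: power2_norm_eq_inner inner_simps inner_commute)
  qed
  moreover have "2 *\<^sub>R (n \<bullet> x) *\<^sub>R n = (2 * ((x + y) \<bullet> x) / (norm (x + y))\<^sup>2) *\<^sub>R (x + y)"
    by (simp add: n_def power2_eq_square)
  ultimately have "2 *\<^sub>R (n \<bullet> x) *\<^sub>R n = x + y"
    using False by (metis divide_self norm_eq_zero power_eq_0_iff scaleR_one)
  then show ?thesis using n by (intro bexI[of _ "qvec n"]) (simp_all add: spin_rot_qvec qvec_unit_Spin3)
qed

text \<open>The right factor makes scalar radial functions and radial multiples of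
  \<open>qvec x\<close> invariant, in particular both Poisson kernels. By right linearity
  intertwiners commute with this action, so \<open>A\<close> maps invariant vectors to invariant
  vectors.\<close>

definition conjop :: "biquat \<Rightarrow> Ltwo \<Rightarrow> Ltwo" where "conjop s u = rmul (U (1, s, 0) u) (qconj s)"

lemma spin_GG [simp]: "s \<in> Spin3 \<Longrightarrow> (1, s, 0) \<in> GG" by (simp add: GG_def)

lemma linear_conjop: "s \<in> Spin3 \<Longrightarrow> linear (conjop s)"
  unfolding conjop_def using linear_compose[OF U_linear[OF spin_GG] linear_rmul] by (simp add: o_def)

lemma inner_conjop: "s \<in> Spin3 \<Longrightarrow> conjop s u \<bullet> conjop s v = u \<bullet> v"
  by (simp add: conjop_def inner_rmul rmul_rmul qdag_Spin3 qconj_Spin3 Spin3_inverse inner_U)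

lemma conjop_cls:
  assumes s: "s \<in> Spin3" and f: "f \<in> L2"
  shows "conjop s (cls f) = cls (\<lambda>x. s \<odot> f (spin_rot (qconj s) x) \<odot> qconj s)"
proof -
  have "natural_rep (1, s, 0) f = (\<lambda>x. s \<odot> f (spin_rot (qconj s) x))" by (simp add: fun_eq_iff)
  moreover have "natural_rep (1, s, 0) f \<in> L2" using s f by (intro natural_rep_L2) auto
  ultimately show ?thesis
    unfolding conjop_def using s f by (simp add: U_cls rmul_cls del: natural_rep.simps)
qed

lemma conjop_transl: "s \<in> Spin3 \<Longrightarrow> conjop s (transl b u) = transl (spin_rot s b) (conjop s u)"
  by (simp add: conjop_def transl_def U_rmul U_U qmult_units)

lemma cq_commute: "s \<odot> cq z = cq z \<odot> s"
  by (simp add: biquat_eq_iff qmult_nth cq_nth mult.commute)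

lemma conj_cq: "s \<in> Spin3 \<Longrightarrow> s \<odot> cq z \<odot> qconj s = cq z"
  unfolding cq_commute[of s] qmult_assoc by (simp only: Spin3_inverse qmult_units)

lemma conj_qvec_cq: "s \<in> Spin3 \<Longrightarrow> s \<odot> (qvec x \<odot> cq z) \<odot> qconj s = qvec (spin_rot s x) \<odot> cq z"
  by (simp add: qvec_spin_rot qmult_assoc cq_commute[of "qconj s" z, symmetric])

lemma radial_spin_rot:
  assumes "s \<in> Spin3"
  shows "heat t (spin_rot s x) = heat t x" "Pk t (spin_rot s x) = Pk t x" "Qk t (spin_rot s x) = Qk t x"
  by (simp_all add: heat_def Pk_def Qk_def norm_spin_rot assms)

lemma conjop_hq: "s \<in> Spin3 \<Longrightarrow> t > 0 \<Longrightarrow> conjop s (hq t q) = hq t (s \<odot> q \<odot> qconj s)"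
  unfolding hq_def
  by (simp add: conjop_cls qmult.scaleR_left qmult.scaleR_right radial_spin_rot qconj_Spin3)

lemma conjop_Pv: "s \<in> Spin3 \<Longrightarrow> t > 0 \<Longrightarrow> conjop s (Pv t (cq z)) = Pv t (cq z)"
  unfolding Pv_def
  by (simp add: conjop_cls qmult.scaleR_left qmult.scaleR_right radial_spin_rot qconj_Spin3 conj_cq)

lemma conjop_Qv: "s \<in> Spin3 \<Longrightarrow> t > 0 \<Longrightarrow> conjop s (Qv t (cq z)) = Qv t (cq z)"
  unfolding Qv_def
  by (simp add: conjop_cls qmult.scaleR_left qmult.scaleR_right radial_spin_rot qconj_Spin3 conj_qvec_cq spin_rot_inverse)

lemma hq_add: "t > 0 \<Longrightarrow> hq t (p + q) = hq t p + hq t q"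
  unfolding hq_def by (simp add: cls_add scaleR_add_right)

lemma hq_scaleR: "t > 0 \<Longrightarrow> hq t (c *\<^sub>R q) = c *\<^sub>R hq t q"
  unfolding hq_def by (simp add: cls_scaleR mult.commute)

text \<open>By the semigroup law the inner products of translated Gaussians are values of a
  Gaussian, so their mutual distances are explicit and tend to 0.\<close>

lemma continuous_transl_hq:
  assumes t: "t > 0"
  shows "continuous_on UNIV (\<lambda>b. E \<bullet> transl b (hq t q))"
proof -
  have ip: "transl b (hq t q) \<bullet> transl b' (hq t q) = (norm q)\<^sup>2 * heat (2 * t) (b' - b)" for b b'
  proof -
    have "transl b (hq t q) \<bullet> transl b' (hq t q) = hq t q \<bullet> transl (b' - b) (hq t q)"
      by (simp add: inner_transl_left transl_transl)
    also have "\<dots> = (LINT x|lborel. (norm q)\<^sup>2 * (heat t x * heat t ((b' - b) - x)))"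
    proof -
      have "heat t (x - (b' - b)) = heat t ((b' - b) - x)" for x using heat_minus[of t "x - (b' - b)"] by simp
      then show ?thesis
        unfolding hq_def using t L2_transl[OF hq_L2[OF t, of q], of "b' - b"]
        by (simp add: transl_cls inner_cls power2_norm_eq_inner mult_ac)
    qed
    also have "\<dots> = (norm q)\<^sup>2 * heat (2 * t) (b' - b)" using heat_convolution(1)[OF t t, of "b' - b"] by simp
    finally show ?thesis .
  qed
  have "continuous (at b0) (\<lambda>b. transl b (hq t q))" for b0
    unfolding continuous_at
  proof (rule tendsto_dist_iff[THEN iffD2])
    have d: "dist (transl b (hq t q)) (transl b0 (hq t q)) = sqrt ((norm q)\<^sup>2 * (2 * heat (2 * t) 0 - 2 * heat (2 * t) (b0 - b)))" for b
    proof -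
      have "heat (2 * t) (b - b0) = heat (2 * t) (b0 - b)" using heat_minus[of "2 * t" "b0 - b"] by simp
      then show ?thesis
        by (simp add: dist_norm norm_eq_sqrt_inner inner_diff_left inner_diff_right ip algebra_simps)
    qed
    have "((\<lambda>b. sqrt ((norm q)\<^sup>2 * (2 * heat (2 * t) 0 - 2 * heat (2 * t) (b0 - b)))) \<longlongrightarrow>
        sqrt ((norm q)\<^sup>2 * (2 * heat (2 * t) 0 - 2 * heat (2 * t) (b0 - b0)))) (at b0)"
      unfolding heat_def using t by (intro tendsto_intros) auto
    then show "((\<lambda>b. dist (transl b (hq t q)) (transl b0 (hq t q))) \<longlongrightarrow> 0) (at b0)" by (simp add: d)
  qed
  then show ?thesis
    by (intro continuous_on_inner continuous_on_const) (simp add: continuous_at_imp_continuous_on)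
qed

text \<open>Makes the Lebesgue points of Poisson averages serve for Gaussian averages too. In the
  scaled variable it is \<open>(1 + u)\<^sup>2 \<le> 2 * exp u\<close>.\<close>

lemma heat_le_Pk: "t > 0 \<Longrightarrow> heat (t\<^sup>2) z \<le> (2 * pi\<^sup>2 / sqrt pi ^ 3) * Pk t z"
proof -
  assume t: "t > 0"
  define u where "u = (norm z)\<^sup>2 / t\<^sup>2"
  have u: "u \<ge> 0" by (simp add: u_def)
  have "(1 + u)\<^sup>2 \<le> 2 * exp u" using exp_lower_Taylor_quadratic[OF u] u by (simp add: power2_eq_square algebra_simps)
  then have "exp (- u) \<le> 2 / (1 + u)\<^sup>2" using u by (simp add: exp_minus divide_simps add_nonneg_eq_0_iff)
  then have "(1 / (sqrt pi * t)) ^ 3 * exp (- u) \<le> (1 / (sqrt pi * t)) ^ 3 * (2 / (1 + u)\<^sup>2)"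
    using t by (intro mult_left_mono) auto
  also have "1 + u = (t\<^sup>2 + (norm z)\<^sup>2) / t\<^sup>2" using t by (simp add: u_def field_simps)
  also have "(1 / (sqrt pi * t)) ^ 3 * (2 / ((t\<^sup>2 + (norm z)\<^sup>2) / t\<^sup>2)\<^sup>2) = (2 * pi\<^sup>2 / sqrt pi ^ 3) * Pk t z"
    using t by (simp add: Pk_def power_divide power_mult_distrib) (simp add: power2_eq_square power3_eq_cube power4_eq_xxxx)
  finally show ?thesis using t by (simp add: heat_def u_def real_sqrt_mult)
qed

text \<open>Vectors fixed by the conjugation action of the spin group are, after smoothing, of the form
  \<open>\<alpha>(|x|) + \<beta>(|x|) x\<close>, so two radial functions have to be tested only.\<close>

lemma conjop_invariant_zero:
  assumes inv: "\<And>s. s \<in> Spin3 \<Longrightarrow> conjop s E = E"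
    and h0: "\<And>s z. s > 0 \<Longrightarrow> z \<in> {1, \<i>} \<Longrightarrow> E \<bullet> hq s (cq z) = 0"
    and v0: "\<And>s z. s > 0 \<Longrightarrow> z \<in> {1, \<i>} \<Longrightarrow> E \<bullet> vq s (cq z) = 0"
  shows "E = 0"
proof -
  \<comment> \<open>The Gaussian average of \<open>E\<close> about \<open>b\<close>, paired with
    \<open>q\<close>. All these averages will be shown to vanish, for every
    \<open>q\<close>.\<close>
  define F where "F t b q = E \<bullet> transl b (hq t q)" for t b q
  have cov: "F t (spin_rot s b) (s \<odot> q \<odot> qconj s) = F t b q" if "t > 0" "s \<in> Spin3" for t s b q
  proof -
    have "F t b q = conjop s E \<bullet> conjop s (transl b (hq t q))" using that by (simp add: F_def inner_conjop)
    also have "\<dots> = F t (spin_rot s b) (s \<odot> q \<odot> qconj s)"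
      using that by (simp add: F_def inv conjop_transl conjop_hq)
    finally show ?thesis ..
  qed
  have Fadd: "F t b (p + q) = F t b p + F t b q" and Fscale: "F t b (c *\<^sub>R q) = c * F t b q" if "t > 0" for t b p q c
    using that by (simp_all add: F_def hq_add hq_scaleR linear_add[OF linear_transl] linear_scale[OF linear_transl] inner_add_right)
  have Fc: "continuous_on UNIV (\<lambda>b. F t b q)" if "t > 0" for t q
    unfolding F_def using that by (rule continuous_transl_hq)
  have Fb: "\<bar>F t b q\<bar> \<le> norm E * norm (hq t q)" for t b q
    using Cauchy_Schwarz_ineq2[of E "transl b (hq t q)"] by (simp add: F_def)
  \<comment> \<open>Scalars are fixed by conjugation, so the function is radial in \<open>b\<close>.
    Its own Gaussian average is, by the semigroup law, a pairing of \<open>E\<close> with a scalar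
    Gaussian.\<close>
  have scalar: "F t b (cq z) = 0" if t: "t > 0" and z: "z \<in> {1, \<i>}" for t b z
  proof (rule heat_transform_zero[of "\<lambda>b. F t b (cq z)" "norm E * norm (hq t (cq z))"])
    show "continuous_on UNIV (\<lambda>b. F t b (cq z))" by (rule Fc[OF t])
    show "F t x (cq z) = F t y (cq z)" if xy: "norm x = norm y" for x y
    proof -
      obtain s where s: "s \<in> Spin3" "spin_rot s x = y" using spin_rot_transitive[OF xy] by blast
      then show ?thesis using cov[OF t s(1), of x "cq z"] by (simp add: conj_cq)
    qed
    show "\<bar>F t x (cq z)\<bar> \<le> norm E * norm (hq t (cq z)) * (1 + norm x)" for x
      using Fb[of t x "cq z"] by (rule order_trans) (simp add: algebra_simps)
    fix s :: real assume s: "s > 0"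
    have "(LINT x|lborel. F t x (cq z) * heat s x) = hq (t + s) (cq z) \<bullet> E"
      unfolding hq_convolution[OF s t] F_def by (simp add: inner_commute mult.commute)
    then show "(LINT x|lborel. F t x (cq z) * heat s x) = 0"
      using h0[of "t + s" z] s t z by (simp add: inner_commute)
  qed
  have qvec_sum: "qvec b \<odot> q = (\<Sum>i\<in>UNIV. b $ i *\<^sub>R (qvec (axis i 1) \<odot> q))" for b q
  proof -
    have "b = b $ 1 *\<^sub>R axis 1 1 + b $ 2 *\<^sub>R axis 2 1 + b $ 3 *\<^sub>R axis 3 1"
      by (simp add: vec_eq_iff forall_3 axis_def)
    then have "qvec b = qvec (b $ 1 *\<^sub>R axis 1 1 + b $ 2 *\<^sub>R axis 2 1 + b $ 3 *\<^sub>R axis 3 1)" by (simp add: sum_3)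
    then show ?thesis by (simp add: sum_3 qvec_add qvec_scaleR qmult.add_left qmult.scaleR_left)
  qed
  \<comment> \<open>Rotations move \<open>b\<close> and the direction \<open>qvec b\<close>
    together, so this is radial as well. Averaged over \<open>b\<close> it becomes the pairing of
    \<open>E\<close> with \<open>s\<close> times \<open>vq (t + s) (cq z)\<close>.\<close>
  have radial: "F t b (qvec b \<odot> cq z) = 0" if t: "t > 0" and z: "z \<in> {1, \<i>}" for t b z
  proof -
    have exp: "F t b (qvec b \<odot> cq z) = (\<Sum>i\<in>UNIV. b $ i * F t b (qvec (axis i 1) \<odot> cq z))" for b
      by (subst qvec_sum) (simp add: sum_3 Fadd[OF t] Fscale[OF t])
    define C where "C = norm E * sqrt (heat (2 * t) 0)"
    have hb: "norm (hq t (qvec b \<odot> cq z)) = norm b * sqrt (heat (2 * t) 0)" for b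
    proof -
      have "(norm (qvec b \<odot> cq z))\<^sup>2 = (norm b)\<^sup>2" using z unfolding power2_norm_eq_inner inner_qvec_cq by (auto simp: power2_norm_eq_inner)
      then have "norm (qvec b \<odot> cq z) = norm b" by (rule power2_eq_imp_eq) auto
      then show ?thesis by (simp add: norm_hq t)
    qed
    show ?thesis
    proof (rule heat_transform_zero[of "\<lambda>b. F t b (qvec b \<odot> cq z)" C])
      show "continuous_on UNIV (\<lambda>b. F t b (qvec b \<odot> cq z))"
        unfolding exp by (intro continuous_on_sum continuous_on_mult Fc[OF t] continuous_intros)
      show "F t x (qvec x \<odot> cq z) = F t y (qvec y \<odot> cq z)" if xy: "norm x = norm y" for x y
      proof -
        obtain s where s: "s \<in> Spin3" "spin_rot s x = y" using spin_rot_transitive[OF xy] by blast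
        then show ?thesis using cov[OF t s(1), of x "qvec x \<odot> cq z"] by (simp add: conj_qvec_cq)
      qed
      show "\<bar>F t x (qvec x \<odot> cq z)\<bar> \<le> C * (1 + norm x)" for x
      proof -
        have "C \<ge> 0" using t by (simp add: C_def)
        moreover have "\<bar>F t x (qvec x \<odot> cq z)\<bar> \<le> C * norm x" using Fb[of t x "qvec x \<odot> cq z"] by (simp add: hb C_def mult_ac)
        ultimately show ?thesis by (simp add: algebra_simps)
      qed
      fix s :: real assume s: "s > 0"
      define k where "k b x = heat s b *\<^sub>R heat t (x - b) *\<^sub>R (qvec b \<odot> cq z)" for b x :: "real ^ 3"
      have kL: "k b \<in> L2" for b
        unfolding k_def using L2_scaleR[OF L2_transl[OF hq_L2[OF t, of "qvec b \<odot> cq z"], of b]] by simp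
      have kc: "cls (k b) = heat s b *\<^sub>R transl b (hq t (qvec b \<odot> cq z))" for b
      proof -
        have "(\<lambda>x. heat t (x - b) *\<^sub>R (qvec b \<odot> cq z)) \<in> L2"
          using L2_transl[OF hq_L2[OF t, of "qvec b \<odot> cq z"], of b] by simp
        then show ?thesis unfolding k_def hq_def by (simp only: cls_scaleR transl_cls[OF hq_L2[OF t]])
      qed
      \<comment> \<open>The substitution \<open>y = x - b\<close> brings the integrand into the form
        of \<open>heat_convolution\<close>; the factor \<open>s\<close> makes up for the division by
        \<open>s\<close> there.\<close>
      have refl_eq: "(\<lambda>b. k b x) = (\<lambda>b. (\<lambda>y. s *\<^sub>R ((heat t y *\<^sub>R (heat s (x - y) / s) *\<^sub>R qvec (x - y)) \<odot> cq z)) (x + - b))" for x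
        using s by (simp add: fun_eq_iff k_def qmult.scaleR_left)
      have ky: "integrable lborel (\<lambda>y. s *\<^sub>R ((heat t y *\<^sub>R (heat s (x - y) / s) *\<^sub>R qvec (x - y)) \<odot> cq z))"
        "(LINT y|lborel. s *\<^sub>R ((heat t y *\<^sub>R (heat s (x - y) / s) *\<^sub>R qvec (x - y)) \<odot> cq z)) = s *\<^sub>R (heat (t + s) x / (t + s)) *\<^sub>R (qvec x \<odot> cq z)" for x
      proof -
        have bl: "bounded_linear (\<lambda>a. a \<odot> cq z)" by (rule qmult.bounded_linear_left)
        show "integrable lborel (\<lambda>y. s *\<^sub>R ((heat t y *\<^sub>R (heat s (x - y) / s) *\<^sub>R qvec (x - y)) \<odot> cq z))"
          by (intro integrable_scaleR_right integrable_bounded_linear[OF bl heat_convolution(4)[OF t s]])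
        show "(LINT y|lborel. s *\<^sub>R ((heat t y *\<^sub>R (heat s (x - y) / s) *\<^sub>R qvec (x - y)) \<odot> cq z)) = s *\<^sub>R (heat (t + s) x / (t + s)) *\<^sub>R (qvec x \<odot> cq z)"
          unfolding integral_scaleR_right integral_bounded_linear[OF bl heat_convolution(4)[OF t s]] heat_convolution(2)[OF t s]
          by (simp add: qmult.scaleR_left)
      qed
      have kint: "integrable lborel (\<lambda>b. k b x)" "(LINT b|lborel. k b x) = s *\<^sub>R (heat (t + s) x / (t + s)) *\<^sub>R (qvec x \<odot> cq z)" for x
      proof -
        let ?G = "\<lambda>y. s *\<^sub>R ((heat t y *\<^sub>R (heat s (x - y) / s) *\<^sub>R qvec (x - y)) \<odot> cq z)"
        have [measurable]: "?G \<in> borel_measurable borel" by measurable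
        have n: "integrable lborel (\<lambda>b. ?G (x + - b)) = integrable lborel (\<lambda>b. ?G (x + b))"
          "(LINT b|lborel. ?G (x + - b)) = (LINT b|lborel. ?G (x + b))"
          using integral_neg[of "\<lambda>b. ?G (x + b)"] by simp_all
        have m: "integrable lborel (\<lambda>b. ?G (x + b)) = integrable lborel ?G" "(LINT b|lborel. ?G (x + b)) = (LINT b|lborel. ?G b)"
          using integral_transl[of ?G "- x"] by (simp_all add: add.commute)
        show "integrable lborel (\<lambda>b. k b x)" unfolding refl_eq n m by (rule ky)
        show "(LINT b|lborel. k b x) = s *\<^sub>R (heat (t + s) x / (t + s)) *\<^sub>R (qvec x \<odot> cq z)"
          unfolding refl_eq n m by (rule ky)
      qed
      have ts: "t + s > 0" using t s by simp
      have "cls (\<lambda>x. s *\<^sub>R (heat (t + s) x / (t + s)) *\<^sub>R (qvec x \<odot> cq z)) \<bullet> E = (LINT b|lborel. cls (k b) \<bullet> E)"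
      proof (rule inner_cls_integral[OF sigma_finite_lborel _ kL _ kint(1) _ kint(2)[symmetric]])
        show "case_prod k \<in> borel_measurable (lborel \<Otimes>\<^sub>M lborel)" unfolding k_def by measurable
        show "(\<lambda>x. s *\<^sub>R (heat (t + s) x / (t + s)) *\<^sub>R (qvec x \<odot> cq z)) \<in> L2" by (intro L2_scaleR vq_L2 ts)
        have n: "norm (cls (k b)) = norm (sqrt (heat (2 * t) 0) *\<^sub>R heat s b *\<^sub>R qvec b)" for b
          unfolding kc using t by (simp add: hb mult_ac abs_mult)
        have "integrable lborel (\<lambda>b. sqrt (heat (2 * t) 0) *\<^sub>R heat s b *\<^sub>R qvec b)"
          by (intro integrable_scaleR_right integrable_heat_qvec s)
        then show "(\<integral>\<^sup>+b. ennreal (norm (cls (k b))) \<partial>lborel) < \<infinity>"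
          unfolding n by (simp only: integrable_iff_bounded)
      qed
      moreover have "cls (\<lambda>x. s *\<^sub>R (heat (t + s) x / (t + s)) *\<^sub>R (qvec x \<odot> cq z)) = s *\<^sub>R vq (t + s) (cq z)"
        unfolding vq_def by (rule cls_scaleR[symmetric]) (rule vq_L2[OF ts])
      ultimately have "(LINT b|lborel. cls (k b) \<bullet> E) = 0"
        using v0[OF ts z] by (simp add: inner_commute)
      then show "(LINT x|lborel. F t x (qvec x \<odot> cq z) * heat s x) = 0"
        unfolding kc F_def by (simp add: inner_commute mult.commute)
    qed
  qed
  \<comment> \<open>The half turn about \<open>n\<close> fixes \<open>b\<close> and reverses
    \<open>w\<close>, so invariance says that the value equals its negative.\<close>
  have perp: "F t b (qvec w \<odot> cq z) = 0" if t: "t > 0" and n: "norm n = 1" "n \<bullet> w = 0" "spin_rot (qvec n) b = b" for t b w z n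
    using cov[OF t qvec_unit_Spin3[OF n(1)], of b "qvec w \<odot> cq z"] n
      Fscale[OF t, of b "-1" "qvec w \<odot> cq z"]
    by (simp add: conj_qvec_cq qvec_unit_Spin3 spin_rot_qvec qvec_minus qmult.minus_left)
  \<comment> \<open>A direction splits into a multiple of \<open>b\<close> and a part orthogonal to
    \<open>b\<close>. The first is covered by \<open>radial\<close>, the second by the half turn
    about \<open>b\<close>; for \<open>b = 0\<close> any axis orthogonal to \<open>w\<close> will
    do.\<close>
  have vector: "F t b (qvec w \<odot> cq z) = 0" if t: "t > 0" and z: "z \<in> {1, \<i>}" for t b w z
  proof (cases "b = 0")
    case True
    obtain v :: "real ^ 3" where v: "v \<noteq> 0" "orthogonal w v"
      using orthogonal_to_vector_exists[of w] by (auto simp: orthogonal_commute)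
    show ?thesis
      by (rule perp[OF t, of "(1 / norm v) *\<^sub>R v"]) (use v True in \<open>simp_all add: orthogonal_def inner_commute\<close>)
  next
    case False
    define c where "c = (b \<bullet> w) / (b \<bullet> b)"
    define n where "n = (1 / norm b) *\<^sub>R b"
    have n: "norm n = 1" using False by (simp add: n_def)
    have nb: "2 *\<^sub>R (n \<bullet> b) *\<^sub>R n = 2 *\<^sub>R b"
      using False by (simp add: n_def dot_square_norm power2_eq_square)
    have "F t b (qvec (w - c *\<^sub>R b) \<odot> cq z) = 0"
    proof (rule perp[OF t n])
      have "b \<bullet> (w - c *\<^sub>R b) = 0" using False by (simp add: c_def inner_diff_right)
      then show "n \<bullet> (w - c *\<^sub>R b) = 0" by (simp add: n_def)
      show "spin_rot (qvec n) b = b" using nb by (simp add: spin_rot_qvec[OF n] scaleR_2)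
    qed
    moreover have "qvec w \<odot> cq z = qvec (w - c *\<^sub>R b) \<odot> cq z + c *\<^sub>R (qvec b \<odot> cq z)"
      by (simp add: qvec_diff qvec_scaleR qmult.diff_left qmult.scaleR_left)
    ultimately show ?thesis using radial[OF t z, of b] by (simp add: Fadd[OF t] Fscale[OF t])
  qed
  have all: "F t b q = 0" if t: "t > 0" for t b q
  proof -
    define u v :: "real ^ 3" where "u = (\<chi> i. if i = 1 then Re (q $ 1) else if i = 2 then Re (q $ 2) else Re (q $ 3))"
      and "v = (\<chi> i. if i = 1 then Im (q $ 1) else if i = 2 then Im (q $ 2) else Im (q $ 3))"
    have "q = Re (q $ 0) *\<^sub>R cq 1 + Im (q $ 0) *\<^sub>R cq \<i> + qvec u \<odot> cq 1 + qvec v \<odot> cq \<i>"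
      by (simp add: biquat_eq_iff complex_eq_iff cq_nth qmult_nth qvec_nth u_def v_def)
    then have "F t b q = F t b (Re (q $ 0) *\<^sub>R cq 1 + Im (q $ 0) *\<^sub>R cq \<i> + qvec u \<odot> cq 1 + qvec v \<odot> cq \<i>)" by simp
    then show ?thesis using t by (simp add: Fadd Fscale scalar vector)
  qed
  define f where "f = fun_of E"
  have f: "f \<in> L2" by (simp add: f_def)
  have [measurable]: "f \<in> borel_measurable borel" using f by (rule L2_measurable)
  have "AE x in lborel. f x = 0"
    using Poisson_Lebesgue_points[OF f]
  proof eventually_elim
    fix x assume lim: "((\<lambda>t. LINT z|lborel. Pk t z * norm (f (x + z) - f x)) \<longlongrightarrow> 0) (at_right 0)"
    define c where "c = 2 * pi\<^sup>2 / sqrt pi ^ 3"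
    have "norm (f x) \<le> c * (LINT z|lborel. Pk t z * norm (f (x + z) - f x))" if t: "t > 0" for t
    proof -
      have t2: "t\<^sup>2 > 0" using t by simp
      let ?G = "\<lambda>z. heat (t\<^sup>2) z * (f (x + z) \<bullet> f x)"
      have hL: "(\<lambda>z. heat (t\<^sup>2) (z - x) *\<^sub>R f x) \<in> L2"
        using L2_transl[OF hq_L2[OF t2, of "f x"], of x] by simp
      have "F (t\<^sup>2) x (f x) = (LINT z|lborel. f z \<bullet> (heat (t\<^sup>2) (z - x) *\<^sub>R f x))"
        unfolding F_def hq_def transl_cls[OF hq_L2[OF t2]] inner_cls_right[OF hL] by (simp only: f_def)
      also have "\<dots> = (LINT z|lborel. ?G (z - x))" by simp
      also have "\<dots> = (LINT z|lborel. ?G z)" by (rule integral_transl) simp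
      finally have G0: "(LINT z|lborel. ?G z) = 0" using all[OF t2] by simp
      have iG: "integrable lborel ?G"
      proof -
        have "integrable lborel (\<lambda>z. f z \<bullet> (heat (t\<^sup>2) (z - x) *\<^sub>R f x))" by (intro L2_inner_integrable f hL)
        then have "integrable lborel (\<lambda>z. ?G (z - x))" by simp
        then show ?thesis by (subst (asm) integral_transl) simp_all
      qed
      note iP = integrable_Pk_diff(1)[OF f t, of x]
      have ih: "integrable lborel (\<lambda>z. heat (t\<^sup>2) z * (norm (f x) * norm (f x)))" using has_integral_heat[OF t2] by simp
      \<comment> \<open>Since the Gaussian average of \<open>f (x + z) \<bullet> f x\<close> is 0,
        the square of \<open>norm (f x)\<close> is the average of
        \<open>(f x - f (x + z)) \<bullet> f x\<close>, which the Poisson mean oscillation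
        controls.\<close>
      have "norm (f x) * norm (f x) = (LINT z|lborel. heat (t\<^sup>2) z * (norm (f x) * norm (f x)))"
        using has_integral_heat[OF t2] by simp
      also have "\<dots> = (LINT z|lborel. heat (t\<^sup>2) z * (norm (f x) * norm (f x)) - ?G z)"
        using G0 iG ih by simp
      also have "\<dots> \<le> (LINT z|lborel. norm (f x) * (c * (Pk t z * norm (f (x + z) - f x))))"
      proof (rule integral_mono)
        show "integrable lborel (\<lambda>z. heat (t\<^sup>2) z * (norm (f x) * norm (f x)) - ?G z)" using iG ih by simp
        show "integrable lborel (\<lambda>z. norm (f x) * (c * (Pk t z * norm (f (x + z) - f x))))" using iP by simp
        fix z
        have "heat (t\<^sup>2) z * (norm (f x) * norm (f x)) - ?G z = heat (t\<^sup>2) z * ((f x - f (x + z)) \<bullet> f x)"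
          by (simp add: inner_diff_left dot_square_norm power2_eq_square algebra_simps)
        also have "\<dots> \<le> heat (t\<^sup>2) z * (norm (f (x + z) - f x) * norm (f x))"
          using t2 norm_cauchy_schwarz[of "f x - f (x + z)" "f x"] by (intro mult_left_mono) (auto simp: norm_minus_commute)
        also have "\<dots> \<le> (c * Pk t z) * (norm (f (x + z) - f x) * norm (f x))"
          using heat_le_Pk[OF t, of z] by (intro mult_right_mono) (auto simp: c_def)
        finally show "heat (t\<^sup>2) z * (norm (f x) * norm (f x)) - ?G z \<le> norm (f x) * (c * (Pk t z * norm (f (x + z) - f x)))"
          by (simp add: mult_ac)
      qed
      also have "\<dots> = norm (f x) * (c * (LINT z|lborel. Pk t z * norm (f (x + z) - f x)))" by simp
      finally have le: "norm (f x) * norm (f x) \<le> norm (f x) * (c * (LINT z|lborel. Pk t z * norm (f (x + z) - f x)))" .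
      have "0 \<le> c * (LINT z|lborel. Pk t z * norm (f (x + z) - f x))"
        using t by (intro mult_nonneg_nonneg Bochner_Integration.integral_nonneg) (auto simp: c_def)
      then show ?thesis using le by (cases "f x = 0") auto
    qed
    then have "((\<lambda>t::real. f x) \<longlongrightarrow> 0) (at_right 0)" by (rule dominated_kernel_tendsto[OF lim])
    then show "f x = 0" by (simp add: tendsto_const_iff)
  qed
  then have "f =ae (\<lambda>x. 0)" by (simp add: ae_eq_def)
  then have "cls f = cls (\<lambda>x. 0)" using f by (simp add: cls_eq_iff)
  then show ?thesis by (simp add: f_def zero_Ltwo_def)
qed

theorem intertwiner_Poisson_eq:
  assumes T: "intertwiner T" and A: "intertwiner A" and adj: "\<And>u v. T u \<bullet> v = u \<bullet> A v"
  obtains l m where "A (Pv 1 (cq 1)) = Pv 1 (cq l) + Qv 1 (cq m)"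
proof -
  obtain l m where lm:
    "\<And>s z. s > 0 \<Longrightarrow> z \<in> {1, \<i>} \<Longrightarrow> (A (Pv 1 (cq 1)) - Pv 1 (cq l) - Qv 1 (cq m)) \<bullet> hq s (cq z) = 0"
    "\<And>s z. s > 0 \<Longrightarrow> z \<in> {1, \<i>} \<Longrightarrow> (A (Pv 1 (cq 1)) - Pv 1 (cq l) - Qv 1 (cq m)) \<bullet> vq s (cq z) = 0"
    by (rule intertwiner_Poisson[OF T A adj]) blast
  have "A (Pv 1 (cq 1)) - Pv 1 (cq l) - Qv 1 (cq m) = 0"
  proof (rule conjop_invariant_zero[OF _ lm])
    fix s assume s: "s \<in> Spin3"
    have "conjop s (A u) = A (conjop s u)" for u
      using s by (simp add: conjop_def intertwinerD(2,3)[OF A])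
    then show "conjop s (A (Pv 1 (cq 1)) - Pv 1 (cq l) - Qv 1 (cq m)) = A (Pv 1 (cq 1)) - Pv 1 (cq l) - Qv 1 (cq m)"
      using s by (simp add: linear_diff[OF linear_conjop] conjop_Pv conjop_Qv)
  qed
  then show ?thesis by (intro that[of l m]) (simp add: algebra_simps)
qed

section \<open>Intertwining operators\<close>

text \<open>The Poisson kernel and its conjugate have equal norms; this is the trace of
  \<open>H\<^sup>2 = I\<close> that the isometric case uses. The Gaussian mixture gives the two
  sides as \<open>Gamma (5/2)\<close> and \<open>3/2 * Gamma (3/2)\<close>, up to the same
  factor.\<close>

lemma nn_integral_Pk_square:
  "(\<integral>\<^sup>+x. ennreal ((Pk 1 x)\<^sup>2) \<partial>lborel) = (\<integral>\<^sup>+x. ennreal ((norm x)\<^sup>2 * (Qk 1 x)\<^sup>2) \<partial>lborel)"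
proof -
  \<comment> \<open>The mixing weight of the fourth inverse power of
    \<open>1 + (norm x)\<^sup>2\<close>; the 6 is \<open>Gamma 4\<close>.\<close>
  let ?k = "\<lambda>u. indicator {0<..} u * (u powr 3 * exp (- u)) / (6 * pi ^ 4)"
  have four: "ennreal ((Pk 1 x)\<^sup>2) = (\<integral>\<^sup>+u. ennreal (?k u) * ennreal (exp (- u * (norm x)\<^sup>2)) \<partial>lborel)" for x
  proof -
    define a where "a = 1 + (norm x)\<^sup>2"
    have a: "a > 0" by (simp add: a_def add_pos_nonneg)
    have "(\<integral>\<^sup>+u. ennreal (?k u) * ennreal (exp (- u * (norm x)\<^sup>2)) \<partial>lborel)
      = (\<integral>\<^sup>+u. ennreal (1 / (6 * pi ^ 4)) * ennreal (indicator {0<..} u * (u powr (4 - 1) * exp (- a * u))) \<partial>lborel)"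
      by (intro nn_integral_cong)
        (auto simp: indicator_def a_def ennreal_mult[symmetric] exp_add[symmetric] algebra_simps)
    also have "\<dots> = ennreal (1 / (6 * pi ^ 4)) * (\<integral>\<^sup>+u. ennreal (indicator {0<..} u * (u powr (4 - 1) * exp (- a * u))) \<partial>lborel)"
      by (intro nn_integral_cmult) measurable
    also have "\<dots> = ennreal (1 / (6 * pi ^ 4)) * ennreal (Gamma 4 * a powr (- 4))"
      by (subst nn_integral_gamma[OF a]) auto
    also have "\<dots> = ennreal ((Pk 1 x)\<^sup>2)"
    proof -
      have "Gamma (4::real) = 6" using Gamma_fact[of 3, where 'a=real] by (simp add: fact_numeral)
      moreover have "a powr (- 4) = 1 / a ^ 4" using a powr_minus_divide[of a 4] powr_realpow[OF a, of 4] by simp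
      moreover have "(Pk 1 x)\<^sup>2 = 1 / (pi ^ 4 * a ^ 4)"
        by (simp add: Pk_def a_def power_divide power_mult_distrib flip: power_mult)
      ultimately show ?thesis using a by (simp add: ennreal_mult[symmetric])
    qed
    finally show ?thesis by simp
  qed
  have swap: "(\<integral>\<^sup>+x. ennreal ((Pk 1 x)\<^sup>2) * ennreal (\<phi> x) \<partial>lborel)
      = (\<integral>\<^sup>+u. ennreal (?k u) * (\<integral>\<^sup>+x. ennreal (exp (- u * (norm x)\<^sup>2)) * ennreal (\<phi> x) \<partial>lborel) \<partial>lborel)"
    if [measurable]: "\<phi> \<in> borel_measurable borel" for \<phi> :: "real ^ 3 \<Rightarrow> real"
  proof -
    have "(\<integral>\<^sup>+x. ennreal ((Pk 1 x)\<^sup>2) * ennreal (\<phi> x) \<partial>lborel)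
      = (\<integral>\<^sup>+x. \<integral>\<^sup>+u. ennreal (?k u) * (ennreal (exp (- u * (norm x)\<^sup>2)) * ennreal (\<phi> x)) \<partial>lborel \<partial>lborel)"
      unfolding four by (intro nn_integral_cong) (simp add: nn_integral_multc[symmetric] mult.assoc)
    also have "\<dots> = (\<integral>\<^sup>+u. \<integral>\<^sup>+x. ennreal (?k u) * (ennreal (exp (- u * (norm x)\<^sup>2)) * ennreal (\<phi> x)) \<partial>lborel \<partial>lborel)"
      by (rule lborel_pair.Fubini'[symmetric]) measurable
    also have "\<dots> = (\<integral>\<^sup>+u. ennreal (?k u) * (\<integral>\<^sup>+x. ennreal (exp (- u * (norm x)\<^sup>2)) * ennreal (\<phi> x) \<partial>lborel) \<partial>lborel)"
      by (intro nn_integral_cong nn_integral_cmult) measurable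
    finally show ?thesis .
  qed
  let ?c = "sqrt pi ^ 3 / (6 * pi ^ 4)"
  have z3: "sqrt (pi / u) ^ 3 = sqrt pi ^ 3 * u powr (- (3/2))" if "u > 0" for u
    using that by (simp add: powr_half_rules real_sqrt_divide power_divide)
  have "(\<integral>\<^sup>+x. ennreal ((Pk 1 x)\<^sup>2) \<partial>lborel)
      = (\<integral>\<^sup>+u. ennreal (?k u) * (\<integral>\<^sup>+x. ennreal (exp (- u * (norm (x :: real ^ 3))\<^sup>2)) \<partial>lborel) \<partial>lborel)"
    using swap[of "\<lambda>_. 1"] by simp
  also have "\<dots> = (\<integral>\<^sup>+u. ennreal ?c * ennreal (indicator {0<..} u * (u powr (5/2 - 1) * exp (- 1 * u))) \<partial>lborel)"
  proof (intro nn_integral_cong)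
    fix u :: real
    show "ennreal (?k u) * (\<integral>\<^sup>+x. ennreal (exp (- u * (norm (x :: real ^ 3))\<^sup>2)) \<partial>lborel)
      = ennreal ?c * ennreal (indicator {0<..} u * (u powr (5/2 - 1) * exp (- 1 * u)))"
    proof (cases "u > 0")
      case u: True
      have "u powr 3 * u powr (- (3/2)) = u powr (5/2 - 1)" by (subst powr_add[symmetric]) simp
      then have "?k u * sqrt (pi / u) ^ 3 = ?c * (u powr (5/2 - 1) * exp (- 1 * u))"
        using u by (simp add: z3 mult_ac)
      then show ?thesis using u by (simp only: nn_integral_gaussian3[OF u]) (simp add: ennreal_mult[symmetric])
    qed simp
  qed
  also have "\<dots> = ennreal ?c * ennreal (Gamma (5/2))"
    by (subst nn_integral_cmult, measurable) (subst nn_integral_gamma, auto)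
  finally have 1: "(\<integral>\<^sup>+x. ennreal ((Pk 1 x)\<^sup>2) \<partial>lborel) = ennreal ?c * ennreal (Gamma (5/2))" .
  have "(\<integral>\<^sup>+x. ennreal ((norm x)\<^sup>2 * (Qk 1 x)\<^sup>2) \<partial>lborel) = (\<integral>\<^sup>+x. ennreal ((Pk 1 x)\<^sup>2) * ennreal ((norm x)\<^sup>2) \<partial>lborel)"
    by (simp add: Pk_1 ennreal_mult[symmetric] mult.commute)
  also have "\<dots> = (\<integral>\<^sup>+u. ennreal (?k u) * (\<integral>\<^sup>+x. ennreal (exp (- u * (norm (x :: real ^ 3))\<^sup>2)) * ennreal ((norm x)\<^sup>2) \<partial>lborel) \<partial>lborel)"
    by (rule swap) simp
  also have "\<dots> = (\<integral>\<^sup>+u. ennreal (?c * (3/2)) * ennreal (indicator {0<..} u * (u powr (3/2 - 1) * exp (- 1 * u))) \<partial>lborel)"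
  proof (intro nn_integral_cong)
    fix u :: real
    show "ennreal (?k u) * (\<integral>\<^sup>+x. ennreal (exp (- u * (norm (x :: real ^ 3))\<^sup>2)) * ennreal ((norm x)\<^sup>2) \<partial>lborel)
      = ennreal (?c * (3/2)) * ennreal (indicator {0<..} u * (u powr (3/2 - 1) * exp (- 1 * u)))"
    proof (cases "u > 0")
      case u: True
      have in_eq: "(\<integral>\<^sup>+x. ennreal (exp (- u * (norm (x :: real ^ 3))\<^sup>2)) * ennreal ((norm x)\<^sup>2) \<partial>lborel) = ennreal (3 / (2 * u) * sqrt (pi / u) ^ 3)"
        unfolding nn_integral_gaussian3_moment[OF u, symmetric] by (simp add: ennreal_mult[symmetric] mult.commute)
      have "u powr 3 * u powr (- (3/2)) = u powr (3/2 - 1 + 1)" by (subst powr_add[symmetric]) simp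
      also have "\<dots> = u powr (3/2 - 1) * u" using u by (subst powr_add) simp
      finally have e: "u powr 3 * u powr (- (3/2)) / u = u powr (3/2 - 1)" using u by simp
      have "?k u * (3 / (2 * u) * (sqrt pi ^ 3 * u powr (- (3/2)))) = ?c * (3/2) * ((u powr 3 * u powr (- (3/2)) / u) * exp (- 1 * u))"
        using u by (simp add: mult_ac)
      then have "?k u * (3 / (2 * u) * sqrt (pi / u) ^ 3) = ?c * (3/2) * (u powr (3/2 - 1) * exp (- 1 * u))"
        unfolding z3[OF u] e .
      then show ?thesis using u unfolding in_eq by (simp add: ennreal_mult[symmetric])
    qed simp
  qed
  also have "\<dots> = ennreal (?c * (3/2)) * ennreal (Gamma (3/2))"
    by (subst nn_integral_cmult, measurable) (subst nn_integral_gamma, auto)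
  also have "\<dots> = ennreal ?c * ennreal (Gamma (5/2))"
  proof -
    have "(3 / 2 :: real) \<notin> \<int>\<^sub>\<le>\<^sub>0" using nonpos_Ints_nonpos[of "3 / 2 :: real"] by auto
    then have "Gamma (5 / 2 :: real) = 3 / 2 * Gamma (3 / 2)" using Gamma_plus1[of "3 / 2 :: real"] by simp
    moreover have "0 \<le> Gamma (3 / 2 :: real)" by (rule Gamma_real_nonneg) simp
    ultimately show ?thesis by (simp only:) (simp add: ennreal_mult[symmetric])
  qed
  finally show ?thesis using 1 by simp
qed

lemma Pv_dil:
  assumes t: "t > 0"
  shows "U (t, axis 0 1, 0) (Pv 1 q) = t powr (3/2) *\<^sub>R Pv t q"
proof -
  have "t powr (-3/2) * t ^ 3 = t powr (3/2)" using powr_m32_power[OF t, of 3] by simp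
  moreover have "Pk 1 ((1 / t) *\<^sub>R x) = t ^ 3 * Pk t x" for x using t by (simp add: Pk_scale[OF t, of x])
  ultimately have eq: "t powr (-3/2) *\<^sub>R Pk 1 ((1 / t) *\<^sub>R x) *\<^sub>R q = t powr (3/2) *\<^sub>R Pk t x *\<^sub>R q" for x
    by (simp only: scaleR_scaleR mult.assoc[symmetric])
  have "U (t, axis 0 1, 0) (Pv 1 q) = cls (\<lambda>x. t powr (3/2) *\<^sub>R Pk t x *\<^sub>R q)"
    unfolding Pv_def using t by (subst U_cls) (simp_all only: natural_rep_dil eq dil_GG Pv_L2 zero_less_one)
  also have "\<dots> = t powr (3/2) *\<^sub>R Pv t q"
    unfolding Pv_def using t by (intro cls_scaleR[symmetric] Pv_L2)
  finally show ?thesis .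
qed

lemma Qv_dil:
  assumes t: "t > 0"
  shows "U (t, axis 0 1, 0) (Qv 1 q) = t powr (3/2) *\<^sub>R Qv t q"
proof -
  have p: "t powr (-3/2) * t ^ 3 = t powr (3/2)" using powr_m32_power[OF t, of 3] by simp
  have q: "Qk 1 ((1 / t) *\<^sub>R x) * (1 / t) = t ^ 3 * Qk t x" for x
    using t Pk_scale[OF t, of x] by (simp add: Pk_1[symmetric] Qk_Pk[OF t])
  have eq: "t powr (-3/2) *\<^sub>R Qk 1 ((1 / t) *\<^sub>R x) *\<^sub>R (qvec ((1 / t) *\<^sub>R x) \<odot> q) = t powr (3/2) *\<^sub>R Qk t x *\<^sub>R (qvec x \<odot> q)" for x
  proof -
    have "t powr (-3/2) *\<^sub>R Qk 1 ((1 / t) *\<^sub>R x) *\<^sub>R (qvec ((1 / t) *\<^sub>R x) \<odot> q)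
      = (t powr (-3/2) * (Qk 1 ((1 / t) *\<^sub>R x) * (1 / t))) *\<^sub>R (qvec x \<odot> q)"
      by (simp only: qvec_scaleR qmult.scaleR_left scaleR_scaleR)
    also have "\<dots> = t powr (3/2) *\<^sub>R Qk t x *\<^sub>R (qvec x \<odot> q)"
      unfolding q p[symmetric] by simp
    finally show ?thesis .
  qed
  have "U (t, axis 0 1, 0) (Qv 1 q) = cls (\<lambda>x. t powr (3/2) *\<^sub>R Qk t x *\<^sub>R (qvec x \<odot> q))"
    unfolding Qv_def using t by (subst U_cls) (simp_all only: natural_rep_dil eq dil_GG Qv_L2 zero_less_one)
  also have "\<dots> = t powr (3/2) *\<^sub>R Qv t q"
    unfolding Qv_def using t by (intro cls_scaleR[symmetric] Qv_L2)
  finally show ?thesis .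
qed

lemma rmul_Pv: "t > 0 \<Longrightarrow> rmul (Pv t p) q = Pv t (p \<odot> q)"
  unfolding Pv_def by (simp add: rmul_cls qmult.scaleR_left)

lemma rmul_Qv: "t > 0 \<Longrightarrow> rmul (Qv t p) q = Qv t (p \<odot> q)"
  unfolding Qv_def by (simp add: rmul_cls qmult.scaleR_left qmult_assoc)

text \<open>Both kernels have the same homogeneity \<open>3/2\<close>, so the coefficients
  \<open>l\<close> and \<open>m\<close> found at \<open>t = 1\<close> are valid for every
  \<open>t\<close>. Translations and right multiplication supply \<open>b\<close> and
  \<open>q\<close>.\<close>

lemma intertwiner_Pv:
  assumes A: "intertwiner A" and lm: "A (Pv 1 (cq 1)) = Pv 1 (cq l) + Qv 1 (cq m)" and t: "t > 0"
  shows "A (transl b (Pv t q)) = transl b (Pv t (cq l \<odot> q) + Qv t (cq m \<odot> q))"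
proof -
  have c: "t powr (3/2) \<noteq> 0" using t by simp
  have "t powr (3/2) *\<^sub>R A (Pv t (cq 1)) = U (t, axis 0 1, 0) (A (Pv 1 (cq 1)))"
    using t by (simp add: intertwinerD(2)[OF A, symmetric] Pv_dil linear_scale[OF intertwinerD(1)[OF A]])
  also have "\<dots> = t powr (3/2) *\<^sub>R (Pv t (cq l) + Qv t (cq m))"
    using t by (simp add: lm linear_add[OF U_linear] Pv_dil Qv_dil scaleR_add_right)
  finally have 1: "A (Pv t (cq 1)) = Pv t (cq l) + Qv t (cq m)" using c by simp
  have "A (transl b (Pv t q)) = transl b (rmul (A (Pv t (cq 1))) q)"
    using t by (simp add: intertwinerD(4)[OF A] intertwinerD(3)[OF A, symmetric] rmul_Pv qmult_units)
  then show ?thesis unfolding 1 using t by (simp add: rmul_add rmul_Pv rmul_Qv)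
qed

text \<open>Complexified quaternions have zero divisors, so the norm is not multiplicative in
  general. It is when the left factor is a real vector, a multiple of a unit quaternion.\<close>

lemma norm_qvec_mult: "norm (qvec z \<odot> a) = norm z * norm a"
proof (cases "z = 0")
  case False
  have "qvec z = norm z *\<^sub>R qvec ((1 / norm z) *\<^sub>R z)" using False by (simp add: qvec_scaleR)
  then have "norm (qvec z \<odot> a) = norm z * norm (qvec ((1 / norm z) *\<^sub>R z) \<odot> a)"
    by (metis abs_norm_cancel norm_scaleR qmult.scaleR_left)
  then show ?thesis using False by (simp add: norm_Spin3_left qvec_unit_Spin3)
qed (simp add: qmult.zero_left)

lemma cq_mult: "cq z \<odot> a = z *s a"
  by (simp add: biquat_eq_iff qmult_nth cq_nth)

lemma qdag_cq: "qdag (cq z) = cq (cnj z)"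
  by (simp add: biquat_eq_iff qdag_nth cq_nth)

lemma inner_cq_mult: "a \<bullet> (cq z \<odot> q) = (cnj z *s a) \<bullet> q"
  using qinner_left[of "cq (cnj z)" a q] by (simp add: qdag_cq cq_mult)

lemma inner_qvec_mult: "a \<bullet> (qvec w \<odot> q) = - ((qvec w \<odot> a) \<bullet> q)"
  using qinner_left[of "qvec w" a q] by (simp add: qdag_qvec qmult.minus_left)

lemma bounded_linear_smult: "bounded_linear (\<lambda>a::biquat. z *s a)"
  using qmult.bounded_linear_right[of "cq z"] by (simp add: cq_mult)

section \<open>Poisson averages and truncated singular integrals\<close>

definition PF :: "real \<Rightarrow> (real ^ 3 \<Rightarrow> biquat) \<Rightarrow> real ^ 3 \<Rightarrow> biquat" where
  "PF t f x = (LINT z|lborel. Pk t z *\<^sub>R f (x + z))"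

text \<open>The displacement \<open>z\<close> points from \<open>x\<close> to the argument, opposite
  to the convention in \<open>hilbert\<close>. As the kernel is odd, \<open>QF\<close> approximates
  the negative of \<open>hilbert f\<close> wherever the limits exist.\<close>

definition QF :: "real \<Rightarrow> (real ^ 3 \<Rightarrow> biquat) \<Rightarrow> real ^ 3 \<Rightarrow> biquat" where
  "QF t f x = (LINT z|lborel. Qk t z *\<^sub>R (qvec z \<odot> f (x + z)))"

lemma L2_add_arg: "f \<in> L2 \<Longrightarrow> (\<lambda>z. f (x + z)) \<in> L2"
  using L2_transl[of f "- x"] by (simp add: add.commute)

lemma integrable_QF:
  assumes f: "f \<in> L2" and t: "t > 0"
  shows "integrable lborel (\<lambda>z. Qk t z *\<^sub>R (qvec z \<odot> f (x + z)))"
proof (rule Bochner_Integration.integrable_bound)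
  have [measurable]: "f \<in> borel_measurable borel" using f by (rule L2_measurable)
  show "integrable lborel (\<lambda>z. (norm z)\<^sup>2 * (Qk t z)\<^sup>2 + (norm (f (x + z)))\<^sup>2)"
    using Qk_square_integrable[OF t] L2_integrable[OF L2_add_arg[OF f]] by simp
  show "AE z in lborel. norm (Qk t z *\<^sub>R (qvec z \<odot> f (x + z))) \<le> norm ((norm z)\<^sup>2 * (Qk t z)\<^sup>2 + (norm (f (x + z)))\<^sup>2)"
  proof (rule AE_I2)
    fix z
    show "norm (Qk t z *\<^sub>R (qvec z \<odot> f (x + z))) \<le> norm ((norm z)\<^sup>2 * (Qk t z)\<^sup>2 + (norm (f (x + z)))\<^sup>2)"
      using abs_inner_le[of "Qk t z * norm z" "norm (f (x + z))"]
      by (simp add: norm_qvec_mult power_mult_distrib abs_mult mult_ac)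
  qed
  show "(\<lambda>z. Qk t z *\<^sub>R (qvec z \<odot> f (x + z))) \<in> borel_measurable lborel" by measurable
qed

lemma integral_add_arg:
  fixes F :: "real ^ 3 \<Rightarrow> 'b::{banach, second_countable_topology}"
  assumes [measurable]: "F \<in> borel_measurable borel"
  shows "(LINT y|lborel. F (y - x)) = (LINT z|lborel. F z)"
  by (rule integral_transl) simp

lemma inner_transl_Pv:
  assumes f: "f \<in> L2" and t: "t > 0"
  shows "cls f \<bullet> transl x (Pv t q) = PF t f x \<bullet> q"
proof -
  have [measurable]: "f \<in> borel_measurable borel" using f by (rule L2_measurable)
  let ?G = "\<lambda>z. (Pk t z *\<^sub>R f (x + z)) \<bullet> q"
  have "cls f \<bullet> transl x (Pv t q) = (LINT y|lborel. f y \<bullet> (Pk t (y - x) *\<^sub>R q))"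
    unfolding Pv_def transl_cls[OF Pv_L2[OF t]]
    by (rule inner_cls[OF f]) (use L2_transl[OF Pv_L2[OF t, of q], of x] in simp)
  also have "\<dots> = (LINT y|lborel. ?G (y - x))" by simp
  also have "\<dots> = (LINT z|lborel. ?G z)" by (rule integral_add_arg) simp
  also have "\<dots> = PF t f x \<bullet> q" unfolding PF_def by (rule integral_inner_left) (rule integrable_Pk_diff[OF f t])
  finally show ?thesis .
qed

lemma inner_transl_Qv:
  assumes f: "f \<in> L2" and t: "t > 0"
  shows "cls f \<bullet> transl x (Qv t q) = - (QF t f x \<bullet> q)"
proof -
  have [measurable]: "f \<in> borel_measurable borel" using f by (rule L2_measurable)
  let ?G = "\<lambda>z. - ((Qk t z *\<^sub>R (qvec z \<odot> f (x + z))) \<bullet> q)"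
  have "cls f \<bullet> transl x (Qv t q) = (LINT y|lborel. f y \<bullet> (Qk t (y - x) *\<^sub>R (qvec (y - x) \<odot> q)))"
    unfolding Qv_def transl_cls[OF Qv_L2[OF t]]
    by (rule inner_cls[OF f]) (use L2_transl[OF Qv_L2[OF t, of q], of x] in simp)
  also have "\<dots> = (LINT y|lborel. ?G (y - x))" by (simp add: inner_qvec_mult)
  also have "\<dots> = (LINT z|lborel. ?G z)" by (rule integral_add_arg) simp
  also have "\<dots> = - (QF t f x \<bullet> q)"
    unfolding QF_def using integral_inner_left[OF integrable_QF[OF f t, of x], of q] by simp
  finally show ?thesis .
qed

text \<open>The truncated singular kernel differs from the conjugate Poisson kernel by an odd kernel that
  the Poisson kernel dominates; oddness allows \<open>f x\<close> to be subtracted under the integral.\<close>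

definition Dk :: "real \<Rightarrow> real ^ 3 \<Rightarrow> real" where
  "Dk t z = Qk t z - indicator {z. norm z > t} z * (1 / (pi\<^sup>2 * norm z ^ 4))"

lemma Dk_measurable [measurable]: "Dk t \<in> borel_measurable borel"
  unfolding Dk_def by measurable

lemma Dk_bound:
  assumes t: "t > 0"
  shows "\<bar>Dk t z\<bar> * norm z \<le> 3 * Pk t z"
proof (cases "norm z > t")
  case False
  then have "Qk t z * norm z \<le> Qk t z * t" by (intro mult_left_mono) auto
  also have "\<dots> = Pk t z" using t by (simp add: Qk_Pk)
  also have "\<dots> \<le> 3 * Pk t z" using t by simp
  finally show ?thesis using False by (simp add: Dk_def)
next
  case True
  define r where "r = norm z"
  define S where "S = t\<^sup>2 + r\<^sup>2"
  have r: "r > t" "r > 0" using True t by (auto simp: r_def)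
  have S: "S > 0" using t by (simp add: S_def add_pos_nonneg)
  have "Dk t z = - ((S\<^sup>2 - r ^ 4) / (pi\<^sup>2 * r ^ 4 * S\<^sup>2))"
  proof -
    have "Dk t z = 1 / (pi\<^sup>2 * S\<^sup>2) - 1 / (pi\<^sup>2 * r ^ 4)"
      using True by (simp add: Dk_def Qk_def r_def S_def)
    moreover have "1 / (c * a) - 1 / (c * b) = - ((a - b) / (c * b * a))" if "a \<noteq> 0" "b \<noteq> 0" "c \<noteq> 0" for a b c :: real
      using that by (simp add: divide_simps)
    ultimately show ?thesis using S r by simp
  qed
  moreover have "S\<^sup>2 - r ^ 4 = t ^ 4 + 2 * t\<^sup>2 * r\<^sup>2"
    by (simp add: S_def power2_eq_square power4_eq_xxxx algebra_simps)
  \<comment> \<open>For \<open>t < r\<close> each of \<open>t ^ 4\<close> and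
    \<open>t\<^sup>2 * r\<^sup>2\<close> is at most \<open>t * r ^ 3\<close>; the constant 3 is the
    sum of the coefficients 1 and 2.\<close>
  moreover have "t ^ 4 + 2 * t\<^sup>2 * r\<^sup>2 \<le> 3 * t * r ^ 3"
  proof -
    have a: "t\<^sup>2 * t\<^sup>2 \<le> t\<^sup>2 * r\<^sup>2" using r t by (intro mult_left_mono power_mono) auto
    have b: "t\<^sup>2 * r\<^sup>2 \<le> t * r ^ 3"
      using mult_right_mono[of t r "t * r\<^sup>2"] r t by (simp add: power2_eq_square power3_eq_cube mult_ac)
    show ?thesis using a b by (simp add: power2_eq_square power4_eq_xxxx)
  qed
  ultimately have "\<bar>Dk t z\<bar> \<le> 3 * t * r ^ 3 / (pi\<^sup>2 * r ^ 4 * S\<^sup>2)"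
    using t r S by (simp add: abs_minus_cancel) (intro divide_right_mono; simp)
  then have "\<bar>Dk t z\<bar> * r \<le> 3 * t * r ^ 3 / (pi\<^sup>2 * r ^ 4 * S\<^sup>2) * r" using r by (intro mult_right_mono) auto
  also have "\<dots> = 3 * (t / (pi\<^sup>2 * S\<^sup>2))" using r by (simp add: power3_eq_cube power4_eq_xxxx)
  also have "\<dots> = 3 * Pk t z" by (simp add: Pk_def S_def r_def)
  finally show ?thesis by (simp add: r_def)
qed

lemma hilbert_trunc_bound:
  assumes f: "f \<in> L2" and t: "t > 0"
  shows "norm ((1 / pi\<^sup>2) *\<^sub>R hilbert_trunc t f x + QF t f x) \<le> 3 * (LINT z|lborel. Pk t z * norm (f (x + z) - f x))"
proof -
  have [measurable]: "f \<in> borel_measurable borel" using f by (rule L2_measurable)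
  let ?K = "\<lambda>z. (indicator {z. norm z > t} z * (1 / (pi\<^sup>2 * norm z ^ 4))) *\<^sub>R (qvec z \<odot> f (x + z))"
  have iD: "integrable lborel (\<lambda>z. Dk t z *\<^sub>R (qvec z \<odot> g z))" if "integrable lborel (\<lambda>z. Pk t z *\<^sub>R g z)"
    and [measurable]: "g \<in> borel_measurable borel" for g :: "real ^ 3 \<Rightarrow> biquat"
  proof (rule Bochner_Integration.integrable_bound)
    show "integrable lborel (\<lambda>z. 3 *\<^sub>R (Pk t z *\<^sub>R g z))" using that(1) by (rule integrable_scaleR_right)
    show "AE z in lborel. norm (Dk t z *\<^sub>R (qvec z \<odot> g z)) \<le> norm (3 *\<^sub>R (Pk t z *\<^sub>R g z))"
    proof (rule AE_I2)
      fix z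
      have "\<bar>Dk t z\<bar> * norm z * norm (g z) \<le> 3 * Pk t z * norm (g z)" by (intro mult_right_mono Dk_bound[OF t]) simp
      then show "norm (Dk t z *\<^sub>R (qvec z \<odot> g z)) \<le> norm (3 *\<^sub>R (Pk t z *\<^sub>R g z))"
        using t by (simp add: norm_qvec_mult mult.assoc)
    qed
    show "(\<lambda>z. Dk t z *\<^sub>R (qvec z \<odot> g z)) \<in> borel_measurable lborel" by measurable
  qed
  have i1: "integrable lborel (\<lambda>z. Dk t z *\<^sub>R (qvec z \<odot> f (x + z)))"
    by (rule iD) (use integrable_Pk_diff(2)[OF f t] in auto)
  have i2: "integrable lborel (\<lambda>z. Dk t z *\<^sub>R (qvec z \<odot> f x))"
    by (rule iD) (use integrable_Pk[OF t] in auto)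
  have odd: "(LINT z|lborel. Dk t z *\<^sub>R (qvec z \<odot> f x)) = 0"
  proof -
    have "(LINT z|lborel. Dk t z *\<^sub>R (qvec z \<odot> f x)) = (LINT z|lborel. Dk t (- z) *\<^sub>R (qvec (- z) \<odot> f x))"
      by (rule integral_neg(1)[symmetric]) measurable
    also have "\<dots> = - (LINT z|lborel. Dk t z *\<^sub>R (qvec z \<odot> f x))"
      by (simp add: qvec_minus qmult.minus_left Dk_def Qk_def indicator_def)
    finally show ?thesis by (simp add: eq_neg_iff_add_eq_0 flip: scaleR_2)
  qed
  have KD: "?K z = Qk t z *\<^sub>R (qvec z \<odot> f (x + z)) - Dk t z *\<^sub>R (qvec z \<odot> f (x + z))" for z
    by (simp add: Dk_def scaleR_left_diff_distrib)
  have "(1 / pi\<^sup>2) *\<^sub>R hilbert_trunc t f x = (LINT y|lborel. - ?K (y - x))"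
  proof -
    have "(1 / pi\<^sup>2) *\<^sub>R hilbert_trunc t f x = (LINT y|lborel. (1 / pi\<^sup>2) *\<^sub>R indicat_real {y. norm (x - y) > t} y *\<^sub>R (1 / norm (x - y) ^ 4) *\<^sub>R (qvec (x - y) \<odot> f y))"
      unfolding hilbert_trunc_def set_lebesgue_integral_def by (rule integral_scaleR_right[symmetric])
    also have "\<dots> = (LINT y|lborel. - ?K (y - x))"
    proof (intro Bochner_Integration.integral_cong refl)
      fix y
      have "qvec (x - y) = - qvec (y - x)" by (simp add: qvec_diff)
      then show "(1 / pi\<^sup>2) *\<^sub>R indicat_real {y. norm (x - y) > t} y *\<^sub>R (1 / norm (x - y) ^ 4) *\<^sub>R (qvec (x - y) \<odot> f y) = - ?K (y - x)"
        by (simp add: norm_minus_commute[of x y] qmult.minus_left indicator_def)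
    qed
    finally show ?thesis .
  qed
  also have "\<dots> = (LINT z|lborel. - ?K z)" by (rule integral_add_arg) measurable
  also have "\<dots> = (LINT z|lborel. Dk t z *\<^sub>R (qvec z \<odot> f (x + z))) - QF t f x"
    unfolding KD QF_def using integrable_QF[OF f t, of x] i1 by simp
  finally have "(1 / pi\<^sup>2) *\<^sub>R hilbert_trunc t f x + QF t f x = (LINT z|lborel. Dk t z *\<^sub>R (qvec z \<odot> f (x + z)))" by simp
  also have "\<dots> = (LINT z|lborel. Dk t z *\<^sub>R (qvec z \<odot> (f (x + z) - f x)))"
    using i1 i2 odd by (simp add: qmult.diff_right scaleR_diff_right)
  also have "norm \<dots> \<le> (LINT z|lborel. norm (Dk t z *\<^sub>R (qvec z \<odot> (f (x + z) - f x))))" by (rule integral_norm_bound)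
  also have "\<dots> \<le> (LINT z|lborel. 3 * (Pk t z * norm (f (x + z) - f x)))"
  proof (rule integral_mono)
    show "integrable lborel (\<lambda>z. norm (Dk t z *\<^sub>R (qvec z \<odot> (f (x + z) - f x))))"
      using Bochner_Integration.integrable_diff[OF i1 i2] by (simp add: qmult.diff_right scaleR_diff_right)
    show "integrable lborel (\<lambda>z. 3 * (Pk t z * norm (f (x + z) - f x)))" using integrable_Pk_diff(1)[OF f t] by simp
    fix z
    have "\<bar>Dk t z\<bar> * norm z * norm (f (x + z) - f x) \<le> 3 * Pk t z * norm (f (x + z) - f x)"
      by (intro mult_right_mono Dk_bound[OF t]) simp
    then show "norm (Dk t z *\<^sub>R (qvec z \<odot> (f (x + z) - f x))) \<le> 3 * (Pk t z * norm (f (x + z) - f x))"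
      by (simp add: norm_qvec_mult mult.assoc)
  qed
  also have "\<dots> = 3 * (LINT z|lborel. Pk t z * norm (f (x + z) - f x))" by simp
  finally show ?thesis .
qed

lemma PF_tendsto:
  assumes f: "f \<in> L2"
    and lim: "((\<lambda>t. LINT z|lborel. Pk t z * norm (f (x + z) - f x)) \<longlongrightarrow> 0) (at_right 0)"
  shows "((\<lambda>t. PF t f x) \<longlongrightarrow> f x) (at_right 0)"
proof -
  have "((\<lambda>t. PF t f x - f x) \<longlongrightarrow> 0) (at_right 0)"
  proof (rule dominated_kernel_tendsto[OF lim])
    fix t :: real assume t: "t > 0"
    have i: "integrable lborel (\<lambda>z. Pk t z *\<^sub>R f x)" using integrable_Pk[OF t] by simp
    have "PF t f x - f x = (LINT z|lborel. Pk t z *\<^sub>R f (x + z)) - (LINT z|lborel. Pk t z *\<^sub>R f x)"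
      using integrable_Pk[OF t] integral_Pk[OF t] by (simp add: PF_def)
    also have "\<dots> = (LINT z|lborel. Pk t z *\<^sub>R (f (x + z) - f x))"
      using integrable_Pk_diff(2)[OF f t, of x] i by (simp add: scaleR_diff_right)
    also have "norm \<dots> \<le> (LINT z|lborel. norm (Pk t z *\<^sub>R (f (x + z) - f x)))" by (rule integral_norm_bound)
    finally show "norm (PF t f x - f x) \<le> 1 * (LINT z|lborel. Pk t z * norm (f (x + z) - f x))" using t by simp
  qed
  then show ?thesis by (simp add: LIM_zero_iff)
qed

text \<open>The coefficients are conjugated because they belong to the adjoint \<open>A\<close>. The
  minus sign before \<open>QF\<close> in \<open>eq\<close> disappears in the limit, where
  \<open>QF\<close> becomes the negative of \<open>hilbert f x\<close>.\<close>

lemma intertwiner_representation: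
  assumes A: "intertwiner A" and adj: "\<And>u v. T u \<bullet> v = u \<bullet> A v"
    and lm: "A (Pv 1 (cq 1)) = Pv 1 (cq l) + Qv 1 (cq m)"
    and f: "f \<in> L2" and g: "g \<in> L2" and Tf: "T (cls f) = cls g"
  shows "g =ae (\<lambda>x. cnj l *s f x + cnj m *s hilbert f x)"
proof -
  have eq: "PF t g x = cnj l *s PF t f x - cnj m *s QF t f x" if t: "t > 0" for t x
  proof -
    have "PF t g x \<bullet> q = (cnj l *s PF t f x - cnj m *s QF t f x) \<bullet> q" for q
    proof -
      have "PF t g x \<bullet> q = cls f \<bullet> A (transl x (Pv t q))"
        by (simp add: inner_transl_Pv[OF g t, symmetric] Tf[symmetric] adj)
      also have "\<dots> = cls f \<bullet> transl x (Pv t (cq l \<odot> q)) + cls f \<bullet> transl x (Qv t (cq m \<odot> q))"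
        by (simp add: intertwiner_Pv[OF A lm t] linear_add[OF linear_transl] inner_add_right)
      also have "\<dots> = (cnj l *s PF t f x - cnj m *s QF t f x) \<bullet> q"
        by (simp add: inner_transl_Pv[OF f t] inner_transl_Qv[OF f t] inner_cq_mult inner_diff_left)
      finally show ?thesis .
    qed
    then show ?thesis using vector_eq_rdot by blast
  qed
  show ?thesis
    unfolding ae_eq_def using Poisson_Lebesgue_points[OF f] Poisson_Lebesgue_points[OF g]
  proof eventually_elim
    fix x
    assume lf: "((\<lambda>t. LINT z|lborel. Pk t z * norm (f (x + z) - f x)) \<longlongrightarrow> 0) (at_right 0)"
      and lg: "((\<lambda>t. LINT z|lborel. Pk t z * norm (g (x + z) - g x)) \<longlongrightarrow> 0) (at_right 0)"
    note sm = bounded_linear.tendsto[OF bounded_linear_smult]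
    have lim: "((\<lambda>t. cnj l *s PF t f x - PF t g x) \<longlongrightarrow> cnj l *s f x - g x) (at_right 0)"
      by (intro tendsto_diff sm PF_tendsto f g lf lg)
    have pos: "eventually (\<lambda>t::real. t > 0) (at_right 0)" by (rule eventually_at_right_less)
    \<comment> \<open>The convergence of \<open>QF\<close>, up to the factor \<open>cnj m\<close>,
      is not known in advance: it is forced by the convergence of the Poisson averages of
      \<open>f\<close> and of \<open>g\<close>.\<close>
    have limQ: "((\<lambda>t. cnj m *s QF t f x) \<longlongrightarrow> cnj l *s f x - g x) (at_right 0)"
      by (rule Lim_transform_eventually[OF lim]) (use pos in eventually_elim, simp add: eq)
    show "g x = cnj l *s f x + cnj m *s hilbert f x"
    \<comment> \<open>For \<open>m = 0\<close> nothing has been shown about the principal value at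
      \<open>x\<close>, but the term \<open>cnj m *s hilbert f x\<close> is zero whatever
      \<open>Lim\<close> returns.\<close>
    proof (cases "m = 0")
      case True
      then have "((\<lambda>t::real. 0) \<longlongrightarrow> cnj l *s f x - g x) (at_right 0)" using limQ by simp
      then have "cnj l *s f x - g x = 0" by (simp add: tendsto_const_iff)
      then show ?thesis using True by simp
    next
      case False
      define L where "L = (1 / cnj m) *s (cnj l *s f x - g x)"
      have mL: "cnj m *s L = cnj l *s f x - g x" using False by (simp add: L_def)
      have "((\<lambda>t. (1 / cnj m) *s (cnj m *s QF t f x)) \<longlongrightarrow> L) (at_right 0)"
        unfolding L_def by (intro sm limQ)
      then have Q: "((\<lambda>t. QF t f x) \<longlongrightarrow> L) (at_right 0)" using False by simp
      have "((\<lambda>t. (1 / pi\<^sup>2) *\<^sub>R hilbert_trunc t f x + QF t f x) \<longlongrightarrow> 0) (at_right 0)"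
        by (rule dominated_kernel_tendsto[OF lf hilbert_trunc_bound[OF f]])
      then have "((\<lambda>t. pi\<^sup>2 *\<^sub>R (((1 / pi\<^sup>2) *\<^sub>R hilbert_trunc t f x + QF t f x) - QF t f x)) \<longlongrightarrow> pi\<^sup>2 *\<^sub>R (0 - L)) (at_right 0)"
        by (intro tendsto_intros Q)
      then have "((\<lambda>t. hilbert_trunc t f x) \<longlongrightarrow> - (pi\<^sup>2 *\<^sub>R L)) (at_right 0)" by simp
      then have "Lim (at_right 0) (\<lambda>t. hilbert_trunc t f x) = - (pi\<^sup>2 *\<^sub>R L)"
        by (intro tendsto_Lim) simp
      then have "hilbert f x = - L" by (simp add: hilbert_def)
      then show ?thesis using mL by (simp add: vector_smult_rneg)
    qed
  qed
qed

text \<open>Averaging the integrand over \<open>x\<close> and \<open>- x\<close> gives a function of constant sign.\<close>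

lemma cross_inner_nonzero:
  "integral\<^sup>L lborel (\<lambda>x :: real ^ 3. Qk 1 x * Pk 1 (x - axis 1 1) * x $ 1) \<noteq> 0" (is "?I \<noteq> 0")
proof
  assume I0: "?I = 0"
  let ?e = "axis 1 1 :: real ^ 3"
  let ?g = "\<lambda>x :: real ^ 3. Qk 1 x * Pk 1 (x - ?e) * x $ 1"
  define h where "h x = Qk 1 x * x $ 1 * (Pk 1 (x - ?e) - Pk 1 (x + ?e))" for x
  have Pe: "Pk 1 (- x - ?e) = Pk 1 (x + ?e)" for x
    using norm_minus_cancel[of "x + ?e"] by (simp add: Pk_def)
  have ig: "integrable lborel ?g"
  proof (rule Bochner_Integration.integrable_bound)
    show "integrable lborel (\<lambda>x. (norm x)\<^sup>2 * (Qk 1 x)\<^sup>2 + (Pk 1 (x - ?e))\<^sup>2)"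
      using Qk_square_integrable[of 1] Pk_square_integrable[of 1] integral_transl(2)[of "\<lambda>x. (Pk 1 x)\<^sup>2" ?e] by simp
    show "AE x in lborel. norm (?g x) \<le> norm ((norm x)\<^sup>2 * (Qk 1 x)\<^sup>2 + (Pk 1 (x - ?e))\<^sup>2)"
    proof (rule AE_I2)
      fix x :: "real ^ 3"
      have "\<bar>x $ 1\<bar> \<le> norm x" by (rule component_le_norm_cart)
      then have "(Qk 1 x * Pk 1 (x - ?e)) * \<bar>x $ 1\<bar> \<le> (Qk 1 x * Pk 1 (x - ?e)) * norm x" by (intro mult_left_mono) auto
      then show "norm (?g x) \<le> norm ((norm x)\<^sup>2 * (Qk 1 x)\<^sup>2 + (Pk 1 (x - ?e))\<^sup>2)"
        using abs_inner_le[of "Qk 1 x * norm x" "Pk 1 (x - ?e)"]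
        by (simp add: abs_mult power_mult_distrib mult_ac)
    qed
  qed simp
  have ig': "integrable lborel (\<lambda>x. ?g (- x))" "(LINT x|lborel. ?g (- x)) = 0"
    using integral_neg[of ?g] ig I0 by simp_all
  have hg: "h x = ?g x + ?g (- x)" for x
    by (simp only: Pe) (simp add: h_def Qk_def algebra_simps diff_divide_distrib)
  have ih: "integrable lborel h" "(LINT x|lborel. h x) = 0"
    unfolding hg using ig ig' I0 by simp_all
  have nrm: "(norm (x + ?e))\<^sup>2 - (norm (x - ?e))\<^sup>2 = 4 * x $ 1" for x
    by (simp add: power2_norm_eq_inner inner_simps inner_commute inner_axis inner_axis')
  have mono: "Pk 1 y \<le> Pk 1 x" if "norm x \<le> norm y" for x y
    unfolding Pk_def using that
    by (intro divide_left_mono mult_left_mono power_mono mult_pos_pos zero_less_power add_left_mono) (simp_all add: add_pos_nonneg)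
  have h0: "h x \<ge> 0" for x
  proof (cases "x $ 1 \<ge> 0")
    case True
    then have "(norm (x - ?e))\<^sup>2 \<le> (norm (x + ?e))\<^sup>2" using nrm[of x] by linarith
    then have "Pk 1 (x + ?e) \<le> Pk 1 (x - ?e)" using mono[OF power2_le_imp_le] by auto
    then show ?thesis using True by (simp add: h_def)
  next
    case False
    then have "(norm (x + ?e))\<^sup>2 \<le> (norm (x - ?e))\<^sup>2" using nrm[of x] by linarith
    then have "Pk 1 (x - ?e) - Pk 1 (x + ?e) \<le> 0" using mono[OF power2_le_imp_le, of "x + ?e" "x - ?e"] by auto
    moreover have "Qk 1 x * x $ 1 \<le> 0" using False by (intro mult_nonneg_nonpos) auto
    ultimately show ?thesis unfolding h_def by (intro mult_nonpos_nonpos)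
  qed
  \<comment> \<open>A nonnegative continuous function with integral 0 vanishes everywhere. At
    \<open>?e\<close> this would require the Poisson kernel to take equal values at 0 and at
    \<open>2 *\<^sub>R ?e\<close>.\<close>
  have "AE x in lborel. h x = 0" using ih h0 by (subst (asm) integral_nonneg_eq_0_iff_AE) auto
  then have "AE x in lebesgue. x \<in> {x. h x = 0}" using AE_completion by auto
  moreover have "closed {x. h x = 0}"
    unfolding h_def Qk_def Pk_def
    by (intro closed_Collect_eq continuous_intros) (auto simp: add_pos_nonneg less_imp_neq[symmetric] add_nonneg_eq_0_iff)
  ultimately have "h ?e = 0" using mem_closed_if_AE_lebesgue by blast
  then show False by (simp add: h_def Qk_def Pk_def axis_def norm_eq_sqrt_inner inner_vec3 field_simps)
qed

text \<open>Right multiplication by \<open>e\<close> mixes scalar and vector parts, so now the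
  pairings of unlike kernels survive. Translation along the same axis as \<open>e\<close> keeps
  those of like kernels zero: the triple product in the last one has two parallel vectors. The two
  mixed pairings have the same sign, so they add in the isometric case and do not cancel.\<close>

lemma cross_inner:
  fixes z w :: complex
  defines "e \<equiv> axis 1 1 :: biquat" and "b \<equiv> axis 1 1 :: real ^ 3"
  defines "I \<equiv> integral\<^sup>L lborel (\<lambda>x :: real ^ 3. Qk 1 x * Pk 1 (x - axis 1 1) * x $ 1)"
  shows "Pv 1 (cq z) \<bullet> transl b (Pv 1 (cq w \<odot> e)) = 0"
    and "Qv 1 (cq z) \<bullet> transl b (Pv 1 (cq w \<odot> e)) = Re (z * cnj w) * I"
    and "Pv 1 (cq z) \<bullet> transl b (Qv 1 (cq w \<odot> e)) = Re (z * cnj w) * I"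
    and "Qv 1 (cq z) \<bullet> transl b (Qv 1 (cq w \<odot> e)) = 0"
proof -
  note PL = Pv_L2[OF zero_less_one] and QL = Qv_L2[OF zero_less_one]
  have tP: "transl b (Pv 1 q) = cls (\<lambda>x. Pk 1 (x - b) *\<^sub>R q)" "(\<lambda>x. Pk 1 (x - b) *\<^sub>R q) \<in> L2" for q
    unfolding Pv_def using L2_transl[OF PL] by (auto simp only: transl_cls[OF PL])
  have tQ: "transl b (Qv 1 q) = cls (\<lambda>x. Qk 1 (x - b) *\<^sub>R (qvec (x - b) \<odot> q))"
    "(\<lambda>x. Qk 1 (x - b) *\<^sub>R (qvec (x - b) \<odot> q)) \<in> L2" for q
    unfolding Qv_def using L2_transl[OF QL] by (auto simp only: transl_cls[OF QL])
  have PP: "cq z \<bullet> (cq w \<odot> e) = 0"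
    by (simp add: e_def qinner cq_nth qmult_nth axis_def)
  have QP: "(qvec x \<odot> cq z) \<bullet> (cq w \<odot> e) = Re (z * cnj w) * x $ 1" for x
    by (simp add: e_def qinner cq_nth qmult_nth qvec_nth axis_def algebra_simps)
  have PQ: "cq z \<bullet> (qvec x \<odot> (cq w \<odot> e)) = - (Re (z * cnj w) * x $ 1)" for x
    by (simp add: e_def qinner cq_nth qmult_nth qvec_nth axis_def algebra_simps)
  have QQ: "(qvec x \<odot> cq z) \<bullet> (qvec (x - b) \<odot> (cq w \<odot> e)) = 0" for x
    by (simp add: e_def b_def qinner cq_nth qmult_nth qvec_nth axis_def algebra_simps)
  show "Pv 1 (cq z) \<bullet> transl b (Pv 1 (cq w \<odot> e)) = 0"
    unfolding tP(1) unfolding Pv_def by (subst inner_cls[OF PL tP(2)]) (simp add: PP)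
  show "Qv 1 (cq z) \<bullet> transl b (Qv 1 (cq w \<odot> e)) = 0"
    unfolding tQ(1) unfolding Qv_def by (subst inner_cls[OF QL tQ(2)]) (simp add: QQ)
  have "Qv 1 (cq z) \<bullet> transl b (Pv 1 (cq w \<odot> e))
    = (LINT x|lborel. Re (z * cnj w) * (Qk 1 x * Pk 1 (x - axis 1 1) * x $ 1))"
    unfolding tP(1) unfolding Qv_def
    by (subst inner_cls[OF QL tP(2)])
      (simp only: inner_scaleR_left inner_scaleR_right QP b_def mult_ac)
  then show "Qv 1 (cq z) \<bullet> transl b (Pv 1 (cq w \<odot> e)) = Re (z * cnj w) * I"
    unfolding I_def by (simp only: integral_mult_right_zero)
  \<comment> \<open>After a shift by \<open>b\<close>, the reflection of \<open>x\<close> restores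
    the integrand of \<open>I\<close>; the odd factor \<open>x $ 1\<close> absorbs the minus sign
    from \<open>PQ\<close>.\<close>
  let ?G = "\<lambda>x. - (Re (z * cnj w) * (Pk 1 (x + b) * Qk 1 x * x $ 1))"
  have Pb: "Pk 1 (b - x) = Pk 1 (x - b)" for x by (simp add: Pk_def norm_minus_commute)
  have Q: "Qk 1 (- x) = Qk 1 x" for x by (simp add: Qk_def)
  have "Pv 1 (cq z) \<bullet> transl b (Qv 1 (cq w \<odot> e)) = (LINT x|lborel. ?G (x - b))"
    unfolding tQ(1) unfolding Pv_def
    by (subst inner_cls[OF PL tQ(2)])
      (simp only: inner_scaleR_left inner_scaleR_right PQ diff_add_cancel mult_ac mult_minus_right)
  also have "\<dots> = (LINT x|lborel. ?G x)" by (rule integral_add_arg) simp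
  also have "\<dots> = (LINT x|lborel. ?G (- x))" by (rule integral_neg(1)[symmetric]) simp
  also have "\<dots> = (LINT x|lborel. Re (z * cnj w) * (Qk 1 x * Pk 1 (x - axis 1 1) * x $ 1))"
    by (intro Bochner_Integration.integral_cong refl) (simp add: Q Pb[unfolded b_def] b_def)
  finally show "Pv 1 (cq z) \<bullet> transl b (Qv 1 (cq w \<odot> e)) = Re (z * cnj w) * I"
    unfolding I_def by (simp only: integral_mult_right_zero)
qed

text \<open>Over the complex scalars the two kernels are orthogonal and equally long, so the
  isometry condition on \<open>Pv 1 (cq 1)\<close> is an equation for the squared moduli of
  \<open>l\<close> and \<open>m\<close>.\<close>

lemma Pv_Qv_inner:
  fixes z w :: complex
  defines "p \<equiv> LINT x|lborel. (Pk 1 x)\<^sup>2"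
  shows "Pv 1 (cq z) \<bullet> Pv 1 (cq w) = Re (z * cnj w) * p"
    and "Qv 1 (cq z) \<bullet> Qv 1 (cq w) = Re (z * cnj w) * p"
    and "Pv 1 (cq z) \<bullet> Qv 1 (cq w) = 0" and "p > 0"
proof -
  note PL = Pv_L2[OF zero_less_one] and QL = Qv_L2[OF zero_less_one]
  show "Pv 1 (cq z) \<bullet> Pv 1 (cq w) = Re (z * cnj w) * p"
    unfolding Pv_def inner_cls[OF PL PL] p_def integral_mult_right_zero[symmetric]
    by (intro Bochner_Integration.integral_cong refl)
      (simp only: inner_scaleR_left inner_scaleR_right inner_cq power2_eq_square mult_ac)
  have pq: "p = (LINT x|lborel. (norm x)\<^sup>2 * (Qk 1 x)\<^sup>2)"
    using nn_integral_Pk_square by (simp add: p_def integral_eq_nn_integral)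
  show "Qv 1 (cq z) \<bullet> Qv 1 (cq w) = Re (z * cnj w) * p"
    unfolding Qv_def inner_cls[OF QL QL] pq integral_mult_right_zero[symmetric]
    by (intro Bochner_Integration.integral_cong refl)
      (simp only: inner_scaleR_left inner_scaleR_right inner_qvec_cq power2_eq_square mult_ac)
  show "Pv 1 (cq z) \<bullet> Qv 1 (cq w) = 0"
    unfolding Pv_def Qv_def inner_cls[OF PL QL]
    by (simp only: inner_scaleR_left inner_scaleR_right inner_cq_qvec) simp
  have "p \<noteq> 0"
  proof
    assume "p = 0"
    then have "AE x in lborel. (Pk 1 x)\<^sup>2 = 0"
      unfolding p_def by (subst (asm) integral_nonneg_eq_0_iff_AE) (auto simp: Pk_square_integrable)
    then have "AE x :: real ^ 3 in lborel. False"
      by (rule eventually_mono) (use Pk_pos[of 1] in \<open>simp add: less_imp_neq[symmetric]\<close>)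
    then show False using ae_filter_eq_bot_iff[of "lborel :: (real ^ 3) measure"] by (simp add: eventually_False)
  qed
  moreover have "p \<ge> 0" unfolding p_def by simp
  ultimately show "p > 0" by simp
qed

text \<open>The translate by \<open>e\<^sub>1\<close> of the Poisson kernel times \<open>e\<^sub>1\<close> is orthogonal to the Poisson kernel but
  not to its Hilbert transform; testing against it detects \<open>Im m\<close> and the product of \<open>l\<close> and \<open>m\<close>.\<close>

lemma selfadjoint_isometric_coefficients:
  assumes A: "intertwiner A" and lm: "A (Pv 1 (cq 1)) = Pv 1 (cq l) + Qv 1 (cq m)"
    and sa: "\<And>u v. A u \<bullet> v = u \<bullet> A v" and iso: "\<And>u. norm (A u) = norm u"
  shows "m = 0 \<and> (l = 1 \<or> l = - 1) \<or> l = 0 \<and> (m = 1 \<or> m = - 1)"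
proof -
  let ?p = "LINT x|lborel. (Pk 1 x)\<^sup>2"
  let ?I = "integral\<^sup>L lborel (\<lambda>x :: real ^ 3. Qk 1 x * Pk 1 (x - axis 1 1) * x $ 1)"
  let ?e = "axis 1 1 :: biquat" and ?b = "axis 1 1 :: real ^ 3"
  note lin = intertwinerD(1)[OF A]
  have inn: "A u \<bullet> A v = u \<bullet> v" for u v
    using iso[of "u + v"] by (simp add: dot_norm linear_add[OF lin] iso del: norm_add_square_le)
  have Ap: "A (transl b (Pv 1 q)) = transl b (Pv 1 (cq l \<odot> q)) + transl b (Qv 1 (cq m \<odot> q))" for b q
    by (simp add: intertwiner_Pv[OF A lm] linear_add[OF linear_transl])
  have cqm: "cq x \<odot> cq y = cq (x * y)" "cq x \<odot> (cq y \<odot> q) = cq (x * y) \<odot> q" for x y q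
    by (simp_all add: cq_mult biquat_eq_iff cq_nth)
  have sym: "Qv 1 (cq z) \<bullet> Pv 1 (cq w) = 0" for z w
    by (metis Pv_Qv_inner(3) inner_commute)
  \<comment> \<open>Only the real inner product is at hand, so the factor \<open>\<i>\<close> in one
    argument is needed to see the imaginary part. The translation by 0 brings the vector into the
    form of \<open>Ap\<close>.\<close>
  have "Im l * ?p = - (Im l * ?p)"
    using sa[of "Pv 1 (cq 1)" "transl 0 (Pv 1 (cq \<i>))"] unfolding Ap lm
    by (simp add: cqm inner_simps Pv_Qv_inner sym)
  then have l: "Im l = 0" using Pv_Qv_inner(4) by simp
  have "(Re l)\<^sup>2 * ?p + (Im l)\<^sup>2 * ?p + (Re m)\<^sup>2 * ?p + (Im m)\<^sup>2 * ?p = ?p"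
    using inn[of "Pv 1 (cq 1)" "Pv 1 (cq 1)"] unfolding lm
    by (simp add: inner_simps Pv_Qv_inner sym power2_eq_square algebra_simps)
  then have "((Re l)\<^sup>2 + (Im l)\<^sup>2 + (Re m)\<^sup>2 + (Im m)\<^sup>2 - 1) * ?p = 0" by (simp add: algebra_simps)
  then have n: "(Re l)\<^sup>2 + (Im l)\<^sup>2 + (Re m)\<^sup>2 + (Im m)\<^sup>2 = 1" using Pv_Qv_inner(4) by simp
  \<comment> \<open>The same test for \<open>m\<close> against the translated kernel, which pairs to
    0 with the Poisson kernel but to a nonzero multiple of \<open>?I\<close> with its
    conjugate.\<close>
  have "Im m * ?I = - (Im m * ?I)"
    using sa[of "Pv 1 (cq 1)" "transl ?b (Pv 1 (cq \<i> \<odot> ?e))"] unfolding Ap lm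
    by (simp add: cqm inner_simps cross_inner)
  then have m: "Im m = 0" using cross_inner_nonzero by simp
  \<comment> \<open>The two test vectors are orthogonal and an isometry keeps them so. The images
    pair to twice the mixed product of the coefficients.\<close>
  have "2 * (Re l * Re m + Im l * Im m) * ?I = 0"
    using inn[of "Pv 1 (cq 1)" "transl ?b (Pv 1 (cq 1 \<odot> ?e))"] unfolding Ap lm
    by (simp only: cqm inner_simps cross_inner) (simp add: algebra_simps)
  then have "Re l = 0 \<or> Re m = 0" using cross_inner_nonzero l m by simp
  then show ?thesis using n l m by (auto simp: complex_eq_iff power2_eq_1_iff)
qed

section \<open>From representatives to classes\<close>

definition lift :: "((real ^ 3 \<Rightarrow> biquat) \<Rightarrow> real ^ 3 \<Rightarrow> biquat) \<Rightarrow> Ltwo \<Rightarrow> Ltwo" where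
  "lift T u = cls (T (fun_of u))"

lemma lift_cls:
  assumes "L2_linear_operator T" "f \<in> L2"
  shows "lift T (cls f) = cls (T f)"
  using assms fun_of_cls[OF assms(2)] unfolding lift_def L2_linear_operator_def
  by (subst cls_eq_iff) auto

lemma intertwiner_lift:
  assumes T: "L2_linear_operator T" and c: "commutes_with_rep T"
  shows "intertwiner (lift T)"
proof -
  note lc = lift_cls[OF T]
  have TL: "T f \<in> L2" if "f \<in> L2" for f using T that by (simp add: L2_linear_operator_def)
  have add: "lift T (u + v) = lift T u + lift T v" for u v
  proof -
    obtain f g where f: "f \<in> L2" "u = cls f" and g: "g \<in> L2" "v = cls g" by (metis Ltwo_cases)
    have "T (\<lambda>x. f x + g x) =ae (\<lambda>x. T f x + T g x)" using T f g by (simp add: L2_linear_operator_def)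
    then show ?thesis unfolding f g using f g
      by (simp add: cls_add lc TL L2_add cls_eq_iff)
  qed
  have rm: "lift T (rmul u q) = rmul (lift T u) q" for u q
  proof -
    obtain f where f: "f \<in> L2" "u = cls f" by (metis Ltwo_cases)
    have "T (\<lambda>x. f x \<odot> q) =ae (\<lambda>x. T f x \<odot> q)" using T f by (simp add: L2_linear_operator_def)
    then show ?thesis unfolding f using f
      by (simp add: rmul_cls lc TL L2_rmul cls_eq_iff)
  qed
  \<comment> \<open>Real homogeneity is the special case of right linearity for a real scalar
    quaternion.\<close>
  have "lift T (c *\<^sub>R u) = c *\<^sub>R lift T u" for c u
    using rm[of u "c *\<^sub>R axis 0 1"] by (simp add: rmul_scaleR_right)
  then have "linear (lift T)" by (intro linearI add)
  moreover have "lift T (U g u) = U g (lift T u)" if g: "g \<in> GG" for g u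
  proof -
    obtain f where f: "f \<in> L2" "u = cls f" by (metis Ltwo_cases)
    have "T (natural_rep g f) =ae natural_rep g (T f)" using c f g by (simp add: commutes_with_rep_def)
    then show ?thesis unfolding f using f g
      by (simp add: U_cls lc TL natural_rep_L2 cls_eq_iff)
  qed
  ultimately show ?thesis using rm by (simp add: intertwiner_def)
qed

lemma Re_L2_inner:
  assumes f: "f \<in> L2" and g: "g \<in> L2"
  shows "Re (L2_inner f g) = cls f \<bullet> cls g"
proof -
  have [measurable]: "f \<in> borel_measurable borel" "g \<in> borel_measurable borel"
    using f g by (auto intro: L2_measurable)
  have "integrable lborel (\<lambda>x. \<Sum>j\<in>UNIV. f x $ j * cnj (g x $ j))"
  proof (intro Bochner_Integration.integrable_sum)
    fix j :: 4
    show "integrable lborel (\<lambda>x. f x $ j * cnj (g x $ j))"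
    proof (rule Bochner_Integration.integrable_bound)
      show "integrable lborel (\<lambda>x. (norm (f x))\<^sup>2 + (norm (g x))\<^sup>2)"
        using f g by (simp add: L2_integrable)
      show "(\<lambda>x. f x $ j * cnj (g x $ j)) \<in> borel_measurable lborel"
        by (intro borel_measurable_times borel_measurable_continuous_on[OF linear_continuous_on[OF bounded_linear_cnj]]
            borel_measurable_continuous_on[OF linear_continuous_on[OF bounded_linear_vec_nth]]) simp_all
      show "AE x in lborel. norm (f x $ j * cnj (g x $ j)) \<le> norm ((norm (f x))\<^sup>2 + (norm (g x))\<^sup>2)"
      proof (rule AE_I2)
        fix x
        have "norm (f x $ j * cnj (g x $ j)) \<le> norm (f x) * norm (g x)"
          by (simp add: norm_mult mult_mono Finite_Cartesian_Product.norm_nth_le)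
        also have "\<dots> \<le> (norm (f x))\<^sup>2 + (norm (g x))\<^sup>2"
          using abs_inner_le[of "norm (f x)" "norm (g x)"] by simp
        finally show "norm (f x $ j * cnj (g x $ j)) \<le> norm ((norm (f x))\<^sup>2 + (norm (g x))\<^sup>2)" by simp
      qed
    qed
  qed
  then show ?thesis
    unfolding L2_inner_def inner_cls[OF f g]
    by (subst integral_Re[symmetric]) (simp_all add: sum_index4 qinner)
qed

lemma L2_norm_cls: "f \<in> L2 \<Longrightarrow> L2_norm f = norm (cls f)"
  by (simp add: L2_norm_def norm_cls_square[symmetric])

theorem theorem5p11:
  fixes T :: "(real ^ 3 \<Rightarrow> biquat) \<Rightarrow> real ^ 3 \<Rightarrow> biquat"
  assumes "L2_linear_operator T"
    and "commutes_with_rep T"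
  shows "(\<exists>l \<mu> :: complex. \<forall>f\<in>L2. T f =ae (\<lambda>x. l *s f x + \<mu> *s hilbert f x)) \<and>
    (L2_selfadjoint T \<and> L2_norm_preserving T \<longrightarrow>
       (\<forall>f\<in>L2. T f =ae f) \<or> (\<forall>f\<in>L2. T f =ae (\<lambda>x. - f x)) \<or>
       (\<forall>f\<in>L2. T f =ae hilbert f) \<or> (\<forall>f\<in>L2. T f =ae (\<lambda>x. - hilbert f x)))"
proof -
  note lc = lift_cls[OF assms(1)]
  have TL: "T f \<in> L2" if "f \<in> L2" for f using assms(1) that by (simp add: L2_linear_operator_def)
  have lT: "intertwiner (lift T)" by (rule intertwiner_lift[OF assms])
  obtain A where A: "intertwiner A" and adj: "\<And>u v. lift T u \<bullet> v = u \<bullet> A v"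
    using intertwiner_adjoint[OF lT] by blast
  obtain l m where lm: "A (Pv 1 (cq 1)) = Pv 1 (cq l) + Qv 1 (cq m)"
    using intertwiner_Poisson_eq[OF lT A adj] by blast
  have form: "T f =ae (\<lambda>x. cnj l *s f x + cnj m *s hilbert f x)" if "f \<in> L2" for f
    by (rule intertwiner_representation[OF A adj lm that TL[OF that] lc[OF that]])
  moreover have "(\<forall>f\<in>L2. T f =ae f) \<or> (\<forall>f\<in>L2. T f =ae (\<lambda>x. - f x)) \<or>
       (\<forall>f\<in>L2. T f =ae hilbert f) \<or> (\<forall>f\<in>L2. T f =ae (\<lambda>x. - hilbert f x))"
    if sa: "L2_selfadjoint T" and iso: "L2_norm_preserving T"
  proof -
    have saT: "lift T u \<bullet> v = u \<bullet> lift T v" for u v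
    proof -
      obtain f g where f: "f \<in> L2" "u = cls f" and g: "g \<in> L2" "v = cls g" by (metis Ltwo_cases)
      have "L2_inner (T f) g = L2_inner f (T g)" using sa f g by (simp add: L2_selfadjoint_def)
      then show ?thesis using f g by (simp add: lc Re_L2_inner[symmetric] TL)
    qed
    \<comment> \<open>Identifies the operator with its adjoint, so the isometry assumed of
      \<open>T\<close> and the coefficients found for \<open>A\<close> belong to one
      operator.\<close>
    have AT: "A = lift T"
    proof
      fix v show "A v = lift T v"
        using adj[of _ v] saT[of _ v] by (subst vector_eq_ldot[symmetric]) simp
    qed
    have "norm (A u) = norm u" for u
    proof -
      obtain f where f: "f \<in> L2" "u = cls f" by (metis Ltwo_cases)
      then show ?thesis using iso unfolding AT
        by (simp add: lc L2_norm_cls[symmetric] TL L2_norm_preserving_def)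
    qed
    then have "m = 0 \<and> (l = 1 \<or> l = - 1) \<or> l = 0 \<and> (m = 1 \<or> m = - 1)"
      using saT unfolding AT[symmetric] by (intro selfadjoint_isometric_coefficients[OF A lm])
    \<comment> \<open>All admissible coefficients are 0, 1 or -1, so the conjugations in
      \<open>form\<close> have no effect.\<close>
    then show ?thesis using form by (elim disjE conjE) (simp_all add: vector_smult_lneg)
  qed
  ultimately show ?thesis by blast
qed

end
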